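(* Let $\mathcal{C}$ and $\mathcal{D}$ be connected graded coalgebras over $\mathbb{K}$. If $\mathcal{C}$ and $\mathcal{D}$ are cofree coalgebras, then the composition $\mathcal{D}\circ\mathcal{C}$ is also a cofree coalgebra. Its space of primitive elements is spanned by the decomposable tensors of the forms $$\delta\circ(1\cdot c_1\cdot\dotsb\cdot c_{n-1}\cdot 1)\qquad\text{and}\qquad 1\circ(\gamma),$$ where $\gamma, c_1,\dots,c_{n-1}\in\mathcal{C}$ and $\delta\in\mathcal{D}_n$ ($n\ge 1$), with $\gamma$ and $\delta$ primitive.
   Context: $\mathbb{K}$ is a field of characteristic zero. A graded coalgebra is a vector space $\mathcal{C}=\bigoplus_{n\ge0}\mathcal{C}_n$ with a coassociative coproduct $\Delta$ satisfying $\Delta(\mathcal{C}_n)\subseteq\bigoplus_{i+j=n}\mathcal{C}_i\otimes\mathcal{C}_j$ and a counit $\varepsilon$ vanishing on $\mathcal{C}_n$ for $n>0$; write $|c|=n$ if $c\in\mathcal{C}_n$, and $\Delta(c)=\sum_{(c)}c'\otimes c''$ (Sweedler notation). It is connected if $\mathcal{C}_0=\mathbb{K}$; then $1\in\mathcal{C}_0$ denotes the element with $\varepsilon(1)=1$. An element $x$ is primitive if $\Delta(x)=1\otimes x+x\otimes 1$. The cofree coalgebra on a vector space $V$ is $\mathsf{C}(V)=\bigoplus_{n\ge0}V^{\otimes n}$ with the deconcatenation coproduct $\Delta(v_1\backslash\dotsb\backslash v_n)=\sum_{i=0}^n (v_1\backslash\dotsb\backslash v_i)\otimes(v_{i+1}\backslash\dotsb\backslash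 v_n)$ (where $\backslash$ denotes the tensor product in $V^{\otimes n}$) and counit the projection onto $V^{\otimes 0}=\mathbb{K}$. A coalgebra is cofree if it is isomorphic, as a coalgebra, to $\mathsf{C}(V)$ for a subspace $V$, necessarily its space of primitive elements. The composition of graded coalgebras $\mathcal{C},\mathcal{D}$ is the vector space $\mathcal{D}\circ\mathcal{C}=\bigoplus_{n\ge0}\mathcal{D}_n\otimes\mathcal{C}^{\otimes(n+1)}$. For $d\in\mathcal{D}_n$ and $c_0,\dots,c_n\in\mathcal{C}$, the corresponding decomposable tensor is written $d\circ(c_0\cdot\dotsb\cdot c_n)$. The coproduct is $$\Delta\bigl(d\circ(c_0\cdot\dotsb\cdot c_n)\bigr)=\sum_{i=0}^n\ \sum_{(d),\,|d'|=i}\ \sum_{(c_i)} \bigl(d'\circ(c_0\cdot\dotsb\cdot c_{i-1}\cdot c_i')\bigr)\otimes\bigl(d''\circ(c_i''\cdot c_{i+1}\cdot\dotsb\cdot c_n)\bigr),$$ where the sum over $(d)$ with $|d'|=i$ is over the component of $\Delta(d)$ in $\mathcal{D}_i\otimes\mathcal{D}_{n-i}$; the counit is $\varepsilon(d\circ(c_0\cdot\dotsb\cdot c_n))=\varepsilon_{\mathcal D}(d)\prod_j\varepsilon_{\mathcal C}(c_j)$. *)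

theory Defs
  imports Complex_Main "HOL-Library.Function_Algebras"
begin

section \<open>Vector spaces and tensor products\<close>

text \<open>
  A vector space is given by a subspace \<open>carrier\<close> of a type that is a vector space, in the
  sense of \<^theory>\<open>HOL.Vector_Spaces\<close>, under the scalar multiplication \<open>scal\<close>.
\<close>

record ('k, 'v) vspace =
  carrier :: "'v set"
  scal :: "'k \<Rightarrow> 'v \<Rightarrow> 'v"

definition is_vspace :: "('k::field, 'v::ab_group_add, 'm) vspace_scheme \<Rightarrow> bool" where
  "is_vspace V \<longleftrightarrow> vector_space (scal V) \<and> module.subspace (scal V) (carrier V)"

definition linear_on ::
    "('k::field, 'v::ab_group_add, 'm) vspace_scheme \<Rightarrow> ('k, 'w::ab_group_add, 'n) vspace_scheme \<Rightarrow> ('v \<Rightarrow> 'w) \<Rightarrow> bool" where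
  "linear_on V W f \<longleftrightarrow>
     (\<forall>x\<in>carrier V. f x \<in> carrier W) \<and>
     (\<forall>x\<in>carrier V. \<forall>y\<in>carrier V. f (x + y) = f x + f y) \<and>
     (\<forall>a. \<forall>x\<in>carrier V. f (scal V a x) = scal W a (f x))"

definition ground :: "('k::field, 'k) vspace" where
  "ground = \<lparr>carrier = UNIV, scal = (*)\<rparr>"

definition fscale :: "'k::field \<Rightarrow> ('x \<Rightarrow> 'k) \<Rightarrow> ('x \<Rightarrow> 'k)" where
  "fscale a f = (\<lambda>x. a * f x)"

text \<open>
  Tensors are realised as functionals on multilinear forms: the decomposable tensor of \<open>v\<close>
  and \<open>w\<close> is evaluation \<open>B \<mapsto> B v w\<close> on bilinear forms \<open>B\<close> (and \<open>0\<close> on functions that are not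
  bilinear), and the tensor product is the linear span of the decomposable tensors. Over a
  field this is a model of the tensor product; its universal property is \<open>tens_bilinear\<close> and
  \<open>tens_universal\<close> below.
\<close>

definition bilinear_form ::
    "('k::field, 'v::ab_group_add, 'm) vspace_scheme \<Rightarrow> ('k, 'w::ab_group_add, 'n) vspace_scheme \<Rightarrow> ('v \<Rightarrow> 'w \<Rightarrow> 'k) \<Rightarrow> bool" where
  "bilinear_form V W B \<longleftrightarrow>
     (\<forall>w\<in>carrier W. linear_on V ground (\<lambda>v. B v w)) \<and> (\<forall>v\<in>carrier V. linear_on W ground (\<lambda>w. B v w))"

type_synonym ('k, 'v, 'w) tensor = "('v \<Rightarrow> 'w \<Rightarrow> 'k) \<Rightarrow> 'k"

definition tens ::
    "('k::field, 'v::ab_group_add, 'm) vspace_scheme \<Rightarrow> ('k, 'w::ab_group_add, 'n) vspace_scheme \<Rightarrow>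
     'v \<Rightarrow> 'w \<Rightarrow> ('k, 'v, 'w) tensor" where
  "tens V W v w = (\<lambda>B. if bilinear_form V W B then B v w else 0)"

text \<open>\<open>tensor_span V W S T\<close> is \<open>S \<otimes> T\<close> as a subspace of \<open>V \<otimes> W\<close>, for subspaces \<open>S\<close> and \<open>T\<close>.\<close>

definition tensor_span ::
    "('k::field, 'v::ab_group_add, 'm) vspace_scheme \<Rightarrow> ('k, 'w::ab_group_add, 'n) vspace_scheme \<Rightarrow>
     'v set \<Rightarrow> 'w set \<Rightarrow> ('k, 'v, 'w) tensor set" where
  "tensor_span V W S T = module.span fscale {tens V W v w | v w. v \<in> S \<and> w \<in> T}"

definition tensor_prod ::
    "('k::field, 'v::ab_group_add, 'm) vspace_scheme \<Rightarrow> ('k, 'w::ab_group_add, 'n) vspace_scheme \<Rightarrow>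
     ('k, ('k, 'v, 'w) tensor) vspace" where
  "tensor_prod V W = \<lparr>carrier = tensor_span V W (carrier V) (carrier W), scal = fscale\<rparr>"

text \<open>
  The linear map induced by a bilinear map \<open>f\<close> with values in a space of functions, given by
  \<open>lift f (v \<otimes> w) = f v w\<close> (lemma \<open>lift_tens\<close>). For a coproduct \<open>\<Delta>\<close>, \<open>lift f (\<Delta> c)\<close> is the
  Sweedler sum of the \<open>f c' c''\<close>.
\<close>

definition lift :: "('v \<Rightarrow> 'w \<Rightarrow> 'x \<Rightarrow> 'k) \<Rightarrow> ('k, 'v, 'w) tensor \<Rightarrow> 'x \<Rightarrow> 'k" where
  "lift f t = (\<lambda>x. t (\<lambda>v w. f v w x))"

text \<open>\<open>tensor_map V W f g\<close> is \<open>f \<otimes> g\<close>, where \<open>V\<close> and \<open>W\<close> are the codomains of \<open>f\<close> and \<open>g\<close>.\<close>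

definition tensor_map ::
    "('k::field, 'a::ab_group_add, 'm) vspace_scheme \<Rightarrow> ('k, 'b::ab_group_add, 'n) vspace_scheme \<Rightarrow>
     ('v \<Rightarrow> 'a) \<Rightarrow> ('w \<Rightarrow> 'b) \<Rightarrow> ('k, 'v, 'w) tensor \<Rightarrow> ('k, 'a, 'b) tensor" where
  "tensor_map V W f g = lift (\<lambda>v w. tens V W (f v) (g w))"

definition tensor_assoc ::
    "('k::field, 'u::ab_group_add, 'l) vspace_scheme \<Rightarrow> ('k, 'v::ab_group_add, 'm) vspace_scheme \<Rightarrow>
     ('k, 'w::ab_group_add, 'n) vspace_scheme \<Rightarrow>
     ('k, ('k, 'u, 'v) tensor, 'w) tensor \<Rightarrow> ('k, 'u, ('k, 'v, 'w) tensor) tensor" where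
  "tensor_assoc U V W =
     lift (\<lambda>p w. lift (\<lambda>u v. tens U (tensor_prod V W) u (tens V W v w)) p)"

text \<open>
  Tensor powers. A function \<open>M\<close> on lists with \<open>multilinear_form V M\<close> is a family consisting
  of one \<open>n\<close>-linear form for each \<open>n\<close>, with no relation between different \<open>n\<close>. Hence the spaces
  \<open>tensor_power V n\<close> for the various \<open>n\<close> form a direct sum, which is \<open>tensor_alg V\<close>.
\<close>

definition multilinear_form :: "('k::field, 'v::ab_group_add, 'm) vspace_scheme \<Rightarrow> ('v list \<Rightarrow> 'k) \<Rightarrow> bool" where
  "multilinear_form V M \<longleftrightarrow>
     (\<forall>xs ys. set xs \<subseteq> carrier V \<longrightarrow> set ys \<subseteq> carrier V \<longrightarrow> linear_on V ground (\<lambda>v. M (xs @ v # ys)))"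

type_synonym ('k, 'v) words = "('v list \<Rightarrow> 'k) \<Rightarrow> 'k"

definition word :: "('k::field, 'v::ab_group_add, 'm) vspace_scheme \<Rightarrow> 'v list \<Rightarrow> ('k, 'v) words" where
  "word V vs = (\<lambda>M. if multilinear_form V M then M vs else 0)"

definition tensor_power :: "('k::field, 'v::ab_group_add, 'm) vspace_scheme \<Rightarrow> nat \<Rightarrow> ('k, 'v) words set" where
  "tensor_power V n = module.span fscale {word V vs | vs. set vs \<subseteq> carrier V \<and> length vs = n}"

definition tensor_alg :: "('k::field, 'v::ab_group_add, 'm) vspace_scheme \<Rightarrow> ('k, ('k, 'v) words) vspace" where
  "tensor_alg V = \<lparr>carrier = module.span fscale (\<Union>n. tensor_power V n), scal = fscale\<rparr>"

definition word_lift :: "('v list \<Rightarrow> 'x \<Rightarrow> 'k) \<Rightarrow> ('k, 'v) words \<Rightarrow> 'x \<Rightarrow> 'k" where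
  "word_lift f t = (\<lambda>x. t (\<lambda>vs. f vs x))"


section \<open>Coalgebras\<close>

record ('k, 'v) coalg = "('k, 'v) vspace" +
  coprod :: "'v \<Rightarrow> ('k, 'v, 'v) tensor"
  counit :: "'v \<Rightarrow> 'k"

text \<open>In the counit axioms, \<open>K \<otimes> A\<close> and \<open>A \<otimes> K\<close> are identified with \<open>A\<close> by \<open>1 \<otimes> x = x = x \<otimes> 1\<close>.\<close>

locale coalgebra =
  fixes A :: "('k::field, 'v::ab_group_add, 'm) coalg_scheme"
  assumes is_vspace: "is_vspace A"
    and linear_coprod: "linear_on A (tensor_prod A A) (coprod A)"
    and linear_counit: "linear_on A ground (counit A)"
    and coassoc: "x \<in> carrier A \<Longrightarrow>
      tensor_assoc A A A (tensor_map (tensor_prod A A) A (coprod A) id (coprod A x))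
      = tensor_map A (tensor_prod A A) id (coprod A) (coprod A x)"
    and counit_left: "x \<in> carrier A \<Longrightarrow> tensor_map ground A (counit A) id (coprod A x) = tens ground A 1 x"
    and counit_right: "x \<in> carrier A \<Longrightarrow> tensor_map A ground id (counit A) (coprod A x) = tens A ground x 1"

definition coalg_iso ::
    "('k::field, 'v::ab_group_add, 'm) coalg_scheme \<Rightarrow> ('k, 'w::ab_group_add, 'n) coalg_scheme \<Rightarrow> ('v \<Rightarrow> 'w) \<Rightarrow> bool" where
  "coalg_iso A B \<phi> \<longleftrightarrow>
     linear_on A B \<phi> \<and> bij_betw \<phi> (carrier A) (carrier B) \<and>
     (\<forall>x\<in>carrier A. coprod B (\<phi> x) = tensor_map B B \<phi> \<phi> (coprod A x)) \<and>
     (\<forall>x\<in>carrier A. counit B (\<phi> x) = counit A x)"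

text \<open>\<open>primitive A e x\<close>: the element \<open>x\<close> is primitive, where \<open>e\<close> is the element called \<open>1\<close> of \<open>A\<close>.\<close>

definition primitive :: "('k::field, 'v::ab_group_add, 'm) coalg_scheme \<Rightarrow> 'v \<Rightarrow> 'v \<Rightarrow> bool" where
  "primitive A e x \<longleftrightarrow> x \<in> carrier A \<and> coprod A x = tens A A e x + tens A A x e"

text \<open>The coalgebra \<open>C(V)\<close>. Its structure maps are computed on words \<open>v\<^sub>1 \ \<dots> \ v\<^sub>n\<close> in
  \<open>cofree_coalg_coprod\<close> and \<open>cofree_coalg_counit\<close>.\<close>

definition cofree_coalg :: "('k::field, 'v::ab_group_add, 'm) vspace_scheme \<Rightarrow> ('k, ('k, 'v) words) coalg" where
  "cofree_coalg V = \<lparr>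
     carrier = carrier (tensor_alg V),
     scal = scal (tensor_alg V),
     coprod = word_lift (\<lambda>vs. \<Sum>i\<le>length vs.
       tens (tensor_alg V) (tensor_alg V) (word V (take i vs)) (word V (drop i vs))),
     counit = (\<lambda>t. t (\<lambda>vs. if vs = [] then 1 else 0))\<rparr>"

definition cofree :: "('k::field, 'v::ab_group_add, 'm) coalg_scheme \<Rightarrow> bool" where
  "cofree A \<longleftrightarrow> coalgebra A \<and>
     (\<exists>V \<phi>. module.subspace (scal A) V \<and> V \<subseteq> carrier A \<and>
        coalg_iso A (cofree_coalg \<lparr>carrier = V, scal = scal A\<rparr>) \<phi>)"


section \<open>Graded coalgebras\<close>

definition decomposes :: "(nat \<Rightarrow> 'v::ab_group_add set) \<Rightarrow> 'v \<Rightarrow> (nat \<Rightarrow> 'v) \<Rightarrow> bool" where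
  "decomposes G x f \<longleftrightarrow> (\<forall>n. f n \<in> G n) \<and> finite {n. f n \<noteq> 0} \<and> x = (\<Sum>n | f n \<noteq> 0. f n)"

definition component :: "(nat \<Rightarrow> 'v::ab_group_add set) \<Rightarrow> nat \<Rightarrow> 'v \<Rightarrow> 'v" where
  "component G n x = (THE f. decomposes G x f) n"

record ('k, 'v) graded_coalg = "('k, 'v) coalg" +
  grade :: "nat \<Rightarrow> 'v set"

locale graded_coalgebra = coalgebra A
  for A :: "('k::field, 'v::ab_group_add, 'm) graded_coalg_scheme" +
  assumes subspace_grade: "module.subspace (scal A) (grade A n)"
    and grade_subset: "grade A n \<subseteq> carrier A"
    and direct_sum: "x \<in> carrier A \<Longrightarrow> \<exists>!f. decomposes (grade A) x f"
    and coprod_grade: "x \<in> grade A n \<Longrightarrow>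
      coprod A x \<in> module.span fscale (\<Union>i\<le>n. tensor_span A A (grade A i) (grade A (n - i)))"
    and counit_grade: "x \<in> grade A n \<Longrightarrow> n > 0 \<Longrightarrow> counit A x = 0"

locale connected_graded_coalgebra = graded_coalgebra +
  assumes connected: "vector_space.dim (scal A) (grade A 0) = 1"

text \<open>The element \<open>1\<close> of a connected graded coalgebra.\<close>

definition unit_elt :: "('k::field, 'v::ab_group_add, 'm) graded_coalg_scheme \<Rightarrow> 'v" where
  "unit_elt A = (THE x. x \<in> grade A 0 \<and> counit A x = 1)"


section \<open>Composition of graded coalgebras\<close>

text \<open>\<open>circ D C d [c\<^sub>0, \<dots>, c\<^sub>n]\<close> is \<open>d \<circ> (c\<^sub>0 \<cdot> \<dots> \<cdot> c\<^sub>n)\<close>.\<close>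

definition circ ::
    "('k::field, 'd::ab_group_add, 'm) graded_coalg_scheme \<Rightarrow> ('k, 'c::ab_group_add, 'n) graded_coalg_scheme \<Rightarrow>
     'd \<Rightarrow> 'c list \<Rightarrow> ('k, 'd, ('k, 'c) words) tensor" where
  "circ D C d cs = tens D (tensor_alg C) d (word C cs)"

text \<open>The direct sum of the spaces \<open>D\<^sub>n \<otimes> C\<^bsup>\<otimes>(n+1)\<^esup>\<close>, as a subspace of \<open>D \<otimes> tensor_alg C\<close>.\<close>

definition comp_space ::
    "('k::field, 'd::ab_group_add, 'm) graded_coalg_scheme \<Rightarrow> ('k, 'c::ab_group_add, 'n) graded_coalg_scheme \<Rightarrow>
     ('k, ('k, 'd, ('k, 'c) words) tensor) vspace" where
  "comp_space D C = \<lparr>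
     carrier = module.span fscale (\<Union>n. tensor_span D (tensor_alg C) (grade D n) (tensor_power C (Suc n))),
     scal = fscale\<rparr>"

text \<open>
  The coproduct of \<open>d \<circ> (c\<^sub>0 \<cdot> \<dots> \<cdot> c\<^sub>n)\<close>, where \<open>n = length cs - 1\<close>. Taking the component of \<open>d'\<close>
  of degree \<open>i\<close> and the component of \<open>d''\<close> of degree \<open>n - i\<close> selects the part of the coproduct
  of \<open>d\<close> in \<open>D\<^sub>i \<otimes> D\<^bsub>n-i\<^esub>\<close>.
\<close>

definition circ_coprod ::
    "('k::field, 'd::ab_group_add, 'm) graded_coalg_scheme \<Rightarrow> ('k, 'c::ab_group_add, 'n) graded_coalg_scheme \<Rightarrow>
     'd \<Rightarrow> 'c list \<Rightarrow> ('k, ('k, 'd, ('k, 'c) words) tensor, ('k, 'd, ('k, 'c) words) tensor) tensor" where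
  "circ_coprod D C d cs =
     (\<Sum>i<length cs.
        lift (\<lambda>d' d''.
          lift (\<lambda>c' c''.
            tens (comp_space D C) (comp_space D C)
              (circ D C (component (grade D) i d') (take i cs @ [c']))
              (circ D C (component (grade D) (length cs - 1 - i) d'') (c'' # drop (Suc i) cs)))
            (coprod C (cs ! i)))
          (coprod D d))"

text \<open>The coproduct and counit are the linear extensions of the formulas on decomposable
  tensors, see \<open>composition_coprod\<close> and \<open>composition_counit\<close>.\<close>

definition composition ::
    "('k::field, 'd::ab_group_add, 'm) graded_coalg_scheme \<Rightarrow> ('k, 'c::ab_group_add, 'n) graded_coalg_scheme \<Rightarrow>
     ('k, ('k, 'd, ('k, 'c) words) tensor) coalg" where
  "composition D C = \<lparr>
     carrier = carrier (comp_space D C),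
     scal = scal (comp_space D C),
     coprod = lift (\<lambda>d. word_lift (circ_coprod D C d)),
     counit = (\<lambda>t. t (\<lambda>d w. counit D d * w (\<lambda>cs. prod_list (map (counit C) cs))))\<rparr>"

section \<open>The structure maps on decomposable tensors\<close>

lemma vector_space_fscale: "vector_space (fscale :: 'k::field \<Rightarrow> ('x \<Rightarrow> 'k) \<Rightarrow> _)"
  by unfold_locales (auto simp: fscale_def fun_eq_iff algebra_simps)

lemma vector_space_mult: "vector_space ((*) :: 'k::field \<Rightarrow> 'k \<Rightarrow> 'k)"
  by unfold_locales (auto simp: algebra_simps)

lemma fscale_apply [simp]: "fscale a f x = a * f x"
  by (simp add: fscale_def)

lemma ground_simps [simp]: "carrier ground = UNIV" "scal ground = (*)"
  by (simp_all add: ground_def)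

lemma tensor_prod_simps [simp]:
  "carrier (tensor_prod V W) = tensor_span V W (carrier V) (carrier W)" "scal (tensor_prod V W) = fscale"
  by (simp_all add: tensor_prod_def)

lemma is_vspace_span:
  fixes X :: "('x \<Rightarrow> 'k::field) set"
  assumes "carrier V = module.span fscale X" "scal V = fscale"
  shows "is_vspace V"
proof -
  interpret F: vector_space "fscale :: 'k \<Rightarrow> ('x \<Rightarrow> 'k) \<Rightarrow> _" by (rule vector_space_fscale)
  show ?thesis using assms by (simp add: is_vspace_def F.vector_space_axioms)
qed

lemma is_vspace_tensor_prod: "is_vspace (tensor_prod V W)"
  by (rule is_vspace_span) (auto simp: tensor_span_def)

lemma is_vspace_tensor_alg: "is_vspace (tensor_alg V)"
  by (rule is_vspace_span) (auto simp: tensor_alg_def)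

lemma is_vspace_comp_space: "is_vspace (comp_space D C)"
  by (rule is_vspace_span) (auto simp: comp_space_def)

lemma is_vspaceD:
  assumes "is_vspace V"
  shows "0 \<in> carrier V" "x \<in> carrier V \<Longrightarrow> y \<in> carrier V \<Longrightarrow> x + y \<in> carrier V"
    "x \<in> carrier V \<Longrightarrow> scal V a x \<in> carrier V"
proof -
  interpret vector_space "scal V" using assms by (simp add: is_vspace_def)
  show "0 \<in> carrier V" "x \<in> carrier V \<Longrightarrow> y \<in> carrier V \<Longrightarrow> x + y \<in> carrier V"
    "x \<in> carrier V \<Longrightarrow> scal V a x \<in> carrier V"
    using assms by (auto simp: is_vspace_def subspace_0 subspace_add subspace_scale)
qed

lemma span_fscale_base: "x \<in> X \<Longrightarrow> x \<in> module.span fscale X"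
proof -
  interpret F: vector_space "fscale :: 'b \<Rightarrow> ('a \<Rightarrow> 'b) \<Rightarrow> _" by (rule vector_space_fscale)
  show "x \<in> X \<Longrightarrow> x \<in> F.span X" by (rule F.span_base)
qed

lemma span_fscale_induct [consumes 1, case_names zero add]:
  assumes "x \<in> module.span fscale X" "P 0"
    and "\<And>c x y. x \<in> X \<Longrightarrow> y \<in> module.span fscale X \<Longrightarrow> P y \<Longrightarrow> P (fscale c x + y)"
  shows "P x"
proof -
  interpret F: vector_space "fscale :: 'b \<Rightarrow> ('a \<Rightarrow> 'b) \<Rightarrow> _" by (rule vector_space_fscale)
  have "x \<in> F.span X \<and> P x" using assms(1)
  proof (induction rule: F.span_induct_alt)
    case base
    show ?case using F.span_zero assms(2) by (rule conjI)
  next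
    case (step c x y)
    then show ?case using F.span_add[OF F.span_scale[OF F.span_base]] assms(3) by blast
  qed
  then show ?thesis ..
qed

lemma linear_on_compose: "linear_on V W g \<Longrightarrow> linear_on U V f \<Longrightarrow> linear_on U W (\<lambda>x. g (f x))"
  by (auto simp: linear_on_def)

lemma linear_on_ground_iff:
  "linear_on V ground f \<longleftrightarrow> (\<forall>x\<in>carrier V. \<forall>y\<in>carrier V. f (x + y) = f x + f y) \<and>
     (\<forall>a. \<forall>x\<in>carrier V. f (scal V a x) = a * f x)"
  by (simp add: linear_on_def)

lemma linear_on_ground_cong:
  "is_vspace V \<Longrightarrow> linear_on V ground f \<Longrightarrow> (\<And>v. v \<in> carrier V \<Longrightarrow> f v = g v) \<Longrightarrow> linear_on V ground g"
  by (simp add: linear_on_ground_iff is_vspaceD)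

lemma linear_on_ground_sum:
  "(\<And>i. i \<in> I \<Longrightarrow> linear_on V ground (f i)) \<Longrightarrow> linear_on V ground (\<lambda>v. \<Sum>i\<in>I. f i v)"
  by (auto simp: linear_on_ground_iff sum.distrib sum_distrib_left)

lemma linear_on_funI:
  assumes "scal W = fscale" "\<And>x. x \<in> carrier V \<Longrightarrow> f x \<in> carrier W"
    and "\<And>z. linear_on V ground (\<lambda>v. f v z)"
  shows "linear_on V W f"
  using assms by (auto simp: linear_on_def fun_eq_iff)

lemma tens_mem: "v \<in> carrier V \<Longrightarrow> w \<in> carrier W \<Longrightarrow> tens V W v w \<in> carrier (tensor_prod V W)"
  by (auto simp: tensor_span_def intro!: span_fscale_base)

lemma tens_bilinear_form: "bilinear_form V W (\<lambda>v w. tens V W v w B)"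
  by (auto simp: tens_def bilinear_form_def linear_on_ground_iff)

lemma tens_bilinear:
  "w \<in> carrier W \<Longrightarrow> linear_on V (tensor_prod V W) (\<lambda>v. tens V W v w)"
  "v \<in> carrier V \<Longrightarrow> linear_on W (tensor_prod V W) (\<lambda>w. tens V W v w)"
  using tens_bilinear_form[of V W]
  by (auto intro!: linear_on_funI tens_mem simp del: tensor_prod_simps(1) simp: bilinear_form_def)

lemma lift_tens:
  assumes "\<And>x. bilinear_form V W (\<lambda>v w. f v w x)"
  shows "lift f (tens V W v w) = f v w"
  using assms by (auto simp: lift_def tens_def)

lemma lift_linear [simp]: "lift f 0 = 0" "lift f (s + t) = lift f s + lift f t"
  "lift f (fscale a t) = fscale a (lift f t)"
  by (auto simp: lift_def fun_eq_iff)

lemma tens_universal: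
  fixes V :: "('k::field, 'v::ab_group_add, 'm) vspace_scheme" and W :: "('k, 'w::ab_group_add, 'n) vspace_scheme"
    and U :: "('k, 'u::ab_group_add, 'l) vspace_scheme"
  assumes U: "is_vspace U"
    and f1: "\<And>w. w \<in> carrier W \<Longrightarrow> linear_on V U (\<lambda>v. f v w)"
    and f2: "\<And>v. v \<in> carrier V \<Longrightarrow> linear_on W U (\<lambda>w. f v w)"
  shows "\<exists>g. linear_on (tensor_prod V W) U g \<and> (\<forall>v\<in>carrier V. \<forall>w\<in>carrier W. g (tens V W v w) = f v w)"
proof -
  interpret F: vector_space "fscale :: 'k \<Rightarrow> ('k, 'v, 'w) tensor \<Rightarrow> _" by (rule vector_space_fscale)
  interpret U: vector_space "scal U" using U by (simp add: is_vspace_def)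
  interpret P: vector_space_pair "fscale :: 'k \<Rightarrow> ('k, 'v, 'w) tensor \<Rightarrow> _" "scal U" ..
  interpret K: vector_space "(*) :: 'k \<Rightarrow> _" by (rule vector_space_mult)
  interpret Q: vector_space_pair "fscale :: 'k \<Rightarrow> ('k, 'v, 'w) tensor \<Rightarrow> _" "(*) :: 'k \<Rightarrow> _" ..
  interpret R: vector_space_pair "scal U" "(*) :: 'k \<Rightarrow> _" ..
  let ?T = "{tens V W v w | v w. v \<in> carrier V \<and> w \<in> carrier W}"
  obtain E where E: "E \<subseteq> ?T" "F.independent E" "?T \<subseteq> F.span E"
    using F.maximal_independent_subset[of ?T] by blast
  have "\<forall>e\<in>E. \<exists>p. fst p \<in> carrier V \<and> snd p \<in> carrier W \<and> e = tens V W (fst p) (snd p)"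
    using E(1) by fastforce
  then obtain p where p: "\<And>e. e \<in> E \<Longrightarrow>
      fst (p e) \<in> carrier V \<and> snd (p e) \<in> carrier W \<and> e = tens V W (fst (p e)) (snd (p e))" by metis
  obtain g where g: "Vector_Spaces.linear fscale (scal U) g" "\<And>e. e \<in> E \<Longrightarrow> g e = f (fst (p e)) (snd (p e))"
    using P.linear_independent_extend[OF E(2), of "\<lambda>e. f (fst (p e)) (snd (p e))"] by blast
  interpret g: Vector_Spaces.linear fscale "scal U" g by (rule g(1))
  have key: "l (g (tens V W v w)) = l (f v w)"
    if l: "Vector_Spaces.linear (scal U) (*) l" and vw: "v \<in> carrier V" "w \<in> carrier W" for l v w
  proof -
    interpret l: Vector_Spaces.linear "scal U" "(*)" l by (rule l)
    let ?B = "\<lambda>v w. l (f v w)"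
    have B: "bilinear_form V W ?B"
      using f1 f2 by (auto simp: bilinear_form_def linear_on_def l.add l.scale)
    have t: "tens V W v w ?B = l (f v w)" for v w using B by (simp add: tens_def)
    have "l (g t) = t ?B" if "t \<in> F.span E" for t
    proof (rule Q.linear_eq_on[OF _ _ that])
      show "Vector_Spaces.linear fscale (*) (\<lambda>t. l (g t))"
        using l g(1) by (auto simp: Vector_Spaces.linear_iff)
      show "Vector_Spaces.linear fscale (*) (\<lambda>t::('k, 'v, 'w) tensor. t ?B)"
        using F.vector_space_axioms vector_space_mult by (auto simp: Vector_Spaces.linear_iff)
      show "l (g e) = e ?B" if "e \<in> E" for e
        using p[OF that] g(2)[OF that] t by metis
    qed
    moreover have "tens V W v w \<in> F.span E" using E(3) vw by blast
    ultimately show ?thesis using t by simp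
  qed
  have g_tens: "g (tens V W v w) = f v w" if vw: "v \<in> carrier V" "w \<in> carrier W" for v w
  proof (rule ccontr)
    let ?u = "g (tens V W v w) - f v w"
    assume "g (tens V W v w) \<noteq> f v w"
    then have "U.independent {?u}" by simp
    then obtain l where l: "Vector_Spaces.linear (scal U) (*) l" "l ?u = 1"
      using R.linear_independent_extend[of "{?u}" "\<lambda>_. 1"] by auto
    interpret l: Vector_Spaces.linear "scal U" "(*)" l by (rule l(1))
    have "l ?u = l (g (tens V W v w)) - l (f v w)" by (rule l.diff)
    with l(2) key[OF l(1) vw] show False by simp
  qed
  have "g t \<in> carrier U" if "t \<in> F.span ?T" for t
    using that
  proof (induction rule: span_fscale_induct)
    case zero
    show ?case unfolding g.zero by (rule is_vspaceD[OF U])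
  next
    case (add c x y)
    then have "g x \<in> carrier U" using f1 g_tens by (auto simp: linear_on_def)
    with add(2) show ?case unfolding g.add g.scale using add(3) is_vspaceD[OF U] by blast
  qed
  then have "linear_on (tensor_prod V W) U g"
    by (auto simp: linear_on_def tensor_span_def g.add g.scale)
  with g_tens show ?thesis by blast
qed

lemma linear_lift_param:
  assumes "\<And>v w. v \<in> carrier V \<Longrightarrow> w \<in> carrier W \<Longrightarrow> linear_on Z ground (\<lambda>z. f z v w x)"
    and "\<And>z. z \<in> carrier Z \<Longrightarrow> bilinear_form V W (\<lambda>v w. f z v w x)"
    and "t \<in> carrier (tensor_prod V W)" and Z: "is_vspace Z"
  shows "linear_on Z ground (\<lambda>z. lift (f z) t x)"
  using assms(3) unfolding tensor_prod_simps tensor_span_def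
proof (induction rule: span_fscale_induct)
  case zero
  then show ?case by (simp add: linear_on_ground_iff lift_def)
next
  case (add c s t)
  then obtain v w where s: "s = tens V W v w" "v \<in> carrier V" "w \<in> carrier W" by auto
  have eq: "c * f z v w x + lift (f z) t x = lift (f z) (fscale c s + t) x" if "z \<in> carrier Z" for z
    using assms(2)[OF that] by (simp add: lift_def s(1) tens_def)
  have "linear_on Z ground (\<lambda>z. c * f z v w x + lift (f z) t x)"
    using add(3) assms(1)[OF s(2,3)] by (auto simp: linear_on_ground_iff algebra_simps)
  from linear_on_ground_cong[OF Z this eq] show ?case .
qed

lemma tensor_map_tens:
  assumes f: "linear_on V V' f" and g: "linear_on W W' g"
  shows "tensor_map V' W' f g (tens V W v w) = tens V' W' (f v) (g w)"
proof -
  have "bilinear_form V W (\<lambda>v w. tens V' W' (f v) (g w) x)" for x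
    using tens_bilinear_form[of V' W' x] f g by (auto simp: bilinear_form_def linear_on_def)
  then show ?thesis by (simp add: tensor_map_def lift_tens)
qed

lemma tensor_assoc_tens:
  assumes "is_vspace U" "is_vspace V" "is_vspace W" "u \<in> carrier U" "v \<in> carrier V" "w \<in> carrier W"
  shows "tensor_assoc U V W (tens (tensor_prod U V) W (tens U V u v) w)
    = tens U (tensor_prod V W) u (tens V W v w)"
proof -
  let ?f = "\<lambda>w u v. tens U (tensor_prod V W) u (tens V W v w)"
  have 1: "bilinear_form U V (\<lambda>u v. ?f w u v x)" if "w \<in> carrier W" for w x
    using tens_bilinear_form[of U "tensor_prod V W" x] tens_bilinear(1)[OF that, of V] tens_mem[OF _ that]
    by (auto simp: bilinear_form_def intro: linear_on_compose[where f = "\<lambda>v. tens V W v w"])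
  have 2: "linear_on W ground (\<lambda>w. ?f w u v x)" if "u \<in> carrier U" "v \<in> carrier V" for u v x
    using tens_bilinear_form[of U "tensor_prod V W" x] tens_bilinear(2)[OF that(2), of W] that
    by (auto simp: bilinear_form_def intro: linear_on_compose[where f = "\<lambda>w. tens V W v w"])
  have "bilinear_form (tensor_prod U V) W (\<lambda>p w. lift (?f w) p x)" for x
    unfolding bilinear_form_def
    using linear_lift_param[where f = ?f, OF 2 1 _ assms(3)]
    by (auto simp: linear_on_ground_iff)
  then have "tensor_assoc U V W (tens (tensor_prod U V) W (tens U V u v) w) = lift (?f w) (tens U V u v)"
    unfolding tensor_assoc_def by (rule lift_tens)
  also have "\<dots> = ?f w u v" using 1[OF assms(6)] by (rule lift_tens)
  finally show ?thesis .
qed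

lemma word_mem: "set vs \<subseteq> carrier V \<Longrightarrow> word V vs \<in> carrier (tensor_alg V)"
  by (fastforce simp: tensor_alg_def tensor_power_def intro!: span_fscale_base)

lemma multilinear_form_word: "multilinear_form V (\<lambda>vs. word V vs M)"
  by (auto simp: word_def multilinear_form_def linear_on_ground_iff)

lemma word_multilinear:
  assumes "set xs \<subseteq> carrier V" "set ys \<subseteq> carrier V"
  shows "linear_on V (tensor_alg V) (\<lambda>v. word V (xs @ v # ys))"
proof (rule linear_on_funI)
  show "linear_on V ground (\<lambda>v. word V (xs @ v # ys) M)" for M
    using assms multilinear_form_word[of V M] by (auto simp: multilinear_form_def)
qed (use assms in \<open>auto simp: tensor_alg_def[THEN arg_cong, of scal] intro!: word_mem\<close>)

lemma word_lift_word:
  assumes "\<And>x. multilinear_form V (\<lambda>vs. f vs x)"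
  shows "word_lift f (word V vs) = f vs"
  using assms by (auto simp: word_lift_def word_def)

lemma linear_word_lift_param:
  assumes "\<And>vs. set vs \<subseteq> carrier V \<Longrightarrow> linear_on Z ground (\<lambda>z. f z vs x)"
    and "\<And>z. z \<in> carrier Z \<Longrightarrow> multilinear_form V (\<lambda>vs. f z vs x)"
    and "t \<in> carrier (tensor_alg V)" and Z: "is_vspace Z"
  shows "linear_on Z ground (\<lambda>z. word_lift (f z) t x)"
proof -
  have step: "linear_on Z ground (\<lambda>z. word_lift (f z) (fscale c s + t) x)"
    if "linear_on Z ground (\<lambda>z. word_lift (f z) s x)" "linear_on Z ground (\<lambda>z. word_lift (f z) t x)" for c s t
    using that is_vspaceD[OF Z] by (auto simp: linear_on_ground_iff word_lift_def algebra_simps)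
  have 0: "linear_on Z ground (\<lambda>z. word_lift (f z) 0 x)"
    by (simp add: linear_on_ground_iff word_lift_def)
  have w: "linear_on Z ground (\<lambda>z. word_lift (f z) (word V vs) x)" if vs: "set vs \<subseteq> carrier V" for vs
  proof -
    have "word_lift (f z) (word V vs) x = f z vs x" if "z \<in> carrier Z" for z
      using assms(2)[OF that] by (simp add: word_lift_def word_def)
    then show ?thesis using assms(1)[OF vs] is_vspaceD[OF Z] by (auto simp: linear_on_ground_iff)
  qed
  have p: "linear_on Z ground (\<lambda>z. word_lift (f z) s x)" if "s \<in> tensor_power V n" for s n
    using that unfolding tensor_power_def
  proof (induction rule: span_fscale_induct)
    case (add c s t)
    then show ?case using w step by blast
  qed (rule 0)
  have "t \<in> module.span fscale (\<Union>n. tensor_power V n)"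
    using assms(3) by (simp add: tensor_alg_def)
  then show ?thesis
  proof (induction rule: span_fscale_induct)
    case (add c s t)
    then show ?case using p step by blast
  qed (rule 0)
qed

lemma sum_fun_pointwise: "(\<Sum>i\<in>I. f i) x = (\<Sum>i\<in>I. f i x)"
  by (induction I rule: infinite_finite_induct) auto

lemma cofree_coalg_coprod:
  assumes "set vs \<subseteq> carrier V"
  shows "coprod (cofree_coalg V) (word V vs) =
    (\<Sum>i\<le>length vs. tens (tensor_alg V) (tensor_alg V) (word V (take i vs)) (word V (drop i vs)))"
proof -
  let ?t = "tens (tensor_alg V) (tensor_alg V)"
  let ?f = "\<lambda>vs. \<Sum>i\<le>length vs. ?t (word V (take i vs)) (word V (drop i vs))"
  have "linear_on V ground (\<lambda>v. ?f (xs @ v # ys) z)"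
    if xy: "set xs \<subseteq> carrier V" "set ys \<subseteq> carrier V" for xs ys z
  proof -
    have tl: "w \<in> carrier (tensor_alg V) \<Longrightarrow> linear_on (tensor_alg V) ground (\<lambda>v. ?t v w z)"
      "w \<in> carrier (tensor_alg V) \<Longrightarrow> linear_on (tensor_alg V) ground (\<lambda>v. ?t w v z)" for w
      using tens_bilinear_form[of "tensor_alg V" "tensor_alg V" z] by (auto simp: bilinear_form_def)
    have "linear_on V ground (\<lambda>v. ?t (word V (take i (xs @ v # ys))) (word V (drop i (xs @ v # ys))) z)"
      (is "linear_on V ground ?h") for i
    proof (cases "i \<le> length xs")
      case True
      have "linear_on V ground (\<lambda>v. ?t (word V (take i xs)) (word V (drop i xs @ v # ys)) z)"
        using xy set_take_subset[of i xs] set_drop_subset[of i xs]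
        by (intro linear_on_compose[OF tl(2)] word_mem word_multilinear) auto
      with True show ?thesis by simp
    next
      case False
      then obtain j where j: "i = length xs + Suc j" using less_imp_Suc_add not_le by fastforce
      have "linear_on V ground (\<lambda>v. ?t (word V (xs @ v # take j ys)) (word V (drop j ys)) z)"
        using xy set_take_subset[of j ys] set_drop_subset[of j ys]
        by (intro linear_on_compose[OF tl(1), where f = "\<lambda>v. word V (xs @ v # take j ys)"] word_mem word_multilinear) auto
      with j show ?thesis by simp
    qed
    then have "linear_on V ground (\<lambda>v. \<Sum>i\<le>length (xs @ undefined # ys).
        ?t (word V (take i (xs @ v # ys))) (word V (drop i (xs @ v # ys))) z)"
      by (intro linear_on_ground_sum)
    then show ?thesis by (simp add: sum_fun_pointwise)
  qed
  then show ?thesis by (simp add: cofree_coalg_def word_lift_word multilinear_form_def)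
qed

lemma cofree_coalg_counit:
  "counit (cofree_coalg V) (word V vs) = (if vs = [] then 1 else 0)"
  by (auto simp: cofree_coalg_def word_def multilinear_form_def linear_on_ground_iff)

context graded_coalgebra begin

lemma decomposesI:
  assumes "\<And>n. f n \<in> grade A n" "finite S" "\<And>n. n \<notin> S \<Longrightarrow> f n = 0" "x = (\<Sum>n\<in>S. f n)"
  shows "decomposes (grade A) x f"
proof -
  have "{n. f n \<noteq> 0} \<subseteq> S" using assms(3) by auto
  then show ?thesis using assms unfolding decomposes_def
    by (auto intro: finite_subset sum.mono_neutral_right)
qed

lemma component_decomposes: "x \<in> carrier A \<Longrightarrow> decomposes (grade A) x (\<lambda>n. component (grade A) n x)"
  unfolding component_def using theI'[OF direct_sum] by simp

lemma component_eqI: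
  "x \<in> carrier A \<Longrightarrow> decomposes (grade A) x f \<Longrightarrow> component (grade A) n x = f n"
  unfolding component_def using direct_sum by (metis the1_equality)

lemma component_mem: "x \<in> carrier A \<Longrightarrow> component (grade A) n x \<in> grade A n"
  using component_decomposes by (auto simp: decomposes_def)

lemma linear_component: "linear_on A A (component (grade A) n)"
proof -
  interpret V: vector_space "scal A" using is_vspace by (simp add: is_vspace_def)
  let ?c = "component (grade A)"
  have sum: "(\<Sum>n\<in>S. ?c n x) = x"
    if "x \<in> carrier A" "finite S" "{n. ?c n x \<noteq> 0} \<subseteq> S" for x S
  proof -
    have "x = (\<Sum>n | ?c n x \<noteq> 0. ?c n x)"
      using component_decomposes[OF that(1)] by (simp add: decomposes_def)
    also have "\<dots> = (\<Sum>n\<in>S. ?c n x)" using that by (intro sum.mono_neutral_left) auto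
    finally show ?thesis ..
  qed
  have fin: "finite {n. ?c n x \<noteq> 0}" if "x \<in> carrier A" for x
    using component_decomposes[OF that] by (auto simp: decomposes_def)
  have "?c n (x + y) = ?c n x + ?c n y" if xy: "x \<in> carrier A" "y \<in> carrier A" for x y
  proof (rule component_eqI[where f = "\<lambda>n. ?c n x + ?c n y"], rule is_vspaceD(2)[OF is_vspace xy], rule decomposesI)
    let ?S = "{n. ?c n x \<noteq> 0} \<union> {n. ?c n y \<noteq> 0}"
    show f: "finite ?S" using fin xy by simp
    have "(\<Sum>n\<in>?S. ?c n x) = x" "(\<Sum>n\<in>?S. ?c n y) = y"
      by (rule sum[OF xy(1) f] sum[OF xy(2) f], blast)+
    then show "x + y = (\<Sum>n\<in>?S. ?c n x + ?c n y)"
      unfolding sum.distrib by simp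
  qed (use component_mem[OF xy(1)] component_mem[OF xy(2)] V.subspace_add[OF subspace_grade] in auto)
  moreover have "?c n (scal A a x) = scal A a (?c n x)" if x: "x \<in> carrier A" for a x
  proof (rule component_eqI[where f = "\<lambda>n. scal A a (?c n x)"], rule is_vspaceD(3)[OF is_vspace x], rule decomposesI)
    let ?S = "{n. ?c n x \<noteq> 0}"
    show f: "finite ?S" using fin x by simp
    show "scal A a x = (\<Sum>n\<in>?S. scal A a (?c n x))"
      unfolding V.scale_sum_right[symmetric] using sum[OF x f order_refl] by simp
  qed (use component_mem[OF x] V.subspace_scale[OF subspace_grade] in auto)
  ultimately show ?thesis using component_mem grade_subset unfolding linear_on_def by blast
qed

lemma component_grade: "x \<in> grade A n \<Longrightarrow> component (grade A) m x = (if m = n then x else 0)"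
  using module.subspace_0[OF _ subspace_grade] is_vspace[unfolded is_vspace_def, folded module_iff_vector_space] grade_subset
  by (intro component_eqI decomposesI[where S = "{n}"]) auto

end

lemma composition_coprod:
  assumes C: "graded_coalgebra C" and D: "graded_coalgebra D"
    and d: "d \<in> carrier D" and cs: "set cs \<subseteq> carrier C"
  shows "coprod (composition D C) (circ D C d cs) = circ_coprod D C d cs"
proof -
  interpret C: graded_coalgebra C by (rule C)
  interpret D: graded_coalgebra D by (rule D)
  let ?P = "comp_space D C"
  let ?k = "component (grade D)"
  have scalP: "scal ?P = fscale" by (simp add: comp_space_def)
  have memP: "circ D C (?k n d) cs \<in> carrier ?P"
    if "d \<in> carrier D" "set cs \<subseteq> carrier C" "length cs = Suc n" for d cs n
  proof -
    have "word C cs \<in> tensor_power C (Suc n)"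
      unfolding tensor_power_def using that by (intro span_fscale_base) blast
    then have "circ D C (?k n d) cs \<in> tensor_span D (tensor_alg C) (grade D n) (tensor_power C (Suc n))"
      unfolding circ_def tensor_span_def using D.component_mem[OF that(1)] by (intro span_fscale_base) blast
    then show ?thesis by (auto simp: comp_space_def intro!: span_fscale_base)
  qed
  have tl: "w \<in> carrier (tensor_alg C) \<Longrightarrow> linear_on D ground (\<lambda>v. tens D (tensor_alg C) v w z)"
      "v \<in> carrier D \<Longrightarrow> linear_on (tensor_alg C) ground (\<lambda>w. tens D (tensor_alg C) v w z)" for v w z
    using tens_bilinear_form[of D "tensor_alg C" z] by (auto simp: bilinear_form_def)
  have circ_d: "linear_on D ?P (\<lambda>d. circ D C (?k n d) cs)" if "set cs \<subseteq> carrier C" "length cs = Suc n" for cs n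
    by (rule linear_on_funI, rule scalP, erule memP[OF _ that], unfold circ_def,
        rule linear_on_compose[OF tl(1) D.linear_component], rule word_mem[OF that(1)])
  have circ_c: "linear_on C ?P (\<lambda>c. circ D C (?k n d) (xs @ c # ys))"
    if "d \<in> carrier D" "set xs \<subseteq> carrier C" "set ys \<subseteq> carrier C" "length (xs @ ys) = n" for d xs ys n
  proof (rule linear_on_funI[OF scalP])
    show "circ D C (?k n d) (xs @ c # ys) \<in> carrier ?P" if "c \<in> carrier C" for c
      using \<open>length (xs @ ys) = n\<close> \<open>set xs \<subseteq> _\<close> \<open>set ys \<subseteq> _\<close> that by (intro memP \<open>d \<in> carrier D\<close>) auto
    have "?k n d \<in> carrier D" using D.component_mem[OF that(1)] D.grade_subset by blast
    then show "linear_on C ground (\<lambda>c. circ D C (?k n d) (xs @ c # ys) z)" for z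
      unfolding circ_def by (rule linear_on_compose[OF tl(2) word_multilinear[OF that(2,3)]])
  qed
  have t2: "w \<in> carrier ?P \<Longrightarrow> linear_on ?P ground (\<lambda>v. tens ?P ?P v w z)"
      "v \<in> carrier ?P \<Longrightarrow> linear_on ?P ground (\<lambda>w. tens ?P ?P v w z)" for v w z
    using tens_bilinear_form[of ?P ?P z] by (auto simp: bilinear_form_def)
  let ?S = "\<lambda>xs ys c' c'' d' d''. tens ?P ?P
    (circ D C (?k (length xs) d') (xs @ [c'])) (circ D C (?k (length ys) d'') (c'' # ys))"
  have S: "linear_on C ground (\<lambda>c'. ?S xs ys c' c'' d' d'' z)"
    "linear_on C ground (\<lambda>c''. ?S xs ys c' c'' d' d'' z)"
    "linear_on D ground (\<lambda>d'. ?S xs ys c' c'' d' d'' z)"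
    "linear_on D ground (\<lambda>d''. ?S xs ys c' c'' d' d'' z)"
    if "set xs \<subseteq> carrier C" "set ys \<subseteq> carrier C" "c' \<in> carrier C" "c'' \<in> carrier C" "d' \<in> carrier D" "d'' \<in> carrier D"
    for xs ys c' c'' d' d'' z
  proof -
    have m: "circ D C (?k (length xs) d') (xs @ [c']) \<in> carrier ?P"
      "circ D C (?k (length ys) d'') (c'' # ys) \<in> carrier ?P"
      using that by (auto intro!: memP)
    show "linear_on C ground (\<lambda>c'. ?S xs ys c' c'' d' d'' z)"
      using circ_c[of d' xs "[]" "length xs"] that
      by (intro linear_on_compose[OF t2(1)[OF m(2)], where f = "\<lambda>c. circ D C (?k (length xs) d') (xs @ [c])"]) auto
    show "linear_on C ground (\<lambda>c''. ?S xs ys c' c'' d' d'' z)"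
      using circ_c[of d'' "[]" ys "length ys"] that
      by (intro linear_on_compose[OF t2(2)[OF m(1)], where f = "\<lambda>c. circ D C (?k (length ys) d'') (c # ys)"]) auto
    show "linear_on D ground (\<lambda>d'. ?S xs ys c' c'' d' d'' z)"
      using that
      by (intro linear_on_compose[OF t2(1)[OF m(2)], where f = "\<lambda>d. circ D C (?k (length xs) d) (xs @ [c'])"] circ_d) auto
    show "linear_on D ground (\<lambda>d''. ?S xs ys c' c'' d' d'' z)"
      using that
      by (intro linear_on_compose[OF t2(2)[OF m(1)], where f = "\<lambda>d. circ D C (?k (length ys) d) (c'' # ys)"] circ_d) auto
  qed
  have S2: "linear_on C ground (\<lambda>v. ?S (xs @ v # xs') ys c' c'' d' d'' z)"
    if "set xs \<subseteq> carrier C" "set xs' \<subseteq> carrier C" "set ys \<subseteq> carrier C" "c' \<in> carrier C" "c'' \<in> carrier C" "d' \<in> carrier D" "d'' \<in> carrier D"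
    for xs xs' ys c' c'' d' d'' z
  proof -
    have m: "circ D C (?k (length ys) d'') (c'' # ys) \<in> carrier ?P"
      using that by (auto intro!: memP)
    show ?thesis
      using circ_c[of d' xs "xs' @ [c']" "length (xs @ undefined # xs')"] that
      by (intro linear_on_compose[OF t2(1)[OF m], where f = "\<lambda>v. circ D C (?k (length (xs @ v # xs')) d') ((xs @ v # xs') @ [c'])"]) auto
  qed
  have S3: "linear_on C ground (\<lambda>v. ?S ys (xs @ v # xs') c' c'' d' d'' z)"
    if "set xs \<subseteq> carrier C" "set xs' \<subseteq> carrier C" "set ys \<subseteq> carrier C" "c' \<in> carrier C" "c'' \<in> carrier C" "d' \<in> carrier D" "d'' \<in> carrier D"
    for xs xs' ys c' c'' d' d'' z
  proof -
    have m: "circ D C (?k (length ys) d') (ys @ [c']) \<in> carrier ?P"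
      using that by (auto intro!: memP)
    show ?thesis
      using circ_c[of d'' "c'' # xs" xs' "length (xs @ undefined # xs')"] that
      by (intro linear_on_compose[OF t2(2)[OF m], where f = "\<lambda>v. circ D C (?k (length (xs @ v # xs')) d'') (c'' # xs @ v # xs')"]) auto
  qed
  have cC: "coprod C c \<in> carrier (tensor_prod C C)" if "c \<in> carrier C" for c
    using C.linear_coprod that unfolding linear_on_def by blast
  have cD: "coprod D d \<in> carrier (tensor_prod D D)" if "d \<in> carrier D" for d
    using D.linear_coprod that unfolding linear_on_def by blast
  have lift_coprod: "linear_on C ground (\<lambda>c. lift f (coprod C c) z)" "linear_on D ground (\<lambda>d. lift g (coprod D d) z)" for f g z
    using C.linear_coprod D.linear_coprod by (auto simp: linear_on_def)
  let ?G = "\<lambda>xs ys c d' d''. lift (\<lambda>c' c''. ?S xs ys c' c'' d' d'') (coprod C c)"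
  have Sb: "bilinear_form C C (\<lambda>c' c''. ?S xs ys c' c'' d' d'' z)"
    if "set xs \<subseteq> carrier C" "set ys \<subseteq> carrier C" "d' \<in> carrier D" "d'' \<in> carrier D" for xs ys d' d'' z
    using that S(1,2) by (auto simp: bilinear_form_def)
  have G: "linear_on D ground (\<lambda>d'. ?G xs ys c d' d'' z)"
    "linear_on D ground (\<lambda>d''. ?G xs ys c d' d'' z)"
    if "set xs \<subseteq> carrier C" "set ys \<subseteq> carrier C" "c \<in> carrier C" "d' \<in> carrier D" "d'' \<in> carrier D"
    for xs ys c d' d'' z
  proof -
    show "linear_on D ground (\<lambda>d'. ?G xs ys c d' d'' z)"
      by (rule linear_lift_param[OF _ _ cC[OF that(3)] D.is_vspace], rule S(3)[OF that(1,2) _ _ that(4,5)], assumption+)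
         (rule Sb[OF that(1,2) _ that(5)])
    show "linear_on D ground (\<lambda>d''. ?G xs ys c d' d'' z)"
      by (rule linear_lift_param[OF _ _ cC[OF that(3)] D.is_vspace], rule S(4)[OF that(1,2) _ _ that(4,5)], assumption+)
         (rule Sb[OF that(1,2) that(4)])
  qed
  have G2: "linear_on C ground (\<lambda>v. ?G (zs @ v # zs') ys c d' d'' z)"
    "linear_on C ground (\<lambda>v. ?G ys (zs @ v # zs') c d' d'' z)"
    if "set zs \<subseteq> carrier C" "set zs' \<subseteq> carrier C" "set ys \<subseteq> carrier C" "c \<in> carrier C" "d' \<in> carrier D" "d'' \<in> carrier D"
    for zs zs' ys c d' d'' z
  proof -
    have l: "set (zs @ v # zs') \<subseteq> carrier C" if "v \<in> carrier C" for v
      using that \<open>set zs \<subseteq> _\<close> \<open>set zs' \<subseteq> _\<close> by auto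
    show "linear_on C ground (\<lambda>v. ?G (zs @ v # zs') ys c d' d'' z)"
      by (rule linear_lift_param[OF _ _ cC[OF that(4)] C.is_vspace], rule S2[OF that(1-3) _ _ that(5,6)], assumption+)
         (rule Sb[OF l that(3,5,6)])
    show "linear_on C ground (\<lambda>v. ?G ys (zs @ v # zs') c d' d'' z)"
      by (rule linear_lift_param[OF _ _ cC[OF that(4)] C.is_vspace], rule S3[OF that(1-3) _ _ that(5,6)], assumption+)
         (rule Sb[OF that(3) l that(5,6)])
  qed
  let ?H = "\<lambda>xs ys c d. lift (\<lambda>d' d''. ?G xs ys c d' d'') (coprod D d)"
  have Gb: "bilinear_form D D (\<lambda>d' d''. ?G xs ys c d' d'' z)"
    if "set xs \<subseteq> carrier C" "set ys \<subseteq> carrier C" "c \<in> carrier C" for xs ys c z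
    unfolding bilinear_form_def using G that by blast
  have H: "linear_on C ground (\<lambda>c. ?H xs ys c d z)"
    if "set xs \<subseteq> carrier C" "set ys \<subseteq> carrier C" "d \<in> carrier D" for xs ys d z
    by (rule linear_lift_param[OF _ _ cD[OF that(3)] C.is_vspace], rule lift_coprod)
       (rule Gb[OF that(1,2)])
  have H2: "linear_on C ground (\<lambda>v. ?H (zs @ v # zs') ys c d z)"
    "linear_on C ground (\<lambda>v. ?H ys (zs @ v # zs') c d z)"
    if "set zs \<subseteq> carrier C" "set zs' \<subseteq> carrier C" "set ys \<subseteq> carrier C" "c \<in> carrier C" "d \<in> carrier D"
    for zs zs' ys c d z
  proof -
    have l: "set (zs @ v # zs') \<subseteq> carrier C" if "v \<in> carrier C" for v
      using that \<open>set zs \<subseteq> _\<close> \<open>set zs' \<subseteq> _\<close> by auto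
    show "linear_on C ground (\<lambda>v. ?H (zs @ v # zs') ys c d z)"
      by (rule linear_lift_param[OF _ _ cD[OF that(5)] C.is_vspace], rule G2[OF that(1-4)], assumption+)
         (rule Gb[OF l that(3,4)])
    show "linear_on C ground (\<lambda>v. ?H ys (zs @ v # zs') c d z)"
      by (rule linear_lift_param[OF _ _ cD[OF that(5)] C.is_vspace], rule G2[OF that(1-4)], assumption+)
         (rule Gb[OF that(3) l that(4)])
  qed
  have eq: "circ_coprod D C d cs z = (\<Sum>i<length cs. ?H (take i cs) (drop (Suc i) cs) (cs ! i) d z)" for d cs z
    unfolding circ_coprod_def sum_fun_pointwise by (rule sum.cong) auto
  have 1: "linear_on D ground (\<lambda>d. circ_coprod D C d cs z)" for cs z
    unfolding eq by (intro linear_on_ground_sum lift_coprod)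
  have 2: "multilinear_form C (\<lambda>cs. circ_coprod D C d cs z)" if d: "d \<in> carrier D" for d z
    unfolding multilinear_form_def
  proof (intro allI impI)
    fix xs ys assume xy: "set xs \<subseteq> carrier C" "set ys \<subseteq> carrier C"
    have "linear_on C ground
      (\<lambda>v. ?H (take i (xs @ v # ys)) (drop (Suc i) (xs @ v # ys)) ((xs @ v # ys) ! i) d z)"
      (is "linear_on _ _ ?h") if i: "i \<in> {..<length (xs @ undefined # ys)}" for i
    proof (cases i "length xs" rule: linorder_cases)
      case less
      then have h: "?h = (\<lambda>v. ?H (take i xs) (drop (Suc i) xs @ v # ys) (xs ! i) d z)"
        by (simp add: nth_append)
      have "set (take i xs) \<subseteq> carrier C" "set (drop (Suc i) xs) \<subseteq> carrier C" "xs ! i \<in> carrier C"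
        using xy less set_take_subset[of i xs] set_drop_subset[of "Suc i" xs] nth_mem[of i xs] by blast+
      then show ?thesis unfolding h using xy d by (intro H2(2))
    next
      case equal
      then have h: "?h = (\<lambda>v. ?H xs ys v d z)" by simp
      show ?thesis unfolding h by (rule H[OF xy d])
    next
      case greater
      then obtain j where j: "i = length xs + Suc j" using less_imp_Suc_add by fastforce
      then have h: "?h = (\<lambda>v. ?H (xs @ v # take j ys) (drop (Suc j) ys) (ys ! j) d z)"
        by (simp add: nth_append)
      have "set (take j ys) \<subseteq> carrier C" "set (drop (Suc j) ys) \<subseteq> carrier C" "ys ! j \<in> carrier C"
        using xy i j set_take_subset[of j ys] set_drop_subset[of "Suc j" ys] nth_mem[of j ys] by auto
      then show ?thesis unfolding h using xy d by (intro H2(1))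
    qed
    then have "linear_on C ground (\<lambda>v. \<Sum>i<length (xs @ undefined # ys).
        ?H (take i (xs @ v # ys)) (drop (Suc i) (xs @ v # ys)) ((xs @ v # ys) ! i) d z)"
      by (rule linear_on_ground_sum)
    moreover have "length (xs @ undefined # ys) = length (xs @ v # ys)" for v by simp
    ultimately show "linear_on C ground (\<lambda>v. circ_coprod D C d (xs @ v # ys) z)"
      unfolding eq by simp
  qed
  have "bilinear_form D (tensor_alg C) (\<lambda>d w. word_lift (circ_coprod D C d) w z)" for z
    unfolding bilinear_form_def
  proof (intro conjI ballI)
    show "linear_on D ground (\<lambda>d. word_lift (circ_coprod D C d) w z)" if "w \<in> carrier (tensor_alg C)" for w
      by (rule linear_word_lift_param[OF _ _ that D.is_vspace], rule 1, erule 2)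
    show "linear_on (tensor_alg C) ground (\<lambda>w. word_lift (circ_coprod D C d) w z)" for d
      by (simp add: linear_on_ground_iff word_lift_def tensor_alg_def)
  qed
  then have "coprod (composition D C) (circ D C d cs) = word_lift (circ_coprod D C d) (word C cs)"
    by (simp add: composition_def circ_def lift_tens)
  also have "\<dots> = circ_coprod D C d cs" using 2[OF d] by (rule word_lift_word)
  finally show ?thesis .
qed

lemma composition_counit:
  assumes "graded_coalgebra C" "graded_coalgebra D"
  shows "counit (composition D C) (circ D C d cs) = counit D d * prod_list (map (counit C) cs)"
proof -
  interpret C: graded_coalgebra C by (rule assms)
  interpret D: graded_coalgebra D by (rule assms)
  have m: "multilinear_form C (\<lambda>cs. prod_list (map (counit C) cs))"
    using C.linear_counit by (auto simp: multilinear_form_def linear_on_ground_iff algebra_simps)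
  have "bilinear_form D (tensor_alg C) (\<lambda>d w. counit D d * w (\<lambda>cs. prod_list (map (counit C) cs)))"
    using D.linear_counit by (auto simp: bilinear_form_def linear_on_ground_iff tensor_alg_def algebra_simps)
  with m show ?thesis by (simp add: composition_def circ_def tens_def word_def)
qed

end

theory Submission
  imports Defs
begin

text \<open>
  Call a basis of a coalgebra a deconcatenation basis if it consists of elements \<open>b w\<close>, one for
  each word \<open>w\<close> in an alphabet, and \<open>\<Delta> (b w)\<close> is the sum of \<open>b u \<otimes> b v\<close> over the factorizations
  \<open>w = u @ v\<close>, while the counit is \<open>1\<close> at \<open>b []\<close> and \<open>0\<close> at the other \<open>b w\<close>. A coalgebra is cofree
  if and only if it has such a basis (\<open>deconc_basis_of_cofree\<close>, \<open>cofree_of_deconc_basis\<close>), and then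
  its primitive elements are the span of the \<open>b w\<close> for \<open>w\<close> of length one (\<open>primitives_eq_span\<close>).
  The theorem therefore asks for a deconcatenation basis of \<open>D \<circ> C\<close>.

  Let \<open>b\<^sub>C\<close> and \<open>b\<^sub>D\<close> be deconcatenation bases of \<open>C\<close> and \<open>D\<close>, and suppose that every letter \<open>j\<close> of
  \<open>b\<^sub>D\<close> has a degree \<open>deg j > 0\<close> such that \<open>b\<^sub>D w\<close> is homogeneous, of degree the sum of the degrees
  of the letters of \<open>w\<close>. The elements \<open>b\<^sub>D w \<circ> (b\<^sub>C u\<^sub>0 \<cdot> \<dots> \<cdot> b\<^sub>C u\<^sub>n)\<close>, with \<open>n\<close> the degree of \<open>w\<close>,
  form a basis of \<open>D \<circ> C\<close>. Each index can be read as a single word: spell \<open>u\<^sub>0\<close>; then write one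
  letter made of the first letter \<open>j\<close> of \<open>w\<close> and of the words \<open>u\<^sub>1, \<dots>, u\<^bsub>m-1\<^esub>\<close>, where \<open>m = deg j\<close>;
  then spell \<open>u\<^sub>m\<close>; then write the letter made of the second letter of \<open>w\<close> and of the words that it
  encloses; and so on until \<open>u\<^sub>n\<close> is spelt. Since degrees are positive, this is a bijection from the
  indices to the words in the new alphabet (\<open>bij_betw_comp_words\<close>). A cut of the new word falls
  inside some \<open>u\<^sub>i\<close> that is spelt out, and then it cuts \<open>w\<close> into words of degrees \<open>i\<close> and \<open>n - i\<close>:
  these are exactly the terms of the coproduct of \<open>D \<circ> C\<close> (\<open>coprod_comp_basis_coords\<close>). Words of
  length one give \<open>1 \<circ> (b\<^sub>C [i])\<close> and \<open>b\<^sub>D [j] \<circ> (1 \<cdot> b\<^sub>C u\<^sub>1 \<cdot> \<dots> \<cdot> b\<^sub>C u\<^bsub>m-1\<^esub> \<cdot> 1)\<close>, which is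
  the description of the primitive elements.

  It remains to find a homogeneous deconcatenation basis of \<open>D\<close>; this takes an argument, because an
  isomorphism of \<open>D\<close> with a cofree coalgebra need not have anything to do with the grading. The
  primitive elements form a graded subspace (\<open>component_primitive\<close>). Take a homogeneous basis of it
  and extend its coordinate functionals to functionals \<open>\<eta>\<^sub>j\<close> on \<open>D\<close> that vanish in all degrees but
  one. The convolution products \<open>\<eta>\<^sub>w\<close> of these along words \<open>w\<close> are homogeneous too. With respect to
  any deconcatenation basis that has the chosen primitive elements at the letters, they are
  unitriangular for the length of words, so there is a basis dual to them. It is a deconcatenation
  basis because convolution corresponds to concatenation of words, and it is homogeneous because
  the functionals are (\<open>homogeneous_deconc_basis\<close>).
\<close>

section \<open>Bases with coordinate functionals\<close>

text \<open>
  The coordinate functionals are part of the data because equations between tensors are proved by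
  evaluating both sides at products of such functionals. Instead of being spanned by the \<open>b i\<close>, the
  space is required to have elements with finitely many nonzero coordinates and to be separated by
  the coordinates; this is equivalent (\<open>coord_basis_expansion\<close>, \<open>coord_basisI_span\<close>) and often
  easier to verify.
\<close>

definition coord_basis ::
    "('k::field, 'v::ab_group_add, 'm) vspace_scheme \<Rightarrow> 'i set \<Rightarrow> ('i \<Rightarrow> 'v) \<Rightarrow> ('i \<Rightarrow> 'v \<Rightarrow> 'k) \<Rightarrow> bool" where
  "coord_basis V I b \<xi> \<longleftrightarrow> is_vspace V \<and>
     (\<forall>i\<in>I. b i \<in> carrier V) \<and> (\<forall>i\<in>I. linear_on V ground (\<xi> i)) \<and>
     (\<forall>i\<in>I. \<forall>j\<in>I. \<xi> i (b j) = (if i = j then 1 else 0)) \<and>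
     (\<forall>x\<in>carrier V. finite {i\<in>I. \<xi> i x \<noteq> 0}) \<and>
     (\<forall>x\<in>carrier V. (\<forall>i\<in>I. \<xi> i x = 0) \<longrightarrow> x = 0)"

lemma coord_basisD:
  assumes "coord_basis V I b \<xi>"
  shows coord_basis_vspace: "is_vspace V"
    and coord_basis_mem: "i \<in> I \<Longrightarrow> b i \<in> carrier V"
    and coord_basis_linear: "i \<in> I \<Longrightarrow> linear_on V ground (\<xi> i)"
    and coord_basis_dual: "i \<in> I \<Longrightarrow> j \<in> I \<Longrightarrow> \<xi> i (b j) = (if i = j then 1 else 0)"
    and coord_basis_finite: "x \<in> carrier V \<Longrightarrow> finite {i\<in>I. \<xi> i x \<noteq> 0}"
    and coord_basis_zero: "x \<in> carrier V \<Longrightarrow> (\<And>i. i \<in> I \<Longrightarrow> \<xi> i x = 0) \<Longrightarrow> x = 0"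
  using assms unfolding coord_basis_def by auto

lemma is_vspace_scal:
  assumes "is_vspace V"
  shows "vector_space (scal V)" "module (scal V)"
  using assms by (auto simp: is_vspace_def module_iff_vector_space)

lemma is_vspace_minus:
  assumes "is_vspace V" "x \<in> carrier V" "y \<in> carrier V"
  shows "x - y \<in> carrier V" "x - y = x + scal V (- 1) y"
proof -
  interpret vector_space "scal V" using is_vspace_scal assms by blast
  show "x - y \<in> carrier V" "x - y = x + scal V (- 1) y"
    using assms by (auto simp: is_vspace_def subspace_diff)
qed

lemma is_vspace_sum:
  assumes "is_vspace V" "\<And>i. i \<in> S \<Longrightarrow> f i \<in> carrier V"
  shows "(\<Sum>i\<in>S. f i) \<in> carrier V"
  using assms(2) by (induction S rule: infinite_finite_induct) (auto simp: is_vspaceD[OF assms(1)])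

lemma linear_on_mem: "linear_on V W f \<Longrightarrow> x \<in> carrier V \<Longrightarrow> f x \<in> carrier W"
  and linear_on_add: "linear_on V W f \<Longrightarrow> x \<in> carrier V \<Longrightarrow> y \<in> carrier V \<Longrightarrow> f (x + y) = f x + f y"
  and linear_on_scal: "linear_on V W f \<Longrightarrow> x \<in> carrier V \<Longrightarrow> f (scal V a x) = scal W a (f x)"
  by (auto simp: linear_on_def)

lemma linear_on_zero:
  assumes "linear_on V W f" "is_vspace V"
  shows "f 0 = 0"
  using linear_on_add[OF assms(1), of 0 0] is_vspaceD(1)[OF assms(2)] by simp

lemma linear_on_sum:
  assumes "linear_on V W f" "is_vspace V" "\<And>i. i \<in> S \<Longrightarrow> g i \<in> carrier V"
  shows "f (\<Sum>i\<in>S. g i) = (\<Sum>i\<in>S. f (g i))"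
  using assms(3)
proof (induction S rule: infinite_finite_induct)
  case (insert i S)
  have "(\<Sum>i\<in>S. g i) \<in> carrier V" using insert by (intro is_vspace_sum[OF assms(2)]) auto
  with insert show ?case by (simp add: linear_on_add[OF assms(1)])
qed (auto simp: linear_on_zero[OF assms(1,2)])

lemma linear_on_diff:
  assumes "linear_on V ground f" "is_vspace V" "x \<in> carrier V" "y \<in> carrier V"
  shows "f (x - y) = f x - f y"
proof -
  have "f (x - y) = f x + f (scal V (- 1) y)"
    unfolding is_vspace_minus(2)[OF assms(2-4)]
    by (rule linear_on_add[OF assms(1) assms(3) is_vspaceD(3)[OF assms(2,4)]])
  also have "f (scal V (- 1) y) = - f y" using linear_on_scal[OF assms(1,4), of "- 1"] by simp
  finally show ?thesis by simp
qed

lemma linear_on_span_mem: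
  assumes f: "linear_on V W f" and V: "is_vspace V" and W: "module (scal W)"
    and X: "X \<subseteq> carrier V" "\<And>x. x \<in> X \<Longrightarrow> f x \<in> module.span (scal W) Y"
    and x: "x \<in> module.span (scal V) X"
  shows "f x \<in> module.span (scal W) Y"
proof -
  interpret V: module "scal V" by (rule is_vspace_scal[OF V])
  interpret W: module "scal W" by (rule W)
  have "x \<in> carrier V \<and> f x \<in> W.span Y" using x
  proof (induction rule: V.span_induct_alt)
    case base
    then show ?case using is_vspaceD(1)[OF V] linear_on_zero[OF f V] W.span_zero by simp
  next
    case (step c x y)
    then have "x \<in> carrier V" using X by auto
    then show ?case using step X(2)[OF step(1)] is_vspaceD[OF V]
      by (auto simp: linear_on_add[OF f] linear_on_scal[OF f] intro!: W.span_add W.span_scale)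
  qed
  then show ?thesis ..
qed

context
  fixes V :: "('k::field, 'v::ab_group_add, 'm) vspace_scheme" and I :: "'i set" and b \<xi>
  assumes B: "coord_basis V I b \<xi>"
begin

lemma coord_basis_eq:
  assumes "x \<in> carrier V" "y \<in> carrier V" "\<And>i. i \<in> I \<Longrightarrow> \<xi> i x = \<xi> i y"
  shows "x = y"
proof -
  have "x - y = 0"
    using assms by (intro coord_basis_zero[OF B])
      (auto simp: is_vspace_minus(1)[OF coord_basis_vspace[OF B]] linear_on_diff[OF coord_basis_linear[OF B] coord_basis_vspace[OF B]])
  then show ?thesis by simp
qed

lemma coord_basis_combination:
  assumes S: "finite S" "S \<subseteq> I"
  shows "(\<Sum>i\<in>S. scal V (a i) (b i)) \<in> carrier V"
    and "j \<in> I \<Longrightarrow> \<xi> j (\<Sum>i\<in>S. scal V (a i) (b i)) = (if j \<in> S then a j else 0)"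
proof -
  note V = coord_basis_vspace[OF B]
  have m: "scal V (a i) (b i) \<in> carrier V" if "i \<in> S" for i
    using that S coord_basis_mem[OF B] is_vspaceD(3)[OF V] by blast
  then show "(\<Sum>i\<in>S. scal V (a i) (b i)) \<in> carrier V" by (intro is_vspace_sum V)
  assume j: "j \<in> I"
  note l = coord_basis_linear[OF B j]
  have "\<xi> j (\<Sum>i\<in>S. scal V (a i) (b i)) = (\<Sum>i\<in>S. \<xi> j (scal V (a i) (b i)))"
    by (rule linear_on_sum[OF l V m])
  also have "\<dots> = (\<Sum>i\<in>S. if i = j then a i else 0)"
    using S by (intro sum.cong) (auto simp: linear_on_scal[OF l] coord_basis_mem[OF B] coord_basis_dual[OF B j] subset_iff)
  also have "\<dots> = (if j \<in> S then a j else 0)" using S by simp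
  finally show "\<xi> j (\<Sum>i\<in>S. scal V (a i) (b i)) = (if j \<in> S then a j else 0)" .
qed

lemma coord_basis_expansion:
  assumes x: "x \<in> carrier V" and S: "finite S" "S \<subseteq> I" "{i\<in>I. \<xi> i x \<noteq> 0} \<subseteq> S"
  shows "x = (\<Sum>i\<in>S. scal V (\<xi> i x) (b i))"
  using S(3) by (intro coord_basis_eq x coord_basis_combination S(1,2)) (auto simp: coord_basis_combination(2)[OF S(1,2)])

lemma coord_basis_span: "carrier V = module.span (scal V) (b ` I)"
proof -
  interpret V: module "scal V" by (rule is_vspace_scal[OF coord_basis_vspace[OF B]])
  have "V.subspace (carrier V)" using coord_basis_vspace[OF B] by (simp add: is_vspace_def)
  then have "V.span (b ` I) \<subseteq> carrier V" using coord_basis_mem[OF B] by (intro V.span_minimal) auto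
  moreover have "x \<in> V.span (b ` I)" if x: "x \<in> carrier V" for x
  proof -
    have "x = (\<Sum>i\<in>{i\<in>I. \<xi> i x \<noteq> 0}. scal V (\<xi> i x) (b i))"
      by (rule coord_basis_expansion[OF x coord_basis_finite[OF B x]]) auto
    also have "\<dots> \<in> V.span (b ` I)" by (intro V.span_sum V.span_scale V.span_base) auto
    finally show ?thesis .
  qed
  ultimately show ?thesis by blast
qed

lemma coord_basis_induct [consumes 1, case_names zero add]:
  assumes "x \<in> carrier V" "P 0"
    and "\<And>c i y. i \<in> I \<Longrightarrow> y \<in> carrier V \<Longrightarrow> P y \<Longrightarrow> P (scal V c (b i) + y)"
  shows "P x"
proof -
  note V = coord_basis_vspace[OF B]
  interpret V: module "scal V" by (rule is_vspace_scal[OF V])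
  have "x \<in> carrier V \<and> P x" using assms(1)[unfolded coord_basis_span]
  proof (induction rule: V.span_induct_alt)
    case base
    then show ?case using assms(2) is_vspaceD(1)[OF V] by simp
  next
    case (step c x y)
    then show ?case using assms(3) is_vspaceD[OF V] coord_basis_mem[OF B] by blast
  qed
  then show ?thesis ..
qed

lemma linear_on_coord_basis_eq:
  assumes f: "linear_on V W f" and g: "linear_on V W g" and "\<And>i. i \<in> I \<Longrightarrow> f (b i) = g (b i)"
    and x: "x \<in> carrier V"
  shows "f x = g x"
  using x
proof (induction rule: coord_basis_induct)
  case zero
  show ?case using linear_on_zero[OF f] linear_on_zero[OF g] coord_basis_vspace[OF B] by simp
next
  case (add c i y)
  have m: "b i \<in> carrier V" "scal V c (b i) \<in> carrier V"
    using add coord_basis_mem[OF B] is_vspaceD[OF coord_basis_vspace[OF B]] by blast+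
  show ?case using add m assms(3)[OF add(1)]
    by (simp add: linear_on_add[OF f] linear_on_add[OF g] linear_on_scal[OF f] linear_on_scal[OF g])
qed

end

lemma coord_basisI_span:
  assumes V: "is_vspace V" and m: "\<And>i. i \<in> I \<Longrightarrow> b i \<in> carrier V"
    and l: "\<And>i. i \<in> I \<Longrightarrow> linear_on V ground (\<xi> i)"
    and d: "\<And>i j. i \<in> I \<Longrightarrow> j \<in> I \<Longrightarrow> \<xi> i (b j) = (if i = j then 1 else 0)"
    and s: "carrier V \<subseteq> module.span (scal V) (b ` I)"
  shows "coord_basis V I b \<xi>"
proof -
  interpret V: module "scal V" by (rule is_vspace_scal[OF V])
  have *: "x \<in> carrier V \<and> finite {i\<in>I. \<xi> i x \<noteq> 0} \<and> x = (\<Sum>i\<in>{i\<in>I. \<xi> i x \<noteq> 0}. scal V (\<xi> i x) (b i))"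
    if "x \<in> V.span (b ` I)" for x
    using that
  proof (induction rule: V.span_induct_alt)
    case base
    have "\<xi> i 0 = 0" if "i \<in> I" for i by (rule linear_on_zero[OF l[OF that] V])
    then show ?case using is_vspaceD(1)[OF V] by (simp cong: conj_cong)
  next
    case (step c x y)
    then obtain j where j: "j \<in> I" "x = b j" by auto
    have mj: "scal V c (b j) \<in> carrier V" using m[OF j(1)] is_vspaceD(3)[OF V] by blast
    let ?z = "scal V c x + y"
    have e: "\<xi> i ?z = (if i = j then c else 0) + \<xi> i y" if "i \<in> I" for i
      using linear_on_add[OF l[OF that] mj, of y] linear_on_scal[OF l[OF that] m[OF j(1)], of c]
        step j d[OF that j(1)] by simp
    let ?S = "insert j {i\<in>I. \<xi> i y \<noteq> 0}"
    have fin: "finite ?S" using step by simp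
    have sub: "{i\<in>I. \<xi> i ?z \<noteq> 0} \<subseteq> ?S" using e by auto
    have "y = (\<Sum>i\<in>{i\<in>I. \<xi> i y \<noteq> 0}. scal V (\<xi> i y) (b i))" using step by blast
    also have "\<dots> = (\<Sum>i\<in>?S. scal V (\<xi> i y) (b i))"
      using j by (intro sum.mono_neutral_left fin) auto
    finally have y: "y = (\<Sum>i\<in>?S. scal V (\<xi> i y) (b i))" .
    have "(\<Sum>i\<in>{i\<in>I. \<xi> i ?z \<noteq> 0}. scal V (\<xi> i ?z) (b i)) = (\<Sum>i\<in>?S. scal V (\<xi> i ?z) (b i))"
      using j by (intro sum.mono_neutral_left fin sub) auto
    also have "\<dots> = (\<Sum>i\<in>?S. (if i = j then scal V c (b i) else 0) + scal V (\<xi> i y) (b i))"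
      using e j by (intro sum.cong) (auto simp: V.scale_left_distrib)
    also have "\<dots> = ?z"
      using fin y j(2) unfolding sum.distrib by (simp add: sum.delta)
    finally show ?case using finite_subset[OF sub fin] step is_vspaceD(2)[OF V mj] j by simp
  qed
  show ?thesis unfolding coord_basis_def
  proof (intro conjI ballI impI V)
    fix x assume x: "x \<in> carrier V"
    then have x': "x \<in> V.span (b ` I)" using s by blast
    show "finite {i\<in>I. \<xi> i x \<noteq> 0}" using *[OF x'] by blast
    assume "\<forall>i\<in>I. \<xi> i x = 0"
    then have "{i\<in>I. \<xi> i x \<noteq> 0} = {}" by auto
    with *[OF x'] show "x = 0" by (metis sum.empty)
  qed (use m l d in auto)
qed

lemma coord_basis_exists:
  fixes V :: "('k::field, 'v::ab_group_add, 'm) vspace_scheme"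
  assumes V: "is_vspace V" and X: "X \<subseteq> carrier V" "module.independent (scal V) X"
  shows "\<exists>I \<xi>. X \<subseteq> I \<and> coord_basis V I (\<lambda>i. i) \<xi>"
proof -
  interpret V: vector_space "scal V" by (rule is_vspace_scal[OF V])
  obtain I where I: "X \<subseteq> I" "I \<subseteq> carrier V" "V.independent I" "carrier V \<subseteq> V.span I"
    using V.maximal_independent_subset_extend[OF X] by blast
  have sp: "V.span I \<subseteq> carrier V" using V I(2) by (intro V.span_minimal) (simp_all add: is_vspace_def)
  have "coord_basis V I (\<lambda>i. i) (\<lambda>i x. V.representation I x i)"
  proof (rule coord_basisI_span[OF V])
    show "linear_on V ground (\<lambda>x. V.representation I x i)" for i
      using subsetD[OF I(4)]
      by (auto simp: linear_on_ground_iff V.representation_add[OF I(3)] V.representation_scale[OF I(3)])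
    show "V.representation I j i = (if i = j then 1 else 0)" if "i \<in> I" "j \<in> I" for i j
      using V.representation_basis[OF I(3) that(2)] by auto
  qed (use I in auto)
  with I(1) show ?thesis by blast
qed

lemma coord_basis_transport:
  assumes B: "coord_basis W I c \<zeta>" and V: "is_vspace V" and f: "linear_on V W f" and bij: "bij_betw f (carrier V) (carrier W)"
  shows "coord_basis V I (\<lambda>i. inv_into (carrier V) f (c i)) (\<lambda>i x. \<zeta> i (f x))"
  unfolding coord_basis_def
proof (intro conjI ballI impI)
  note s = bij_betw_inv_into_right[OF bij] and m = linear_on_mem[OF f]
  have mi: "inv_into (carrier V) f y \<in> carrier V" if "y \<in> carrier W" for y
    using bij that by (metis bij_betw_imp_surj_on inv_into_into)
  show "is_vspace V" by (rule V)
  show "inv_into (carrier V) f (c i) \<in> carrier V" if "i \<in> I" for i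
    using mi coord_basis_mem[OF B that] by blast
  show "linear_on V ground (\<lambda>x. \<zeta> i (f x))" if "i \<in> I" for i
    by (rule linear_on_compose[OF coord_basis_linear[OF B that] f])
  show "\<zeta> i (f (inv_into (carrier V) f (c j))) = (if i = j then 1 else 0)" if "i \<in> I" "j \<in> I" for i j
    using s[OF coord_basis_mem[OF B that(2)]] coord_basis_dual[OF B that] by simp
  show "finite {i \<in> I. \<zeta> i (f x) \<noteq> 0}" if "x \<in> carrier V" for x
    by (rule coord_basis_finite[OF B m[OF that]])
  show "x = 0" if "x \<in> carrier V" "\<forall>i\<in>I. \<zeta> i (f x) = 0" for x
  proof -
    have "f x = f 0" using coord_basis_zero[OF B m[OF that(1)]] that(2) linear_on_zero[OF f V] by simp
    then show ?thesis using bij is_vspaceD(1)[OF V] that(1) unfolding bij_betw_def inj_on_def by blast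
  qed
qed

text \<open>
  The isomorphism sends \<open>x\<close> to the unique element with the same coordinates.
\<close>

lemma coord_basis_isomorphism:
  assumes A: "coord_basis V I b \<xi>" and B: "coord_basis W I c \<zeta>"
  shows "\<exists>f. linear_on V W f \<and> bij_betw f (carrier V) (carrier W) \<and> (\<forall>i\<in>I. f (b i) = c i)"
proof -
  note V = coord_basis_vspace[OF A] and W = coord_basis_vspace[OF B]
  have ex: "\<exists>y\<in>carrier W'. \<forall>i\<in>I. \<zeta>' i y = \<xi>' i x"
    if "coord_basis V' I b' \<xi>'" "coord_basis W' I c' \<zeta>'" "x \<in> carrier V'"
    for V' :: "('a, 'u::ab_group_add, 'n) vspace_scheme" and b' \<xi>'
      and W' :: "('a, 'w::ab_group_add, 'o) vspace_scheme" and c' \<zeta>' x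
  proof (intro bexI ballI)
    let ?S = "{i\<in>I. \<xi>' i x \<noteq> 0}" let ?y = "\<Sum>i\<in>?S. scal W' (\<xi>' i x) (c' i)"
    have S: "finite ?S" "?S \<subseteq> I" using coord_basis_finite[OF that(1,3)] by auto
    show "?y \<in> carrier W'" by (rule coord_basis_combination(1)[OF that(2) S])
    show "\<zeta>' i ?y = \<xi>' i x" if "i \<in> I" for i
      using coord_basis_combination(2)[OF \<open>coord_basis W' I c' \<zeta>'\<close> S that] that by simp
  qed
  define f where "f x = (SOME y. y \<in> carrier W \<and> (\<forall>i\<in>I. \<zeta> i y = \<xi> i x))" for x
  have f: "f x \<in> carrier W \<and> (\<forall>i\<in>I. \<zeta> i (f x) = \<xi> i x)" if "x \<in> carrier V" for x
    unfolding f_def by (rule someI_ex) (use ex[OF A B that] in blast)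
  note lv = coord_basis_linear[OF A] and lw = coord_basis_linear[OF B]
  have "linear_on V W f"
    unfolding linear_on_def
  proof (intro conjI ballI allI)
    show "f (x + y) = f x + f y" if "x \<in> carrier V" "y \<in> carrier V" for x y
      by (rule coord_basis_eq[OF B])
        (use f that is_vspaceD(2)[OF V that] is_vspaceD(2)[OF W] in \<open>auto simp: linear_on_add[OF lw] linear_on_add[OF lv]\<close>)
    show "f (scal V a x) = scal W a (f x)" if "x \<in> carrier V" for a x
      by (rule coord_basis_eq[OF B])
        (use f that is_vspaceD(3)[OF V that] is_vspaceD(3)[OF W] in \<open>auto simp: linear_on_scal[OF lw] linear_on_scal[OF lv]\<close>)
  qed (use f in auto)
  moreover have "bij_betw f (carrier V) (carrier W)"
  proof (rule bij_betwI')
    show "(f x = f y) = (x = y)" if "x \<in> carrier V" "y \<in> carrier V" for x y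
      using coord_basis_eq[OF A that] f that by metis
    show "f x \<in> carrier W" if "x \<in> carrier V" for x using f that by blast
    show "\<exists>x\<in>carrier V. y = f x" if y: "y \<in> carrier W" for y
    proof -
      obtain x where x: "x \<in> carrier V" "\<forall>i\<in>I. \<xi> i x = \<zeta> i y" using ex[OF B A y] by blast
      then have "y = f x" using f[OF x(1)] by (intro coord_basis_eq[OF B y]) auto
      with x(1) show ?thesis by blast
    qed
  qed
  moreover have "f (b i) = c i" if i: "i \<in> I" for i
    by (rule coord_basis_eq[OF B])
      (use f i coord_basis_mem[OF A i] coord_basis_mem[OF B i] coord_basis_dual[OF A _ i] coord_basis_dual[OF B _ i] in auto)
  ultimately show ?thesis by blast
qed

lemma coord_basis_subset:
  assumes B: "coord_basis V I b \<xi>" and J: "J \<subseteq> I"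
    and W: "scal W = scal V" "carrier W = module.span (scal V) (b ` J)"
  shows "coord_basis W J b \<xi>"
proof -
  note V = coord_basis_vspace[OF B]
  interpret V: vector_space "scal V" by (rule is_vspace_scal[OF V])
  have sub: "carrier W \<subseteq> carrier V"
    unfolding W coord_basis_span[OF B] using J by (intro V.span_mono) auto
  show ?thesis
  proof (rule coord_basisI_span)
    show "is_vspace W" unfolding is_vspace_def W by (simp add: V.vector_space_axioms)
    show "b i \<in> carrier W" if "i \<in> J" for i using that unfolding W by (intro V.span_base) auto
    show "linear_on W ground (\<xi> i)" if "i \<in> J" for i
      using coord_basis_linear[OF B, of i] that J sub by (auto simp: linear_on_ground_iff W(1) subset_iff)
    show "\<xi> i (b j) = (if i = j then 1 else 0)" if "i \<in> J" "j \<in> J" for i j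
      using that J by (intro coord_basis_dual[OF B]) auto
  qed (use W in auto)
qed

lemma span_subset_iff_coords:
  assumes B: "coord_basis V I b \<xi>" and J: "J \<subseteq> I"
  shows "module.span (scal V) (b ` J) = {x\<in>carrier V. \<forall>i\<in>I - J. \<xi> i x = 0}"
proof -
  note V = coord_basis_vspace[OF B]
  interpret V: vector_space "scal V" by (rule is_vspace_scal[OF V])
  let ?R = "{x\<in>carrier V. \<forall>i\<in>I - J. \<xi> i x = 0}"
  have "V.subspace ?R"
    using is_vspaceD[OF V] linear_on_zero[OF coord_basis_linear[OF B] V]
      linear_on_add[OF coord_basis_linear[OF B]] linear_on_scal[OF coord_basis_linear[OF B]]
    unfolding V.subspace_def by auto
  moreover have "b ` J \<subseteq> ?R" using J coord_basis_mem[OF B] coord_basis_dual[OF B] by (auto simp: subset_iff)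
  ultimately have "V.span (b ` J) \<subseteq> ?R" by (rule V.span_minimal[rotated])
  moreover have "x \<in> V.span (b ` J)" if x: "x \<in> ?R" for x
  proof -
    have "x = (\<Sum>i\<in>{i\<in>I. \<xi> i x \<noteq> 0}. scal V (\<xi> i x) (b i))"
      using x by (intro coord_basis_expansion[OF B] coord_basis_finite[OF B]) auto
    also have "\<dots> \<in> V.span (b ` J)" using x by (intro V.span_sum V.span_scale V.span_base) auto
    finally show ?thesis .
  qed
  ultimately show ?thesis by blast
qed

text \<open>
  Subtracting from \<open>b j\<close> its coordinates on dual basis elements of smaller rank \<open>\<rho>\<close> gives the next
  dual basis element. The functionals separate points: if \<open>j\<close> has maximal rank in the support of
  \<open>x\<close>, then \<open>\<xi> j x\<close> is the nonzero coordinate \<open>\<beta> j x\<close>.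
\<close>

lemma coord_basis_unitriangular:
  fixes \<rho> :: "'i \<Rightarrow> nat"
  assumes B: "coord_basis V I b \<beta>"
    and lin: "\<And>i. i \<in> I \<Longrightarrow> linear_on V ground (\<xi> i)"
    and fin: "\<And>x. x \<in> carrier V \<Longrightarrow> finite {i\<in>I. \<xi> i x \<noteq> 0}"
    and upper: "\<And>i j. i \<in> I \<Longrightarrow> j \<in> I \<Longrightarrow> \<rho> j < \<rho> i \<Longrightarrow> \<xi> i (b j) = 0"
    and diag: "\<And>i j. i \<in> I \<Longrightarrow> j \<in> I \<Longrightarrow> \<rho> j = \<rho> i \<Longrightarrow> \<xi> i (b j) = (if i = j then 1 else 0)"
  shows "\<exists>c. coord_basis V I c \<xi>"
proof -
  note V = coord_basis_vspace[OF B]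
  have ex: "\<exists>x\<in>carrier V. \<forall>i\<in>I. \<xi> i x = (if i = j then 1 else 0)" if "j \<in> I" for j
    using that
  proof (induction j rule: measure_induct_rule[of \<rho>])
    case (less j)
    let ?S = "{i\<in>I. \<xi> i (b j) \<noteq> 0} - {j}"
    have S: "finite ?S" using fin coord_basis_mem[OF B less(2)] by simp
    have "\<rho> i < \<rho> j" if "i \<in> ?S" for i
      using that upper[of i j] diag[of i j] less(2) by (cases "\<rho> i" "\<rho> j" rule: linorder_cases) auto
    then have "\<forall>i\<in>?S. \<exists>x. x \<in> carrier V \<and> (\<forall>i'\<in>I. \<xi> i' x = (if i' = i then 1 else 0))"
      using less(1) by blast
    from bchoice[OF this] obtain c where c: "\<And>i. i \<in> ?S \<Longrightarrow> c i \<in> carrier V"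
        "\<And>i i'. i \<in> ?S \<Longrightarrow> i' \<in> I \<Longrightarrow> \<xi> i' (c i) = (if i' = i then 1 else 0)" by blast
    let ?s = "\<Sum>i\<in>?S. scal V (\<xi> i (b j)) (c i)"
    have ms: "scal V (\<xi> i (b j)) (c i) \<in> carrier V" if "i \<in> ?S" for i
      using c(1)[OF that] is_vspaceD(3)[OF V] by blast
    have mem: "?s \<in> carrier V" using ms by (intro is_vspace_sum V)
    show ?case
    proof (intro bexI ballI)
      show "b j - ?s \<in> carrier V" using is_vspace_minus(1)[OF V coord_basis_mem[OF B less(2)] mem] .
      fix i assume i: "i \<in> I"
      have "\<xi> i ?s = (\<Sum>i'\<in>?S. \<xi> i (scal V (\<xi> i' (b j)) (c i')))"
        by (rule linear_on_sum[OF lin[OF i] V ms])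
      also have "\<dots> = (\<Sum>i'\<in>?S. if i' = i then \<xi> i (b j) else 0)"
        using c i by (intro sum.cong) (auto simp: linear_on_scal[OF lin[OF i] c(1)])
      also have "\<dots> = (if i \<in> ?S then \<xi> i (b j) else 0)" using S by simp
      finally have "\<xi> i (b j - ?s) = \<xi> i (b j) - (if i \<in> ?S then \<xi> i (b j) else 0)"
        using linear_on_diff[OF lin[OF i] V coord_basis_mem[OF B less(2)] mem] by simp
      then show "\<xi> i (b j - ?s) = (if i = j then 1 else 0)"
        using i less(2) diag[of j j] by auto
    qed
  qed
  then have "\<forall>j\<in>I. \<exists>x. x \<in> carrier V \<and> (\<forall>i\<in>I. \<xi> i x = (if i = j then 1 else 0))" by blast
  from bchoice[OF this] obtain c where c: "\<And>j. j \<in> I \<Longrightarrow> c j \<in> carrier V"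
      "\<And>i j. i \<in> I \<Longrightarrow> j \<in> I \<Longrightarrow> \<xi> i (c j) = (if i = j then 1 else 0)" by blast
  have "x = 0" if x: "x \<in> carrier V" and z: "\<forall>i\<in>I. \<xi> i x = 0" for x
  proof (rule ccontr)
    assume "x \<noteq> 0"
    let ?S = "{i\<in>I. \<beta> i x \<noteq> 0}"
    have S: "finite ?S" "?S \<noteq> {}" using coord_basis_finite[OF B x] coord_basis_zero[OF B x] \<open>x \<noteq> 0\<close> by auto
    have "\<exists>j\<in>?S. \<forall>i\<in>?S. \<rho> i \<le> \<rho> j"
    proof -
      have "Max (\<rho> ` ?S) \<in> \<rho> ` ?S" using S by (intro Max_in) auto
      then obtain j where "j \<in> ?S" "\<rho> j = Max (\<rho> ` ?S)" by auto
      then show ?thesis using S(1) by (intro bexI[of _ j]) (auto intro: Max_ge)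
    qed
    then obtain j where j: "j \<in> ?S" "\<And>i. i \<in> ?S \<Longrightarrow> \<rho> i \<le> \<rho> j" by blast
    have jI: "j \<in> I" using j by simp
    have m: "scal V (\<beta> i x) (b i) \<in> carrier V" if "i \<in> ?S" for i
      using that coord_basis_mem[OF B] is_vspaceD(3)[OF V] by blast
    have "\<xi> j x = \<xi> j (\<Sum>i\<in>?S. scal V (\<beta> i x) (b i))"
      using coord_basis_expansion[OF B x S(1)] by auto
    also have "\<dots> = (\<Sum>i\<in>?S. \<xi> j (scal V (\<beta> i x) (b i)))" by (rule linear_on_sum[OF lin[OF jI] V m])
    also have "\<dots> = (\<Sum>i\<in>?S. if i = j then \<beta> i x else 0)"
    proof (intro sum.cong refl)
      fix i assume i: "i \<in> ?S"
      have "\<rho> i \<le> \<rho> j" by (rule j(2)[OF i])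
      then have "\<xi> j (b i) = (if j = i then 1 else 0)"
        using i upper[OF jI, of i] diag[OF jI, of i] by (cases "\<rho> i = \<rho> j") auto
      then show "\<xi> j (scal V (\<beta> i x) (b i)) = (if i = j then \<beta> i x else 0)"
        using i coord_basis_mem[OF B, of i] by (simp add: linear_on_scal[OF lin[OF jI]])
    qed
    also have "\<dots> = \<beta> j x" using S j by simp
    finally show False using z jI j(1) by simp
  qed
  then have "coord_basis V I c \<xi>"
    unfolding coord_basis_def by (intro conjI ballI impI V c lin fin) auto
  then show ?thesis by blast
qed

section \<open>Bases of tensor products and tensor powers\<close>

lemma linear_on_cong_space:
  assumes "carrier V = carrier V'" "scal V = scal V'"
  shows "linear_on V W f = linear_on V' W f"
  using assms by (simp add: linear_on_def)

text \<open>
  A coalgebra and its underlying vector space are records of different types with the same tensors.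
\<close>

lemma tens_cong_space:
  assumes "carrier V = carrier V'" "scal V = scal V'" "carrier W = carrier W'" "scal W = scal W'"
  shows "tens V W = tens V' W'"
  unfolding tens_def bilinear_form_def
  using assms by (simp add: linear_on_cong_space[OF assms(1,2)] linear_on_cong_space[OF assms(3,4)])

lemma bilinear_form_mult:
  "linear_on V ground f \<Longrightarrow> linear_on W ground g \<Longrightarrow> bilinear_form V W (\<lambda>v w. f v * g w)"
  by (auto simp: bilinear_form_def linear_on_ground_iff algebra_simps)

text \<open>
  Tensors are functionals on bilinear forms, and \<open>\<xi> i \<otimes> \<zeta> j\<close> is evaluation at the product of the two
  functionals. It is linear on all functionals, without reference to the vector spaces.
\<close>

definition tensor_coord :: "('i \<Rightarrow> 'v \<Rightarrow> 'k) \<Rightarrow> ('j \<Rightarrow> 'w \<Rightarrow> 'k) \<Rightarrow> 'i \<times> 'j \<Rightarrow> ('k::field, 'v, 'w) tensor \<Rightarrow> 'k" where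
  "tensor_coord \<xi> \<zeta> p t = t (\<lambda>v w. \<xi> (fst p) v * \<zeta> (snd p) w)"

lemma tensor_coord_simps:
  "tensor_coord \<xi> \<zeta> p 0 = 0"
  "tensor_coord \<xi> \<zeta> p (s + t) = tensor_coord \<xi> \<zeta> p s + tensor_coord \<xi> \<zeta> p t"
  "tensor_coord \<xi> \<zeta> p (fscale a t) = a * tensor_coord \<xi> \<zeta> p t"
  by (simp_all add: tensor_coord_def)

lemma tensor_coord_sum: "tensor_coord \<xi> \<zeta> p (\<Sum>i\<in>S. t i) = (\<Sum>i\<in>S. tensor_coord \<xi> \<zeta> p (t i))"
  by (simp add: tensor_coord_def sum_fun_pointwise)

lemma linear_tensor_coord: "scal V = fscale \<Longrightarrow> linear_on V ground (tensor_coord \<xi> \<zeta> p)"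
  by (simp add: linear_on_ground_iff tensor_coord_simps)

lemma tensor_coord_tens:
  "linear_on V ground (\<xi> i) \<Longrightarrow> linear_on W ground (\<zeta> j) \<Longrightarrow>
    tensor_coord \<xi> \<zeta> (i, j) (tens V W v w) = \<xi> i v * \<zeta> j w"
  by (simp add: tensor_coord_def tens_def bilinear_form_mult)

lemma tensor_coord_map:
  "linear_on V' ground (\<xi> i) \<Longrightarrow> linear_on W' ground (\<zeta> j) \<Longrightarrow>
    tensor_coord \<xi> \<zeta> (i, j) (tensor_map V' W' f g t) = tensor_coord (\<lambda>i x. \<xi> i (f x)) (\<lambda>j y. \<zeta> j (g y)) (i, j) t"
  by (simp add: tensor_coord_def tensor_map_def lift_def tens_def bilinear_form_mult)

lemma tens_span_mem:
  assumes V: "is_vspace V" and W: "is_vspace W" and X: "X \<subseteq> carrier V" and Y: "Y \<subseteq> carrier W"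
    and v: "v \<in> module.span (scal V) X" and w: "w \<in> module.span (scal W) Y"
  shows "tens V W v w \<in> module.span fscale {tens V W x y | x y. x \<in> X \<and> y \<in> Y}"
proof -
  let ?T = "{tens V W x y | x y. x \<in> X \<and> y \<in> Y}"
  have m: "module (scal (tensor_prod V W))" using is_vspace_tensor_prod is_vspace_scal(2) by blast
  have wW: "w \<in> carrier W"
  proof -
    interpret W: module "scal W" by (rule is_vspace_scal[OF W])
    show ?thesis using w W.span_minimal[OF Y] W by (auto simp: is_vspace_def)
  qed
  have "tens V W x w \<in> module.span fscale ?T" if x: "x \<in> X" for x
  proof -
    have xV: "x \<in> carrier V" using x X by blast
    have "tens V W x y \<in> module.span fscale ?T" if "y \<in> Y" for y
      using x that by (intro span_fscale_base) blast
    then show ?thesis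
      using linear_on_span_mem[OF tens_bilinear(2)[OF xV] W m Y _ w, of ?T] by simp
  qed
  then show ?thesis
    using linear_on_span_mem[OF tens_bilinear(1)[OF wW] V m X _ v, of ?T] by auto
qed

lemma coord_basis_tensor_prod:
  fixes V :: "('k::field, 'v::ab_group_add, 'm) vspace_scheme" and W :: "('k, 'w::ab_group_add, 'n) vspace_scheme"
  assumes A: "coord_basis V I b \<xi>" and B: "coord_basis W J c \<zeta>"
  shows "coord_basis (tensor_prod V W) (I \<times> J) (\<lambda>(i, j). tens V W (b i) (c j)) (tensor_coord \<xi> \<zeta>)"
proof (rule coord_basisI_span)
  note lA = coord_basis_linear[OF A] and lB = coord_basis_linear[OF B]
  let ?b = "\<lambda>(i, j). tens V W (b i) (c j)"
  show "is_vspace (tensor_prod V W)" by (rule is_vspace_tensor_prod)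
  show "?b p \<in> carrier (tensor_prod V W)" if "p \<in> I \<times> J" for p
    using that coord_basis_mem[OF A] coord_basis_mem[OF B] by (auto simp del: tensor_prod_simps(1) intro!: tens_mem)
  show "linear_on (tensor_prod V W) ground (tensor_coord \<xi> \<zeta> p)" for p
    by (rule linear_tensor_coord) simp
  show "tensor_coord \<xi> \<zeta> p (?b q) = (if p = q then 1 else 0)" if "p \<in> I \<times> J" "q \<in> I \<times> J" for p q
    using that by (auto simp: tensor_coord_tens lA lB coord_basis_dual[OF A] coord_basis_dual[OF B] split: if_splits)
  interpret F: vector_space "fscale :: 'k \<Rightarrow> ('k, 'v, 'w) tensor \<Rightarrow> _" by (rule vector_space_fscale)
  have *: "{tens V W x y | x y. x \<in> b ` I \<and> y \<in> c ` J} = ?b ` (I \<times> J)" by auto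
  have "tens V W v w \<in> F.span (?b ` (I \<times> J))" if "v \<in> carrier V" "w \<in> carrier W" for v w
    unfolding *[symmetric]
    by (rule tens_span_mem[OF coord_basis_vspace[OF A] coord_basis_vspace[OF B]])
      (use that coord_basis_mem[OF A] coord_basis_mem[OF B] in \<open>auto simp: coord_basis_span[OF A] coord_basis_span[OF B]\<close>)
  then show "carrier (tensor_prod V W) \<subseteq> module.span (scal (tensor_prod V W)) (?b ` (I \<times> J))"
    unfolding tensor_prod_simps tensor_span_def by (intro F.span_minimal F.subspace_span) auto
qed

lemma tensor_eq_coords:
  assumes "coord_basis V I b \<xi>" "coord_basis W J c \<zeta>"
    and "s \<in> carrier (tensor_prod V W)" "t \<in> carrier (tensor_prod V W)"
    and "\<And>i j. i \<in> I \<Longrightarrow> j \<in> J \<Longrightarrow> tensor_coord \<xi> \<zeta> (i, j) s = tensor_coord \<xi> \<zeta> (i, j) t"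
  shows "s = t"
  by (rule coord_basis_eq[OF coord_basis_tensor_prod[OF assms(1,2)] assms(3,4)]) (use assms(5) in auto)

text \<open>
  The value at a word of length \<open>n\<close> of the product of \<open>m\<close> coordinate functionals. For \<open>m \<noteq> n\<close> it is
  \<open>0\<close>, because the tensor powers form a direct sum.
\<close>

fun list_coord :: "('i \<Rightarrow> 'v \<Rightarrow> 'k::field) \<Rightarrow> 'i list \<Rightarrow> 'v list \<Rightarrow> 'k" where
  "list_coord \<xi> [] [] = 1"
| "list_coord \<xi> (i # is) (v # vs) = \<xi> i v * list_coord \<xi> is vs"
| "list_coord \<xi> _ _ = 0"

definition word_coord :: "('i \<Rightarrow> 'v \<Rightarrow> 'k::field) \<Rightarrow> 'i list \<Rightarrow> ('k, 'v) words \<Rightarrow> 'k" where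
  "word_coord \<xi> is t = t (list_coord \<xi> is)"

lemma list_coord_length: "length is \<noteq> length vs \<Longrightarrow> list_coord \<xi> is vs = 0"
  by (induction \<xi> "is" vs rule: list_coord.induct) auto

lemma list_coord_append:
  "length is = length vs \<Longrightarrow> list_coord \<xi> (is @ js) (vs @ ws) = list_coord \<xi> is vs * list_coord \<xi> js ws"
  by (induction \<xi> "is" vs rule: list_coord.induct) auto

lemma list_coord_map:
  assumes "\<And>i j. i \<in> I \<Longrightarrow> j \<in> I \<Longrightarrow> \<xi> i (b j) = (if i = j then 1 else 0)" "set is \<subseteq> I" "set js \<subseteq> I"
  shows "list_coord \<xi> is (map b js) = (if is = js then 1 else 0)"
  using assms(2,3)
proof (induction "is" arbitrary: js)
  case Nil
  then show ?case by (cases js) auto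
next
  case (Cons i "is")
  then show ?case by (cases js) (auto simp: assms(1))
qed

lemma multilinear_list_coord:
  assumes "\<And>i. i \<in> set is \<Longrightarrow> linear_on V ground (\<xi> i)"
  shows "multilinear_form V (list_coord \<xi> is)"
proof -
  have "linear_on V ground (\<lambda>v. list_coord \<xi> is (xs @ v # ys))" for xs ys
    using assms
  proof (induction "is" arbitrary: xs)
    case Nil
    then show ?case by (cases xs) (auto simp: linear_on_ground_iff)
  next
    case (Cons i "is")
    then show ?case by (cases xs) (auto simp: linear_on_ground_iff algebra_simps)
  qed
  then show ?thesis by (simp add: multilinear_form_def)
qed

lemma word_coord_word:
  "(\<And>i. i \<in> set is \<Longrightarrow> linear_on V ground (\<xi> i)) \<Longrightarrow> word_coord \<xi> is (word V vs) = list_coord \<xi> is vs"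
  by (simp add: word_coord_def word_def multilinear_list_coord)

lemma tensor_alg_simps [simp]:
  "carrier (tensor_alg V) = module.span fscale (\<Union>n. tensor_power V n)" "scal (tensor_alg V) = fscale"
  by (simp_all add: tensor_alg_def)

lemma linear_word_coord: "linear_on (tensor_alg V) ground (word_coord \<xi> is)"
  by (simp add: linear_on_ground_iff word_coord_def)

text \<open>
  The letters of a word are expanded in the basis one at a time, from left to right: \<open>xs\<close> is the part
  that consists of basis vectors already.
\<close>

lemma word_span_mem:
  assumes V: "is_vspace V" and X: "X \<subseteq> carrier V" "carrier V = module.span (scal V) X"
    and "set xs \<subseteq> X" "set vs \<subseteq> carrier V" "length xs + length vs = n"
  shows "word V (xs @ vs) \<in> module.span fscale {word V ws | ws. set ws \<subseteq> X \<and> length ws = n}"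
proof -
  let ?Y = "{word V ws | ws. set ws \<subseteq> X \<and> length ws = n}"
  define S where "S = module.span fscale ?Y"
  have m: "module (scal (tensor_alg V))" using is_vspace_tensor_alg is_vspace_scal(2) by blast
  have "word V (xs @ vs) \<in> S" using assms(4-6)
  proof (induction vs arbitrary: xs)
    case Nil
    have "word V (xs @ []) \<in> ?Y" using Nil by auto
    then show ?case unfolding S_def by (rule span_fscale_base)
  next
    case (Cons v vs)
    have "linear_on V (tensor_alg V) (\<lambda>v. word V (xs @ v # vs))"
      using Cons X by (intro word_multilinear) auto
    moreover have "word V (xs @ x # vs) \<in> S" if "x \<in> X" for x
      using Cons.IH[of "xs @ [x]"] Cons.prems that by simp
    ultimately show ?case
      using linear_on_span_mem[of V "tensor_alg V" "\<lambda>v. word V (xs @ v # vs)" X ?Y v] V X Cons.prems m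
      by (simp add: S_def)
  qed
  then show ?thesis unfolding S_def .
qed

lemma tensor_power_eq_span:
  fixes V :: "('k::field, 'v::ab_group_add, 'm) vspace_scheme"
  assumes "coord_basis V I b \<xi>"
  shows "tensor_power V n = module.span fscale ((\<lambda>is. word V (map b is)) ` {is \<in> lists I. length is = n})"
proof -
  interpret F: vector_space "fscale :: 'k \<Rightarrow> ('k, 'v) words \<Rightarrow> _" by (rule vector_space_fscale)
  have I: "b ` I \<subseteq> carrier V" using coord_basis_mem[OF assms] by blast
  have e: "{word V ws | ws. set ws \<subseteq> b ` I \<and> length ws = n} = (\<lambda>is. word V (map b is)) ` {is \<in> lists I. length is = n}"
  proof -
    have "{ws. set ws \<subseteq> b ` I \<and> length ws = n} = map b ` {is \<in> lists I. length is = n}"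
      using lists_image[of b I] by (auto simp: in_lists_conv_set subset_iff image_iff set_eq_iff lists_eq_set)
    then show ?thesis by (auto simp: image_image set_eq_iff image_iff)
  qed
  have "word V vs \<in> F.span {word V ws | ws. set ws \<subseteq> b ` I \<and> length ws = n}"
    if "set vs \<subseteq> carrier V" "length vs = n" for vs
    using word_span_mem[OF coord_basis_vspace[OF assms] I coord_basis_span[OF assms], of "[]" vs n] that by simp
  then have "tensor_power V n \<subseteq> F.span {word V ws | ws. set ws \<subseteq> b ` I \<and> length ws = n}"
    unfolding tensor_power_def by (intro F.span_minimal F.subspace_span) auto
  moreover have "F.span {word V ws | ws. set ws \<subseteq> b ` I \<and> length ws = n} \<subseteq> tensor_power V n"
    unfolding tensor_power_def using I by (intro F.span_mono) blast
  ultimately show ?thesis unfolding e by blast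
qed

lemma coord_basis_tensor_alg:
  fixes V :: "('k::field, 'v::ab_group_add, 'm) vspace_scheme"
  assumes A: "coord_basis V I b \<xi>"
  shows "coord_basis (tensor_alg V) (lists I) (\<lambda>is. word V (map b is)) (word_coord \<xi>)"
proof (rule coord_basisI_span)
  show "is_vspace (tensor_alg V)" by (rule is_vspace_tensor_alg)
  show "word V (map b is) \<in> carrier (tensor_alg V)" if "is \<in> lists I" for "is"
    using that coord_basis_mem[OF A] by (intro word_mem) auto
  show "linear_on (tensor_alg V) ground (word_coord \<xi> is)" for "is" by (rule linear_word_coord)
  show "word_coord \<xi> is (word V (map b js)) = (if is = js then 1 else 0)" if "is \<in> lists I" "js \<in> lists I" for "is" js
  proof -
    have s: "set is \<subseteq> I" "set js \<subseteq> I" using that by auto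
    have "word_coord \<xi> is (word V (map b js)) = list_coord \<xi> is (map b js)"
      using s coord_basis_linear[OF A] by (intro word_coord_word) blast
    also have "\<dots> = (if is = js then 1 else 0)"
      using s coord_basis_dual[OF A] by (intro list_coord_map[of I]) auto
    finally show ?thesis .
  qed
  interpret F: vector_space "fscale :: 'k \<Rightarrow> ('k, 'v) words \<Rightarrow> _" by (rule vector_space_fscale)
  have "tensor_power V n \<subseteq> F.span ((\<lambda>is. word V (map b is)) ` lists I)" for n
    unfolding tensor_power_eq_span[OF A] by (intro F.span_mono) auto
  then show "carrier (tensor_alg V) \<subseteq> module.span (scal (tensor_alg V)) ((\<lambda>is. word V (map b is)) ` lists I)"
    unfolding tensor_alg_simps by (intro F.span_minimal F.subspace_span) auto
qed

section \<open>Deconcatenation bases\<close>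

definition splits :: "'i list \<Rightarrow> ('i list \<times> 'i list) set" where
  "splits w = {(u, v). u @ v = w}"

lemma splits_eq_image: "splits w = (\<lambda>i. (take i w, drop i w)) ` {..length w}"
proof (intro equalityI subsetI)
  fix p assume "p \<in> splits w"
  then have "p = (take (length (fst p)) w, drop (length (fst p)) w)" "length (fst p) \<le> length w"
    by (auto simp: splits_def)
  then show "p \<in> (\<lambda>i. (take i w, drop i w)) ` {..length w}" by blast
qed (auto simp: splits_def)

lemma finite_splits [simp]: "finite (splits w)"
  by (simp add: splits_eq_image)

lemma sum_splits: "(\<Sum>i\<le>length w. F (take i w) (drop i w)) = (\<Sum>(u, v)\<in>splits w. F u v)"
proof -
  have "inj_on (\<lambda>i. (take i w, drop i w)) {..length w}"
    by (auto simp: inj_on_def dest: arg_cong[of _ _ length])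
  then show ?thesis by (simp add: splits_eq_image sum.reindex)
qed

text \<open>
  Both sides are the sum over the factorizations of \<open>w\<close> into three words. This is the combinatorial
  content of coassociativity and of the associativity of convolution.
\<close>

lemma sum_splits_assoc:
  "(\<Sum>(u, v)\<in>splits w. \<Sum>(s, t)\<in>splits u. F s t v) = (\<Sum>(u, v)\<in>splits w. \<Sum>(s, t)\<in>splits v. F u s t)"
proof -
  have "(\<Sum>(u, v)\<in>splits w. \<Sum>(s, t)\<in>splits u. F s t v) =
      (\<Sum>(p, q)\<in>Sigma (splits w) (\<lambda>p. splits (fst p)). F (fst q) (snd q) (snd p))"
    by (subst sum.Sigma[symmetric]) (auto simp: case_prod_beta)
  also have "\<dots> = (\<Sum>(p, q)\<in>Sigma (splits w) (\<lambda>p. splits (snd p)). F (fst p) (fst q) (snd q))"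
    by (rule sum.reindex_bij_witness[of _ "\<lambda>(p, q). ((fst p @ fst q, snd q), (fst p, fst q))"
          "\<lambda>(p, q). ((fst q, snd q @ snd p), (snd q, snd p))"]) (auto simp: splits_def)
  also have "\<dots> = (\<Sum>(u, v)\<in>splits w. \<Sum>(s, t)\<in>splits v. F u s t)"
    by (subst sum.Sigma[symmetric]) (auto simp: case_prod_beta)
  finally show ?thesis .
qed

lemma splits_lists: "w \<in> lists I \<Longrightarrow> (u, v) \<in> splits w \<Longrightarrow> u \<in> lists I \<and> v \<in> lists I"
  by (auto simp: splits_def)

lemma sum_splits_delta:
  "(\<Sum>(s, t)\<in>splits w. (if u = s then 1 else 0) * (if v = t then 1 else (0::'k::field))) = (if w = u @ v then 1 else 0)"
proof -
  have "(\<Sum>(s, t)\<in>splits w. (if u = s then 1 else 0) * (if v = t then 1 else (0::'k))) =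
      (\<Sum>p\<in>splits w. if p = (u, v) then 1 else 0)"
    by (intro sum.cong) (auto split: if_splits)
  also have "\<dots> = (if w = u @ v then 1 else 0)"
    by (simp only: sum.delta[OF finite_splits]) (auto simp: splits_def)
  finally show ?thesis .
qed

definition deconc_basis ::
    "('k::field, 'v::ab_group_add, 'm) coalg_scheme \<Rightarrow> 'i set \<Rightarrow> ('i list \<Rightarrow> 'v) \<Rightarrow> ('i list \<Rightarrow> 'v \<Rightarrow> 'k) \<Rightarrow> bool" where
  "deconc_basis A I b \<xi> \<longleftrightarrow> coord_basis A (lists I) b \<xi> \<and>
     (\<forall>w\<in>lists I. coprod A (b w) = (\<Sum>(u, v)\<in>splits w. tens A A (b u) (b v))) \<and>
     (\<forall>w\<in>lists I. counit A (b w) = (if w = [] then 1 else 0))"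

lemma deconc_basisD:
  assumes "deconc_basis A I b \<xi>"
  shows deconc_coord_basis: "coord_basis A (lists I) b \<xi>"
    and deconc_coprod: "w \<in> lists I \<Longrightarrow> coprod A (b w) = (\<Sum>(u, v)\<in>splits w. tens A A (b u) (b v))"
    and deconc_counit: "w \<in> lists I \<Longrightarrow> counit A (b w) = (if w = [] then 1 else 0)"
  using assms by (auto simp: deconc_basis_def)

lemma tensor_coord_sum_splits:
  assumes B: "coord_basis A (lists I) b \<xi>" and w: "w \<in> lists I" "u \<in> lists I" "v \<in> lists I"
  shows "tensor_coord \<xi> \<xi> (u, v) (\<Sum>(s, t)\<in>splits w. tens A A (b s) (b t)) = (if w = u @ v then 1 else 0)"
proof -
  have "tensor_coord \<xi> \<xi> (u, v) (\<Sum>(s, t)\<in>splits w. tens A A (b s) (b t)) =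
      (\<Sum>(s, t)\<in>splits w. \<xi> u (b s) * \<xi> v (b t))"
    by (simp add: tensor_coord_sum case_prod_beta tensor_coord_tens coord_basis_linear[OF B] w)
  also have "\<dots> = (\<Sum>(s, t)\<in>splits w. (if u = s then 1 else 0) * (if v = t then 1 else 0))"
  proof (intro sum.cong refl)
    fix p assume "p \<in> splits w"
    then have "fst p \<in> lists I" "snd p \<in> lists I" using splits_lists[OF w(1), of "fst p" "snd p"] by simp_all
    with w show "(case p of (s, t) \<Rightarrow> \<xi> u (b s) * \<xi> v (b t)) =
        (case p of (s, t) \<Rightarrow> (if u = s then 1 else 0) * (if v = t then 1 else 0))"
      by (simp only: case_prod_beta coord_basis_dual[OF B])
  qed
  finally show ?thesis by (simp only: sum_splits_delta)
qed

text \<open>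
  The formula for the coproduct in its dual form: the coordinate functionals multiply under
  convolution as words do under concatenation.
\<close>

lemma deconc_basisI:
  assumes B: "coord_basis A (lists I) b \<xi>"
    and mem: "\<And>w. w \<in> lists I \<Longrightarrow> coprod A (b w) \<in> carrier (tensor_prod A A)"
    and co: "\<And>w u v. w \<in> lists I \<Longrightarrow> u \<in> lists I \<Longrightarrow> v \<in> lists I \<Longrightarrow>
      tensor_coord \<xi> \<xi> (u, v) (coprod A (b w)) = (if w = u @ v then 1 else 0)"
    and counit: "\<And>w. w \<in> lists I \<Longrightarrow> counit A (b w) = (if w = [] then 1 else 0)"
  shows "deconc_basis A I b \<xi>"
  unfolding deconc_basis_def
proof (intro conjI ballI B counit)
  fix w assume w: "w \<in> lists I"
  show "coprod A (b w) = (\<Sum>(u, v)\<in>splits w. tens A A (b u) (b v))"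
  proof (rule tensor_eq_coords[OF B B mem[OF w]])
    show "(\<Sum>(u, v)\<in>splits w. tens A A (b u) (b v)) \<in> carrier (tensor_prod A A)"
      using splits_lists[OF w] coord_basis_mem[OF B]
      by (intro is_vspace_sum is_vspace_tensor_prod) (auto simp del: tensor_prod_simps(1) intro!: tens_mem)
  qed (simp only: co[OF w] tensor_coord_sum_splits[OF B w])
qed

lemma deconc_coords:
  assumes A: "deconc_basis A I b \<xi>" and lin: "linear_on A (tensor_prod A A) (coprod A)"
    and x: "x \<in> carrier A" and u: "u \<in> lists I" "v \<in> lists I"
  shows "tensor_coord \<xi> \<xi> (u, v) (coprod A x) = \<xi> (u @ v) x"
proof (rule linear_on_coord_basis_eq[OF deconc_coord_basis[OF A] _ _ _ x, where W = ground])
  note B = deconc_coord_basis[OF A]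
  show "linear_on A ground (\<lambda>x. tensor_coord \<xi> \<xi> (u, v) (coprod A x))"
    by (rule linear_on_compose[OF linear_tensor_coord lin]) simp
  show "linear_on A ground (\<xi> (u @ v))" using u by (intro coord_basis_linear[OF B]) auto
  show "tensor_coord \<xi> \<xi> (u, v) (coprod A (b w)) = \<xi> (u @ v) (b w)" if w: "w \<in> lists I" for w
    using u by (simp only: deconc_coprod[OF A w] tensor_coord_sum_splits[OF B w u])
      (simp add: coord_basis_dual[OF B _ w])
qed

lemma deconc_counit_coord:
  assumes A: "deconc_basis A I b \<xi>" and lin: "linear_on A ground (counit A)" and x: "x \<in> carrier A"
  shows "counit A x = \<xi> [] x"
proof (rule linear_on_coord_basis_eq[OF deconc_coord_basis[OF A] lin _ _ x])
  note B = deconc_coord_basis[OF A]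
  show "linear_on A ground (\<xi> [])" by (intro coord_basis_linear[OF B]) auto
  show "counit A (b w) = \<xi> [] (b w)" if w: "w \<in> lists I" for w
    using coord_basis_dual[OF B _ w, of "[]"] by (simp add: deconc_counit[OF A w] eq_commute)
qed

lemma lift_sum: "lift f (\<Sum>i\<in>S. t i) = (\<Sum>i\<in>S. lift f (t i))"
  by (rule ext) (simp add: lift_def sum_fun_pointwise)

abbreviation (input) fun_space :: "('k::field, 'x \<Rightarrow> 'k) vspace" where
  "fun_space \<equiv> \<lparr>carrier = UNIV, scal = fscale\<rparr>"

lemma linear_on_lift: "linear_on V W f \<Longrightarrow> scal W = fscale \<Longrightarrow> linear_on V fun_space (\<lambda>x. lift g (f x))"
  by (simp add: linear_on_def)

text \<open>
  It suffices to verify the axioms at basis vectors, where coassociativity is \<open>sum_splits_assoc\<close> and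
  the counit leaves only the factorizations with an empty factor.
\<close>

lemma coalgebra_deconc:
  assumes A: "deconc_basis A I b \<xi>" and lin: "linear_on A (tensor_prod A A) (coprod A)"
    and lin': "linear_on A ground (counit A)"
  shows "coalgebra A"
proof
  note B = deconc_coord_basis[OF A]
  note m = coord_basis_mem[OF B]
  show V: "is_vspace A" by (rule coord_basis_vspace[OF B])
  show "linear_on A (tensor_prod A A) (coprod A)" "linear_on A ground (counit A)" by (rule lin lin')+
  have id: "linear_on A A id" by (simp add: linear_on_def)
  note l = linear_on_lift[OF lin tensor_prod_simps(2)]
  have memS: "tens A A (b s) (b t) \<in> carrier (tensor_prod A A)" if "w \<in> lists I" "(s, t) \<in> splits w" for s t w
    using splits_lists[OF that] m by (intro tens_mem) auto
  {
    fix x assume x: "x \<in> carrier A"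
    show "tensor_assoc A A A (tensor_map (tensor_prod A A) A (coprod A) id (coprod A x))
      = tensor_map A (tensor_prod A A) id (coprod A) (coprod A x)"
    proof (rule linear_on_coord_basis_eq[OF B _ _ _ x, where W = fun_space])
      show "linear_on A fun_space (\<lambda>x. tensor_assoc A A A (tensor_map (tensor_prod A A) A (coprod A) id (coprod A x)))"
        unfolding tensor_assoc_def tensor_map_def by (rule linear_on_lift[OF l]) simp
      show "linear_on A fun_space (\<lambda>x. tensor_map A (tensor_prod A A) id (coprod A) (coprod A x))"
        unfolding tensor_map_def by (rule l)
      fix w assume w: "w \<in> lists I"
      let ?T = "tensor_prod A A"
      have 1: "tensor_assoc A A A (tensor_map ?T A (coprod A) id (tens A A (b u) (b v))) =
          (\<Sum>(s, t)\<in>splits u. tens A ?T (b s) (tens A A (b t) (b v)))" if uv: "(u, v) \<in> splits w" for u v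
      proof -
        have u: "u \<in> lists I" "v \<in> lists I" using splits_lists[OF w uv] by auto
        have "tensor_map ?T A (coprod A) id (tens A A (b u) (b v)) =
            tens ?T A (\<Sum>p\<in>splits u. tens A A (b (fst p)) (b (snd p))) (b v)"
          by (simp add: tensor_map_tens[OF lin id] deconc_coprod[OF A u(1)] case_prod_beta)
        also have "\<dots> = (\<Sum>p\<in>splits u. tens ?T A (tens A A (b (fst p)) (b (snd p))) (b v))"
          using memS[OF u(1)] by (intro linear_on_sum[OF tens_bilinear(1)[OF m[OF u(2)]] is_vspace_tensor_prod]) auto
        finally have "tensor_assoc A A A (tensor_map ?T A (coprod A) id (tens A A (b u) (b v))) =
          (\<Sum>p\<in>splits u. tensor_assoc A A A (tens ?T A (tens A A (b (fst p)) (b (snd p))) (b v)))"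
          by (simp add: tensor_assoc_def lift_sum)
        also have "\<dots> = (\<Sum>(s, t)\<in>splits u. tens A ?T (b s) (tens A A (b t) (b v)))"
        proof (intro sum.cong refl)
          fix p assume "p \<in> splits u"
          then have "b (fst p) \<in> carrier A" "b (snd p) \<in> carrier A"
            using splits_lists[OF u(1), of "fst p" "snd p"] m by simp_all
          then show "tensor_assoc A A A (tens ?T A (tens A A (b (fst p)) (b (snd p))) (b v)) =
              (case p of (s, t) \<Rightarrow> tens A ?T (b s) (tens A A (b t) (b v)))"
            unfolding case_prod_beta by (rule tensor_assoc_tens[OF V V V _ _ m[OF u(2)]])
        qed
        finally show ?thesis .
      qed
      have 2: "tensor_map A ?T id (coprod A) (tens A A (b u) (b v)) =
          (\<Sum>(s, t)\<in>splits v. tens A ?T (b u) (tens A A (b s) (b t)))" if uv: "(u, v) \<in> splits w" for u v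
      proof -
        have u: "u \<in> lists I" "v \<in> lists I" using splits_lists[OF w uv] by auto
        have "tensor_map A ?T id (coprod A) (tens A A (b u) (b v)) =
            tens A ?T (b u) (\<Sum>p\<in>splits v. tens A A (b (fst p)) (b (snd p)))"
          by (simp add: tensor_map_tens[OF id lin] deconc_coprod[OF A u(2)] case_prod_beta)
        also have "\<dots> = (\<Sum>p\<in>splits v. tens A ?T (b u) (tens A A (b (fst p)) (b (snd p))))"
          using memS[OF u(2)] by (intro linear_on_sum[OF tens_bilinear(2)[OF m[OF u(1)]] is_vspace_tensor_prod]) auto
        finally show ?thesis by (simp add: case_prod_beta)
      qed
      have "tensor_assoc A A A (tensor_map ?T A (coprod A) id (coprod A (b w))) =
        (\<Sum>(u, v)\<in>splits w. tensor_assoc A A A (tensor_map ?T A (coprod A) id (tens A A (b u) (b v))))"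
        by (simp add: deconc_coprod[OF A w] case_prod_beta tensor_assoc_def tensor_map_def lift_sum)
      also have "\<dots> = (\<Sum>(u, v)\<in>splits w. \<Sum>(s, t)\<in>splits u. tens A ?T (b s) (tens A A (b t) (b v)))"
        using 1 by (intro sum.cong) auto
      also have "\<dots> = (\<Sum>(u, v)\<in>splits w. \<Sum>(s, t)\<in>splits v. tens A ?T (b u) (tens A A (b s) (b t)))"
        by (rule sum_splits_assoc)
      also have "\<dots> = (\<Sum>(u, v)\<in>splits w. tensor_map A ?T id (coprod A) (tens A A (b u) (b v)))"
        using 2 by (intro sum.cong) auto
      also have "\<dots> = tensor_map A ?T id (coprod A) (coprod A (b w))"
        by (simp add: deconc_coprod[OF A w] case_prod_beta tensor_map_def lift_sum)
      finally show "tensor_assoc A A A (tensor_map ?T A (coprod A) id (coprod A (b w))) =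
        tensor_map A ?T id (coprod A) (coprod A (b w))" .
    qed
    have g: "is_vspace (ground :: ('a, 'a) vspace)"
      by (simp add: is_vspace_def vector_space_mult module.subspace_UNIV[OF vector_space_mult[folded module_iff_vector_space]])
    have zl: "tens ground A 0 y = 0" "tens A ground y 0 = 0" if "y \<in> carrier A" for y
      using linear_on_zero[OF tens_bilinear(1)[OF that] g] linear_on_zero[OF tens_bilinear(2)[OF that] g] by auto
    show "tensor_map ground A (counit A) id (coprod A x) = tens ground A 1 x"
    proof (rule linear_on_coord_basis_eq[OF B _ _ _ x, where W = fun_space])
      show "linear_on A fun_space (\<lambda>x. tensor_map ground A (counit A) id (coprod A x))"
        unfolding tensor_map_def by (rule l)
      show "linear_on A fun_space (tens ground A 1)"
        using tens_bilinear(2)[of 1 ground A] by (simp add: linear_on_def)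
      fix w assume w: "w \<in> lists I"
      have "tensor_map ground A (counit A) id (coprod A (b w)) =
          (\<Sum>(u, v)\<in>splits w. tensor_map ground A (counit A) id (tens A A (b u) (b v)))"
        by (simp add: deconc_coprod[OF A w] case_prod_beta tensor_map_def lift_sum)
      also have "\<dots> = (\<Sum>p\<in>splits w. if p = ([], w) then tens ground A 1 (b w) else 0)"
        using splits_lists[OF w]
        by (intro sum.cong) (auto simp: tensor_map_tens[OF lin' id] deconc_counit[OF A] zl[OF m] splits_def)
      finally show "tensor_map ground A (counit A) id (coprod A (b w)) = tens ground A 1 (b w)"
        by (simp only: sum.delta[OF finite_splits]) (simp add: splits_def)
    qed
    show "tensor_map A ground id (counit A) (coprod A x) = tens A ground x 1"
    proof (rule linear_on_coord_basis_eq[OF B _ _ _ x, where W = fun_space])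
      show "linear_on A fun_space (\<lambda>x. tensor_map A ground id (counit A) (coprod A x))"
        unfolding tensor_map_def by (rule l)
      show "linear_on A fun_space (\<lambda>x. tens A ground x 1)"
        using tens_bilinear(1)[of 1 ground A] by (simp add: linear_on_def)
      fix w assume w: "w \<in> lists I"
      have "tensor_map A ground id (counit A) (coprod A (b w)) =
          (\<Sum>(u, v)\<in>splits w. tensor_map A ground id (counit A) (tens A A (b u) (b v)))"
        by (simp add: deconc_coprod[OF A w] case_prod_beta tensor_map_def lift_sum)
      also have "\<dots> = (\<Sum>p\<in>splits w. if p = (w, []) then tens A ground (b w) 1 else 0)"
        using splits_lists[OF w]
        by (intro sum.cong) (auto simp: tensor_map_tens[OF id lin'] deconc_counit[OF A] zl[OF m] splits_def)
      finally show "tensor_map A ground id (counit A) (coprod A (b w)) = tens A ground (b w) 1"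
        by (simp only: sum.delta[OF finite_splits]) (simp add: splits_def)
    qed
  }
qed

lemma coord_basis_reindex:
  assumes B: "coord_basis V I b \<xi>" and f: "bij_betw f J I"
  shows "coord_basis V J (\<lambda>j. b (f j)) (\<lambda>j. \<xi> (f j))"
  unfolding coord_basis_def
proof (intro conjI ballI impI coord_basis_vspace[OF B])
  have fI: "f j \<in> I" if "j \<in> J" for j using f that by (auto simp: bij_betw_def)
  show "b (f j) \<in> carrier V" "linear_on V ground (\<xi> (f j))" if "j \<in> J" for j
    using coord_basis_mem[OF B] coord_basis_linear[OF B] fI[OF that] by auto
  show "\<xi> (f i) (b (f j)) = (if i = j then 1 else 0)" if "i \<in> J" "j \<in> J" for i j
    using coord_basis_dual[OF B fI fI] that f by (auto simp: bij_betw_def inj_on_def)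
  show "finite {j \<in> J. \<xi> (f j) x \<noteq> 0}" if "x \<in> carrier V" for x
    using f by (intro finite_imageD[OF finite_subset[OF _ coord_basis_finite[OF B that]], of f])
      (auto simp: fI bij_betw_def intro: inj_on_subset)
  show "x = 0" if "x \<in> carrier V" "\<forall>j\<in>J. \<xi> (f j) x = 0" for x
    using that f by (intro coord_basis_zero[OF B that(1)]) (auto simp: bij_betw_def)
qed

section \<open>Primitive elements\<close>

text \<open>
  The coordinate of \<open>\<Delta> x\<close> at \<open>(u, v)\<close> is \<open>\<xi> (u @ v) x\<close>, whereas \<open>1 \<otimes> x + x \<otimes> 1\<close> has nonzero
  coordinates only where \<open>u\<close> or \<open>v\<close> is empty. Every word of length at least two is a product of
  nonempty words; for the empty word the comparison reads \<open>\<xi> [] x = \<xi> [] x + \<xi> [] x\<close>.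
\<close>

lemma primitive_iff_coords:
  assumes A: "deconc_basis A I b \<xi>" and lin: "linear_on A (tensor_prod A A) (coprod A)"
  shows "primitive A (b []) x \<longleftrightarrow> x \<in> carrier A \<and> (\<forall>w\<in>lists I. length w \<noteq> 1 \<longrightarrow> \<xi> w x = 0)"
proof (intro iffI conjI ballI impI)
  note B = deconc_coord_basis[OF A]
  have e: "b [] \<in> carrier A" by (rule coord_basis_mem[OF B]) auto
  have co: "tensor_coord \<xi> \<xi> (u, v) (tens A A (b []) x + tens A A x (b [])) =
      (if u = [] then \<xi> v x else 0) + (if v = [] then \<xi> u x else 0)" if "u \<in> lists I" "v \<in> lists I" for u v
    using that by (auto simp: tensor_coord_simps tensor_coord_tens coord_basis_linear[OF B] coord_basis_dual[OF B])
  {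
    assume x: "primitive A (b []) x"
    then show xA: "x \<in> carrier A" by (simp add: primitive_def)
    have *: "\<xi> (u @ v) x = (if u = [] then \<xi> v x else 0) + (if v = [] then \<xi> u x else 0)"
      if "u \<in> lists I" "v \<in> lists I" for u v
      using deconc_coords[OF A lin xA that] co[OF that] x by (simp add: primitive_def)
    fix w assume w: "w \<in> lists I" "length w \<noteq> 1"
    show "\<xi> w x = 0"
    proof (cases w)
      case Nil
      have "\<xi> [] x + 0 = \<xi> [] x + \<xi> [] x"
        using *[OF lists.Nil lists.Nil] by (simp only: append_Nil if_True simp_thms add_0_right)
      then show ?thesis unfolding Nil add_left_cancel by (rule sym)
    next
      case (Cons i v)
      then show ?thesis using *[of "[i]" v] w by (cases v) auto
    qed
  }
  assume x: "x \<in> carrier A \<and> (\<forall>w\<in>lists I. length w \<noteq> 1 \<longrightarrow> \<xi> w x = 0)"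
  have "coprod A x = tens A A (b []) x + tens A A x (b [])"
  proof (rule tensor_eq_coords[OF B B])
    show "coprod A x \<in> carrier (tensor_prod A A)" using linear_on_mem[OF lin] x by blast
    show "tens A A (b []) x + tens A A x (b []) \<in> carrier (tensor_prod A A)"
      using x e by (intro is_vspaceD(2)[OF is_vspace_tensor_prod] tens_mem) auto
    show "tensor_coord \<xi> \<xi> (u, v) (coprod A x) = tensor_coord \<xi> \<xi> (u, v) (tens A A (b []) x + tens A A x (b []))"
      if uv: "u \<in> lists I" "v \<in> lists I" for u v
    proof -
      have "\<xi> (u @ v) x = (if u = [] then \<xi> v x else 0) + (if v = [] then \<xi> u x else 0)"
      proof (cases "u = [] \<or> v = []")
        case False
        then have "length (u @ v) \<noteq> 1" by (cases u; cases v) auto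
        moreover have "u @ v \<in> lists I" using uv by auto
        ultimately show ?thesis using x False by auto
      qed (use x uv in auto)
      then show ?thesis using deconc_coords[OF A lin _ uv] x by (simp only: co[OF uv])
    qed
  qed
  then show "primitive A (b []) x" using x by (simp add: primitive_def)
qed

lemma bij_betw_singleton_lists: "bij_betw (\<lambda>i. [i]) I {w \<in> lists I. length w = 1}"
  by (rule bij_betwI') (auto simp: length_Suc_conv)

lemma primitives_eq_span:
  assumes A: "deconc_basis A I b \<xi>" and lin: "linear_on A (tensor_prod A A) (coprod A)"
  shows "{x. primitive A (b []) x} = module.span (scal A) (b ` {w \<in> lists I. length w = 1})"
  unfolding primitive_iff_coords[OF A lin]
  by (subst span_subset_iff_coords[OF deconc_coord_basis[OF A]]) auto

lemma coord_basis_primitives: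
  assumes A: "deconc_basis A I b \<xi>" and lin: "linear_on A (tensor_prod A A) (coprod A)"
  shows "coord_basis \<lparr>carrier = {x. primitive A (b []) x}, scal = scal A\<rparr> I (\<lambda>i. b [i]) (\<lambda>i. \<xi> [i])"
  by (rule coord_basis_reindex[OF coord_basis_subset[OF deconc_coord_basis[OF A]] bij_betw_singleton_lists])
    (auto simp: primitives_eq_span[OF A lin])

section \<open>Cofree coalgebras and deconcatenation bases\<close>

lemma cofree_coalg_simps [simp]:
  "carrier (cofree_coalg V) = carrier (tensor_alg V)" "scal (cofree_coalg V) = fscale"
  by (simp_all add: cofree_coalg_def)

text \<open>
  In \<open>C(V)\<close> the words in a basis of \<open>V\<close> are a deconcatenation basis; the isomorphism carries it back.
\<close>

lemma deconc_basis_of_iso: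
  assumes iso: "coalg_iso A (cofree_coalg V) \<phi>" and A: "is_vspace A" "linear_on A (tensor_prod A A) (coprod A)"
    and B: "coord_basis V J g \<gamma>"
  shows "\<exists>b \<xi>. deconc_basis A J b \<xi> \<and> (\<forall>w\<in>lists J. \<phi> (b w) = word V (map g w))"
proof -
  let ?F = "cofree_coalg V" and ?T = "tensor_alg V"
  have lin: "linear_on A ?F \<phi>" and bij: "bij_betw \<phi> (carrier A) (carrier ?F)"
    and co: "\<And>x. x \<in> carrier A \<Longrightarrow> coprod ?F (\<phi> x) = tensor_map ?F ?F \<phi> \<phi> (coprod A x)"
    and cu: "\<And>x. x \<in> carrier A \<Longrightarrow> counit ?F (\<phi> x) = counit A x"
    using iso by (auto simp: coalg_iso_def)
  note T = coord_basis_tensor_alg[OF B]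
  have lin': "linear_on A ?T \<phi>" using lin by (simp add: linear_on_def)
  define b where "b w = inv_into (carrier A) \<phi> (word V (map g w))" for w
  define \<xi> where "\<xi> w x = word_coord \<gamma> w (\<phi> x)" for w x
  have X: "coord_basis A (lists J) b \<xi>"
    unfolding b_def[abs_def] \<xi>_def[abs_def]
    by (rule coord_basis_transport[OF T A(1) lin']) (use bij in simp)
  have \<phi>b: "\<phi> (b w) = word V (map g w)" if "w \<in> lists J" for w
    unfolding b_def by (rule bij_betw_inv_into_right[OF bij]) (use coord_basis_mem[OF T that] in simp)
  have gV: "set (map g w) \<subseteq> carrier V" if "w \<in> lists J" for w
    using that coord_basis_mem[OF B] by auto
  have "deconc_basis A J b \<xi>"
  proof (rule deconc_basisI[OF X])
    fix w assume w: "w \<in> lists J"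
    note wA = coord_basis_mem[OF X w]
    show "coprod A (b w) \<in> carrier (tensor_prod A A)" by (rule linear_on_mem[OF A(2) wA])
    show "counit A (b w) = (if w = [] then 1 else 0)"
      using cu[OF wA] by (simp add: \<phi>b[OF w] cofree_coalg_counit)
    fix u v assume uv: "u \<in> lists J" "v \<in> lists J"
    have lw: "linear_on ?F ground (word_coord \<gamma> w)" for w by (simp add: linear_on_ground_iff word_coord_def)
    have "tensor_coord \<xi> \<xi> (u, v) (coprod A (b w)) =
        tensor_coord (word_coord \<gamma>) (word_coord \<gamma>) (u, v) (coprod ?F (\<phi> (b w)))"
      unfolding co[OF wA] by (subst tensor_coord_map[OF lw lw]) (simp add: \<xi>_def[abs_def])
    also have "coprod ?F (\<phi> (b w)) = (\<Sum>i\<le>length w. tens ?T ?T (word V (map g (take i w))) (word V (map g (drop i w))))"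
      by (simp only: \<phi>b[OF w] cofree_coalg_coprod[OF gV[OF w]] length_map take_map drop_map)
    also have "\<dots> = (\<Sum>(s, t)\<in>splits w. tens ?T ?T (word V (map g s)) (word V (map g t)))"
      by (rule sum_splits)
    also have "tensor_coord (word_coord \<gamma>) (word_coord \<gamma>) (u, v) \<dots> = (if w = u @ v then 1 else 0)"
      by (rule tensor_coord_sum_splits[OF T w uv])
    finally show "tensor_coord \<xi> \<xi> (u, v) (coprod A (b w)) = (if w = u @ v then 1 else 0)" .
  qed
  with \<phi>b show ?thesis by blast
qed

text \<open>
  The isomorphism sends \<open>b w\<close> to the word of the primitive elements \<open>b [i]\<close>. That it sends
  each primitive element to itself as a one-letter word will make it possible to prescribe the values
  of a deconcatenation basis at the letters.
\<close>

lemma iso_of_deconc_basis: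
  fixes A :: "('k::field, 'v::ab_group_add, 'm) coalg_scheme"
  assumes A: "deconc_basis A I b \<xi>" and lin: "linear_on A (tensor_prod A A) (coprod A)"
    and lin': "linear_on A ground (counit A)"
  defines "P \<equiv> \<lparr>carrier = {x. primitive A (b []) x}, scal = scal A\<rparr>"
  shows "\<exists>\<phi>. coalg_iso A (cofree_coalg P) \<phi> \<and> (\<forall>x\<in>carrier P. \<phi> x = word P [x])"
proof -
  let ?F = "cofree_coalg P" and ?T = "tensor_alg P"
  note B = deconc_coord_basis[OF A]
  have P: "coord_basis P I (\<lambda>i. b [i]) (\<lambda>i. \<xi> [i])"
    unfolding P_def by (rule coord_basis_primitives[OF A lin])
  note T = coord_basis_tensor_alg[OF P]
  obtain \<phi> where l: "linear_on A ?T \<phi>" and bij: "bij_betw \<phi> (carrier A) (carrier ?T)"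
    and \<phi>b: "\<And>w. w \<in> lists I \<Longrightarrow> \<phi> (b w) = word P (map (\<lambda>i. b [i]) w)"
    using coord_basis_isomorphism[OF B T] by blast
  have lF: "linear_on A ?F \<phi>" using l by (simp add: linear_on_def)
  have bP: "set (map (\<lambda>i. b [i]) w) \<subseteq> carrier P" if "w \<in> lists I" for w
    using that coord_basis_mem[OF P] by auto
  have "coprod ?F (\<phi> x) = tensor_map ?F ?F \<phi> \<phi> (coprod A x)" if x: "x \<in> carrier A" for x
  proof (rule linear_on_coord_basis_eq[OF B _ _ _ x, where W = fun_space])
    show "linear_on A fun_space (\<lambda>x. coprod ?F (\<phi> x))"
      using l by (simp add: linear_on_def cofree_coalg_def word_lift_def fun_eq_iff)
    show "linear_on A fun_space (\<lambda>x. tensor_map ?F ?F \<phi> \<phi> (coprod A x))"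
      unfolding tensor_map_def by (intro linear_on_lift[OF lin]) simp
    fix w assume w: "w \<in> lists I"
    have t: "tens ?F ?F = tens ?T ?T" by (rule tens_cong_space) simp_all
    have "coprod ?F (\<phi> (b w)) = (\<Sum>i\<le>length w. tens ?T ?T (word P (map (\<lambda>i. b [i]) (take i w))) (word P (map (\<lambda>i. b [i]) (drop i w))))"
      by (simp only: \<phi>b[OF w] cofree_coalg_coprod[OF bP[OF w]] length_map take_map drop_map)
    also have "\<dots> = (\<Sum>(s, t)\<in>splits w. tens ?T ?T (word P (map (\<lambda>i. b [i]) s)) (word P (map (\<lambda>i. b [i]) t)))"
      by (rule sum_splits)
    also have "\<dots> = (\<Sum>(s, t)\<in>splits w. tensor_map ?F ?F \<phi> \<phi> (tens A A (b s) (b t)))"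
      using splits_lists[OF w] by (intro sum.cong) (auto simp: tensor_map_tens[OF lF lF] t \<phi>b)
    also have "\<dots> = tensor_map ?F ?F \<phi> \<phi> (coprod A (b w))"
      by (simp add: deconc_coprod[OF A w] case_prod_beta tensor_map_def lift_sum)
    finally show "coprod ?F (\<phi> (b w)) = tensor_map ?F ?F \<phi> \<phi> (coprod A (b w))" .
  qed
  moreover have "counit ?F (\<phi> x) = counit A x" if x: "x \<in> carrier A" for x
  proof (rule linear_on_coord_basis_eq[OF B _ lin' _ x])
    show "linear_on A ground (\<lambda>x. counit ?F (\<phi> x))"
      using l by (simp add: linear_on_def cofree_coalg_def)
    show "counit ?F (\<phi> (b w)) = counit A (b w)" if w: "w \<in> lists I" for w
      by (simp add: \<phi>b[OF w] cofree_coalg_counit deconc_counit[OF A w])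
  qed
  ultimately have "coalg_iso A ?F \<phi>" using lF bij by (simp add: coalg_iso_def)
  moreover have "\<phi> x = word P [x]" if x: "x \<in> carrier P" for x
  proof (rule linear_on_coord_basis_eq[OF P _ _ _ x])
    have "carrier P \<subseteq> carrier A" by (auto simp: P_def primitive_def)
    then show "linear_on P ?T \<phi>" using l by (simp add: linear_on_def subset_iff) (simp add: P_def)
    show "linear_on P ?T (\<lambda>x. word P [x])" using word_multilinear[of "[]" P "[]"] by simp
    show "\<phi> (b [i]) = word P [b [i]]" if "i \<in> I" for i using \<phi>b[of "[i]"] that by simp
  qed
  ultimately show ?thesis by blast
qed

lemma cofree_of_deconc_basis:
  assumes A: "deconc_basis A I b \<xi>" and lin: "linear_on A (tensor_prod A A) (coprod A)"
    and lin': "linear_on A ground (counit A)"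
  shows "cofree A"
proof -
  let ?P = "{x. primitive A (b []) x}"
  interpret A: module "scal A" by (rule is_vspace_scal[OF coord_basis_vspace[OF deconc_coord_basis[OF A]]])
  have "A.subspace ?P" unfolding primitives_eq_span[OF A lin] by (rule A.subspace_span)
  moreover have "?P \<subseteq> carrier A" by (auto simp: primitive_def)
  ultimately show ?thesis
    using coalgebra_deconc[OF assms] iso_of_deconc_basis[OF assms] unfolding cofree_def by blast
qed

lemma deconc_basis_of_cofree:
  assumes "cofree A"
  shows "\<exists>I b \<xi>. deconc_basis A (I :: 'v set) b (\<xi> :: 'v list \<Rightarrow> 'v::ab_group_add \<Rightarrow> 'k::field)"
proof -
  interpret coalgebra A using assms by (simp add: cofree_def)
  obtain V \<phi> where V: "module.subspace (scal A) V" "coalg_iso A (cofree_coalg \<lparr>carrier = V, scal = scal A\<rparr>) \<phi>"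
    using assms by (auto simp: cofree_def)
  interpret A: vector_space "scal A" by (rule is_vspace_scal[OF is_vspace])
  have "is_vspace \<lparr>carrier = V, scal = scal A\<rparr>"
    unfolding is_vspace_def using V(1) by (simp add: A.vector_space_axioms)
  then obtain I \<gamma> where "coord_basis \<lparr>carrier = V, scal = scal A\<rparr> I (\<lambda>i. i) \<gamma>"
    using coord_basis_exists[of "\<lparr>carrier = V, scal = scal A\<rparr>" "{}"] A.independent_empty by auto
  from deconc_basis_of_iso[OF V(2) is_vspace linear_coprod this] show ?thesis by blast
qed

text \<open>
  Through the isomorphism of \<open>iso_of_deconc_basis\<close>, words in any basis of the space of primitive
  elements form a deconcatenation basis.
\<close>

lemma deconc_basis_extending:
  assumes A: "deconc_basis A I b \<xi>" and co: "coalgebra A"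
    and J: "coord_basis \<lparr>carrier = {x. primitive A (b []) x}, scal = scal A\<rparr> J g \<gamma>"
  shows "\<exists>b' \<xi>'. deconc_basis A J b' \<xi>' \<and> (\<forall>j\<in>J. b' [j] = g j)"
proof -
  interpret coalgebra A by (rule co)
  let ?P = "\<lparr>carrier = {x. primitive A (b []) x}, scal = scal A\<rparr>"
  obtain \<phi> where iso: "coalg_iso A (cofree_coalg ?P) \<phi>" and \<phi>: "\<And>x. x \<in> carrier ?P \<Longrightarrow> \<phi> x = word ?P [x]"
    using iso_of_deconc_basis[OF A linear_coprod linear_counit] by blast
  obtain b' \<xi>' where b': "deconc_basis A J b' \<xi>'" "\<And>w. w \<in> lists J \<Longrightarrow> \<phi> (b' w) = word ?P (map g w)"
    using deconc_basis_of_iso[OF iso is_vspace linear_coprod J] by blast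
  have "b' [j] = g j" if j: "j \<in> J" for j
  proof -
    have g: "g j \<in> carrier ?P" by (rule coord_basis_mem[OF J j])
    then have "g j \<in> carrier A" by (simp add: primitive_def)
    moreover have "b' [j] \<in> carrier A" using coord_basis_mem[OF deconc_coord_basis[OF b'(1)]] j by auto
    moreover have "\<phi> (b' [j]) = \<phi> (g j)" using b'(2)[of "[j]"] \<phi>[OF g] j by simp
    moreover have "inj_on \<phi> (carrier A)" using iso by (simp add: coalg_iso_def bij_betw_def)
    ultimately show ?thesis by (simp add: inj_on_eq_iff)
  qed
  with b'(1) show ?thesis by blast
qed

section \<open>The unit of a connected graded coalgebra\<close>

text \<open>
  For group-like \<open>g\<close> the map \<open>u \<mapsto> \<xi> u g\<close> is multiplicative. If it were nonzero at a nonempty word, it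
  would be nonzero at all powers of that word, but \<open>g\<close> has finitely many nonzero coordinates.
\<close>

lemma grouplike_unique:
  assumes A: "deconc_basis A I b \<xi>" and co: "coalgebra A"
    and g: "g \<in> carrier A" "coprod A g = tens A A g g" "counit A g = 1"
  shows "g = b []"
proof -
  interpret coalgebra A by (rule co)
  note B = deconc_coord_basis[OF A]
  have m: "\<xi> (u @ v) g = \<xi> u g * \<xi> v g" if "u \<in> lists I" "v \<in> lists I" for u v
    using deconc_coords[OF A linear_coprod g(1) that] g(2) that
    by (simp add: tensor_coord_tens coord_basis_linear[OF B])
  have z: "\<xi> u g = 0" if u: "u \<in> lists I" "u \<noteq> []" for u
  proof (rule ccontr)
    assume "\<xi> u g \<noteq> 0"
    have "concat (replicate (Suc n) u) \<in> {w \<in> lists I. \<xi> w g \<noteq> 0}" for n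
    proof (induction n)
      case 0
      then show ?case using u \<open>\<xi> u g \<noteq> 0\<close> by simp
    next
      case (Suc n)
      then have "concat (replicate (Suc n) u) \<in> lists I" "\<xi> (concat (replicate (Suc n) u)) g \<noteq> 0" by auto
      then show ?case using m[OF u(1)] u \<open>\<xi> u g \<noteq> 0\<close> by auto
    qed
    then have "range (\<lambda>n. concat (replicate (Suc n) u)) \<subseteq> {w \<in> lists I. \<xi> w g \<noteq> 0}" by blast
    moreover have "inj (\<lambda>n. concat (replicate (Suc n) u))"
    proof (rule injI)
      fix n k assume "concat (replicate (Suc n) u) = concat (replicate (Suc k) u)"
      then have "length (concat (replicate (Suc n) u)) = length (concat (replicate (Suc k) u))" by simp
      then show "n = k" using u(2) by (simp add: length_concat sum_list_replicate)
    qed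
    ultimately show False
      using coord_basis_finite[OF B g(1)] finite_subset finite_imageD infinite_UNIV_nat by blast
  qed
  have "\<xi> [] g = 1" using deconc_counit_coord[OF A linear_counit g(1)] g(3) by simp
  then show ?thesis
    using z coord_basis_mem[OF B, of "[]"] coord_basis_dual[OF B _ , of _ "[]"]
    by (intro coord_basis_eq[OF B g(1)]) auto
qed

text \<open>
  The component of degree \<open>0\<close> of \<open>b []\<close> has counit \<open>1\<close>, since the counit vanishes in positive degrees.
  It is group-like because the part of degree \<open>0\<close> of the coalgebra, and so its tensor square, is a
  line; hence it equals \<open>b []\<close>.
\<close>

lemma unit_elt_deconc:
  assumes gr: "connected_graded_coalgebra A" and A: "deconc_basis A I b \<xi>"
  shows "unit_elt A = b []" "b [] \<in> grade A 0" "\<And>y. y \<in> grade A 0 \<Longrightarrow> y = scal A (counit A y) (b [])"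
proof -
  interpret connected_graded_coalgebra A by (rule gr)
  interpret V: vector_space "scal A" by (rule is_vspace_scal[OF is_vspace])
  note B = deconc_coord_basis[OF A]
  have e: "b [] \<in> carrier A" by (rule coord_basis_mem[OF B]) auto
  let ?k = "\<lambda>n. component (grade A) n (b [])"
  define x0 where "x0 = ?k 0"
  have x0: "x0 \<in> grade A 0" unfolding x0_def by (rule component_mem[OF e])
  then have x0A: "x0 \<in> carrier A" using grade_subset by blast
  have "counit A x0 = 1"
  proof -
    have d: "decomposes (grade A) (b []) ?k" by (rule component_decomposes[OF e])
    let ?S = "insert 0 {n. ?k n \<noteq> 0}"
    have S: "finite ?S" using d by (simp add: decomposes_def)
    have "b [] = (\<Sum>n\<in>{n. ?k n \<noteq> 0}. ?k n)" using d by (simp add: decomposes_def)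
    also have "\<dots> = (\<Sum>n\<in>?S. ?k n)" by (intro sum.mono_neutral_left S) auto
    finally have "counit A (b []) = counit A (\<Sum>n\<in>?S. ?k n)" by simp
    also have "\<dots> = (\<Sum>n\<in>?S. counit A (?k n))"
      using component_mem[OF e] grade_subset by (intro linear_on_sum[OF linear_counit is_vspace]) blast
    also have "\<dots> = (\<Sum>n\<in>?S. if n = 0 then counit A x0 else 0)"
      using counit_grade[OF component_mem[OF e]] by (intro sum.cong) (auto simp: x0_def)
    also have "\<dots> = counit A x0" using S by simp
    finally show ?thesis using deconc_counit[OF A, of "[]"] by simp
  qed
  obtain E where E: "E \<subseteq> grade A 0" "grade A 0 \<subseteq> V.span E" "card E = 1"
    by (rule V.basis_exists[of "grade A 0"]) (simp add: connected)
  then obtain e0 where e0: "E = {e0}" by (auto simp: card_1_singleton_iff)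
  have cs: "counit A (scal A c y) = c * counit A y" if "y \<in> carrier A" for c y
    using linear_on_scal[OF linear_counit that] by simp
  have e0A: "e0 \<in> carrier A" using E e0 grade_subset by blast
  have mult: "\<exists>c. y = scal A c x0" if y: "y \<in> grade A 0" for y
  proof -
    obtain c1 where c1: "x0 = scal A c1 e0" using x0 E(2) by (auto simp: e0 V.span_singleton)
    obtain c2 where c2: "y = scal A c2 e0" using y E(2) by (auto simp: e0 V.span_singleton)
    have "c1 \<noteq> 0" using \<open>counit A x0 = 1\<close> cs[OF e0A, of c1] c1 by auto
    then have "y = scal A (c2 / c1) x0" by (simp add: c1 c2)
    then show ?thesis ..
  qed
  have unique: "y = x0" if y: "y \<in> grade A 0" "counit A y = 1" for y
  proof -
    obtain c where c: "y = scal A c x0" using mult[OF y(1)] by blast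
    then have "c = 1" using cs[OF x0A, of c] y(2) \<open>counit A x0 = 1\<close> by simp
    then show ?thesis using c by simp
  qed
  have u: "unit_elt A = x0"
    unfolding unit_elt_def
    by (rule the_equality, rule conjI[OF x0 \<open>counit A x0 = 1\<close>]) (elim conjE, rule unique)
  \<comment> \<open>Elements of degree \<open>0\<close> of the tensor square are multiples of \<open>x0 \<otimes> x0\<close>.\<close>
  have "\<exists>c. t = fscale c (tens A A x0 x0)"
    if t: "t \<in> module.span fscale (\<Union>i\<le>0. tensor_span A A (grade A i) (grade A (0 - i)))" for t
  proof -
    interpret F: vector_space "fscale :: 'a \<Rightarrow> ('a, 'b, 'b) tensor \<Rightarrow> _" by (rule vector_space_fscale)
    have "tens A A v w \<in> F.span {tens A A x0 x0}" if vw: "v \<in> grade A 0" "w \<in> grade A 0" for v w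
    proof -
      obtain c where c: "v = scal A c x0" using mult[OF vw(1)] by blast
      obtain d where d: "w = scal A d x0" using mult[OF vw(2)] by blast
      have "v \<in> carrier A" using vw grade_subset by blast
      then have "tens A A v w = fscale d (tens A A v x0)"
        using linear_on_scal[OF tens_bilinear(2) x0A] d by simp
      also have "tens A A v x0 = fscale c (tens A A x0 x0)"
        using linear_on_scal[OF tens_bilinear(1)[OF x0A] x0A] c by simp
      finally have eq: "tens A A v w = fscale d (fscale c (tens A A x0 x0))" .
      show ?thesis unfolding eq by (intro F.span_scale F.span_base) blast
    qed
    then have "tensor_span A A (grade A 0) (grade A 0) \<subseteq> F.span {tens A A x0 x0}"
      unfolding tensor_span_def by (intro F.span_minimal F.subspace_span) auto
    then have "F.span (\<Union>i\<le>0. tensor_span A A (grade A i) (grade A (0 - i))) \<subseteq> F.span {tens A A x0 x0}"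
      by (intro F.span_minimal F.subspace_span) auto
    with t show ?thesis by (auto simp: F.span_singleton)
  qed
  then obtain c where c: "coprod A x0 = fscale c (tens A A x0 x0)" using coprod_grade[OF x0] by blast
  have x00: "\<xi> [] x0 = 1" using deconc_counit_coord[OF A linear_counit x0A] \<open>counit A x0 = 1\<close> by simp
  then have "c = 1"
    using deconc_coords[OF A linear_coprod x0A, of "[]" "[]"] c
    by (simp add: tensor_coord_simps tensor_coord_tens coord_basis_linear[OF B])
  then have "coprod A x0 = tens A A x0 x0" using c by (simp add: fscale_def)
  then have "x0 = b []" using \<open>counit A x0 = 1\<close> by (intro grouplike_unique[OF A coalgebra_axioms x0A])
  then show "unit_elt A = b []" "b [] \<in> grade A 0" using u x0 by auto
  show "y = scal A (counit A y) (b [])" if y: "y \<in> grade A 0" for y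
  proof -
    obtain c where c: "y = scal A c x0" using mult[OF y] by blast
    then show ?thesis using cs[OF x0A, of c] \<open>counit A x0 = 1\<close> \<open>x0 = b []\<close> by simp
  qed
qed

section \<open>Homogeneous functionals\<close>

definition homogeneous :: "('k::field, 'v::ab_group_add, 'm) graded_coalg_scheme \<Rightarrow> ('v \<Rightarrow> 'k) \<Rightarrow> nat \<Rightarrow> bool" where
  "homogeneous A f n \<longleftrightarrow> linear_on A ground f \<and> (\<forall>m. \<forall>x\<in>grade A m. m \<noteq> n \<longrightarrow> f x = 0)"

lemma homogeneousD:
  assumes "homogeneous A f n"
  shows "linear_on A ground f" "x \<in> grade A m \<Longrightarrow> m \<noteq> n \<Longrightarrow> f x = 0"
  using assms by (auto simp: homogeneous_def)

context graded_coalgebra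
begin

lemma sum_components:
  assumes "x \<in> carrier A"
  shows "finite {n. component (grade A) n x \<noteq> 0}"
    and "(\<Sum>n\<in>{n. component (grade A) n x \<noteq> 0}. component (grade A) n x) = x"
  using component_decomposes[OF assms] by (auto simp: decomposes_def)

lemma component_carrier: "x \<in> carrier A \<Longrightarrow> component (grade A) n x \<in> carrier A"
  using component_mem grade_subset by blast

lemma homogeneous_component:
  assumes f: "homogeneous A f n" and x: "x \<in> carrier A"
  shows "f (component (grade A) m x) = (if m = n then f x else 0)"
proof (cases "m = n")
  case True
  let ?k = "\<lambda>n. component (grade A) n x"
  have l: "linear_on A ground f" using f by (simp add: homogeneous_def)
  have fin: "finite (insert n {n. ?k n \<noteq> 0})" using sum_components[OF x] by simp
  have "f x = f (\<Sum>n\<in>{n. ?k n \<noteq> 0}. ?k n)" using sum_components[OF x] by simp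
  also have "\<dots> = (\<Sum>n\<in>{n. ?k n \<noteq> 0}. f (?k n))"
    by (rule linear_on_sum[OF l is_vspace component_carrier[OF x]])
  also have "\<dots> = (\<Sum>m\<in>insert n {n. ?k n \<noteq> 0}. f (?k m))"
    using linear_on_zero[OF l is_vspace] by (intro sum.mono_neutral_left fin) auto
  also have "\<dots> = (\<Sum>m\<in>insert n {n. ?k n \<noteq> 0}. if m = n then f (?k n) else 0)"
    using f component_mem[OF x] by (intro sum.cong) (auto simp: homogeneous_def)
  also have "\<dots> = f (?k n)" using fin by simp
  finally show ?thesis using True by simp
qed (use f component_mem[OF x] in \<open>auto simp: homogeneous_def\<close>)

lemma homogeneous_counit: "homogeneous A (counit A) 0"
  using linear_counit counit_grade by (auto simp: homogeneous_def)

lemma homogeneous_convolution: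
  assumes f: "homogeneous A f p" and g: "homogeneous A g q"
  shows "homogeneous A (\<lambda>x. coprod A x (\<lambda>v w. f v * g w)) (p + q)"
proof -
  let ?F = "\<lambda>v w. f v * g w"
  have B: "bilinear_form A A ?F" using f g by (intro bilinear_form_mult) (auto simp: homogeneous_def)
  have z: "t ?F = 0" if "t \<in> tensor_span A A (grade A i) (grade A j)" "i + j \<noteq> p + q" for t i j
    using that(1) unfolding tensor_span_def
  proof (induction rule: span_fscale_induct)
    case (add c s t)
    then obtain v w where s: "s = tens A A v w" "v \<in> grade A i" "w \<in> grade A j" by auto
    have "i \<noteq> p \<or> j \<noteq> q" using that(2) by auto
    then have "f v * g w = 0" using f g s by (auto simp: homogeneous_def)
    then show ?case using add B by (simp add: s(1) tens_def)
  qed simp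
  have "coprod A x ?F = 0" if x: "x \<in> grade A m" "m \<noteq> p + q" for x m
    using coprod_grade[OF x(1)]
  proof (induction rule: span_fscale_induct)
    case (add c s t)
    then obtain i where "i \<le> m" "s \<in> tensor_span A A (grade A i) (grade A (m - i))" by auto
    then have "s ?F = 0" using z[of s i "m - i"] x(2) by simp
    then show ?case using add by simp
  qed simp
  moreover have "linear_on A ground (\<lambda>x. coprod A x ?F)"
    using linear_coprod by (simp add: linear_on_def)
  ultimately show ?thesis by (simp add: homogeneous_def)
qed

text \<open>
  The index of a basis vector records its degree, and its coordinate functional is that of a basis of
  the graded piece composed with the projection onto this piece. The sets \<open>X n\<close> can be prescribed in
  order that the basis contain a basis of a graded subspace.
\<close>

lemma homogeneous_basis_exists:
  assumes X: "\<And>n. X n \<subseteq> grade A n" "\<And>n. module.independent (scal A) (X n)"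
  shows "\<exists>H \<eta>. (\<forall>n. X n \<subseteq> H n) \<and> coord_basis A (Sigma UNIV H) snd \<eta> \<and>
    (\<forall>i\<in>Sigma UNIV H. homogeneous A (\<eta> i) (fst i))"
proof -
  interpret V: vector_space "scal A" by (rule is_vspace_scal[OF is_vspace])
  let ?G = "\<lambda>n. \<lparr>carrier = grade A n, scal = scal A\<rparr>"
  let ?k = "component (grade A)"
  have G: "is_vspace (?G n)" for n
    unfolding is_vspace_def by (simp add: V.vector_space_axioms subspace_grade)
  have "\<forall>n. \<exists>p. X n \<subseteq> fst p \<and> coord_basis (?G n) (fst p) (\<lambda>i. i) (snd p)"
    using coord_basis_exists[OF G] X by fastforce
  from choice[OF this] obtain p where
    p: "\<And>n. X n \<subseteq> fst (p n)" "\<And>n. coord_basis (?G n) (fst (p n)) (\<lambda>i. i) (snd (p n))" by blast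
  define H where "H n = fst (p n)" for n
  define \<eta> where "\<eta> i x = snd (p (fst i)) (snd i) (?k (fst i) x)" for i x
  have H: "coord_basis (?G n) (H n) (\<lambda>i. i) (snd (p n))" for n unfolding H_def by (rule p)
  have HG: "H n \<subseteq> grade A n" for n using coord_basis_mem[OF H] by auto
  have lk: "linear_on A (?G n) (?k n)" for n
    using linear_component[of n] component_mem by (auto simp: linear_on_def)
  have l: "linear_on A ground (\<eta> i)" if "i \<in> Sigma UNIV H" for i
    unfolding \<eta>_def[abs_def] using that by (intro linear_on_compose[OF _ lk] coord_basis_linear[OF H]) auto
  have z: "snd (p n) h 0 = 0" if "h \<in> H n" for n h
    by (rule linear_on_zero[OF coord_basis_linear[OF H that] G])
  have "coord_basis A (Sigma UNIV H) snd \<eta>"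
    unfolding coord_basis_def
  proof (intro conjI ballI impI is_vspace l)
    show "snd i \<in> carrier A" if "i \<in> Sigma UNIV H" for i using that HG grade_subset by fastforce
    show "\<eta> i (snd j) = (if i = j then 1 else 0)" if "i \<in> Sigma UNIV H" "j \<in> Sigma UNIV H" for i j
    proof -
      have "snd j \<in> grade A (fst j)" using that(2) subsetD[OF HG] by auto
      then show ?thesis
        using that coord_basis_dual[OF H, of "snd i" "fst i" "snd j"] z
        by (auto simp: \<eta>_def component_grade prod_eq_iff)
    qed
    fix x assume x: "x \<in> carrier A"
    have "{i \<in> Sigma UNIV H. \<eta> i x \<noteq> 0} \<subseteq> Sigma {n. ?k n x \<noteq> 0} (\<lambda>n. {h \<in> H n. snd (p n) h (?k n x) \<noteq> 0})"
      using z by (auto simp: \<eta>_def)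
    moreover have "finite (Sigma {n. ?k n x \<noteq> 0} (\<lambda>n. {h \<in> H n. snd (p n) h (?k n x) \<noteq> 0}))"
      using sum_components[OF x] component_mem[OF x] by (intro finite_SigmaI coord_basis_finite[OF H]) auto
    ultimately show "finite {i \<in> Sigma UNIV H. \<eta> i x \<noteq> 0}" by (rule finite_subset)
    assume *: "\<forall>i\<in>Sigma UNIV H. \<eta> i x = 0"
    have "?k n x = 0" for n
      using * component_mem[OF x, of n] by (intro coord_basis_zero[OF H]) (auto simp: \<eta>_def)
    then show "x = 0" using sum_components(2)[OF x] by simp
  qed
  moreover have "homogeneous A (\<eta> i) (fst i)" if i: "i \<in> Sigma UNIV H" for i
    unfolding homogeneous_def
  proof (intro conjI allI ballI impI l[OF i])
    fix m x assume "x \<in> grade A m" "m \<noteq> fst i"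
    then show "\<eta> i x = 0" using i z by (auto simp: \<eta>_def component_grade)
  qed
  moreover have "X n \<subseteq> H n" for n unfolding H_def by (rule p(1))
  ultimately show ?thesis by (intro exI[of _ H] exI[of _ \<eta>] conjI allI ballI)
qed

end

section \<open>Homogeneous deconcatenation bases\<close>

text \<open>
  In coordinates for a homogeneous basis, the coordinate \<open>(i, j)\<close> of either side of
  \<open>\<Delta> x = e \<otimes> x + x \<otimes> e\<close> is a homogeneous functional of \<open>x\<close>, of degree the sum of the degrees of \<open>i\<close>
  and \<open>j\<close>. The equation for \<open>x\<close> therefore implies that for its components.
\<close>

lemma component_primitive:
  assumes "graded_coalgebra A" and e: "e \<in> grade A 0" and x: "primitive A e x"
  shows "primitive A e (component (grade A) n x)"
proof -
  interpret graded_coalgebra A by (rule assms)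
  interpret V: vector_space "scal A" by (rule is_vspace_scal[OF is_vspace])
  let ?k = "component (grade A)"
  obtain H \<eta> where H: "coord_basis A (Sigma UNIV H) snd \<eta>"
    and \<eta>: "\<And>i. i \<in> Sigma UNIV H \<Longrightarrow> homogeneous A (\<eta> i) (fst i)"
    using homogeneous_basis_exists[of "\<lambda>_. {}"] V.independent_empty by auto
  have xA: "x \<in> carrier A" and dx: "coprod A x = tens A A e x + tens A A x e" using x by (auto simp: primitive_def)
  have eA: "e \<in> carrier A" using e grade_subset by blast
  have kA: "?k n x \<in> carrier A" by (rule component_carrier[OF xA])
  have "coprod A (?k n x) = tens A A e (?k n x) + tens A A (?k n x) e"
  proof (rule tensor_eq_coords[OF H H])
    show "coprod A (?k n x) \<in> carrier (tensor_prod A A)" by (rule linear_on_mem[OF linear_coprod kA])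
    show "tens A A e (?k n x) + tens A A (?k n x) e \<in> carrier (tensor_prod A A)"
      by (intro is_vspaceD(2)[OF is_vspace_tensor_prod] tens_mem eA kA)
    fix i j assume ij: "i \<in> Sigma UNIV H" "j \<in> Sigma UNIV H"
    note l = coord_basis_linear[OF H ij(1)] coord_basis_linear[OF H ij(2)]
    have c: "\<eta> i e = (if fst i = 0 then \<eta> i e else 0)" "\<eta> j e = (if fst j = 0 then \<eta> j e else 0)"
      using homogeneousD(2)[OF \<eta>[OF ij(1)] e] homogeneousD(2)[OF \<eta>[OF ij(2)] e] by auto
    have "tensor_coord \<eta> \<eta> (i, j) (coprod A (?k n x)) =
        (if n = fst i + fst j then tensor_coord \<eta> \<eta> (i, j) (coprod A x) else 0)"
      using homogeneous_component[OF homogeneous_convolution[OF \<eta>[OF ij(1)] \<eta>[OF ij(2)]] xA, of n]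
      by (simp add: tensor_coord_def)
    also have "\<dots> = (if n = fst i + fst j then \<eta> i e * \<eta> j x + \<eta> i x * \<eta> j e else 0)"
      by (simp add: dx tensor_coord_simps tensor_coord_tens l)
    also have "\<dots> = \<eta> i e * \<eta> j (?k n x) + \<eta> i (?k n x) * \<eta> j e"
      unfolding homogeneous_component[OF \<eta>[OF ij(1)] xA] homogeneous_component[OF \<eta>[OF ij(2)] xA]
      using c by (auto split: if_splits)
    also have "\<dots> = tensor_coord \<eta> \<eta> (i, j) (tens A A e (?k n x) + tens A A (?k n x) e)"
      by (simp add: tensor_coord_simps tensor_coord_tens l)
    finally show "tensor_coord \<eta> \<eta> (i, j) (coprod A (?k n x)) =
      tensor_coord \<eta> \<eta> (i, j) (tens A A e (?k n x) + tens A A (?k n x) e)" .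
  qed
  then show ?thesis using kA by (simp add: primitive_def)
qed

text \<open>
  The basis of the primitive elements is contained in one of the whole space, so that its coordinate
  functionals extend to homogeneous functionals. Degree \<open>0\<close> does not occur, since the counit vanishes
  on primitive elements but not on nonzero multiples of the unit.
\<close>

lemma homogeneous_basis_primitives:
  fixes A :: "('k::field, 'v::ab_group_add, 'm) graded_coalg_scheme"
  assumes gr: "connected_graded_coalgebra A" and B: "deconc_basis A I b \<xi>"
  shows "\<exists>(J :: (nat \<times> 'v) set) H \<eta>. J \<subseteq> H \<and> coord_basis A H snd \<eta> \<and>
    (\<forall>i\<in>H. homogeneous A (\<eta> i) (fst i)) \<and> (\<forall>i\<in>J. fst i > 0) \<and>
    coord_basis \<lparr>carrier = {x. primitive A (b []) x}, scal = scal A\<rparr> J snd \<eta>"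
proof -
  interpret connected_graded_coalgebra A by (rule gr)
  interpret V: vector_space "scal A" by (rule is_vspace_scal[OF is_vspace])
  note e = unit_elt_deconc(2)[OF gr B]
  let ?P = "{x. primitive A (b []) x}"
  have P: "V.subspace ?P" unfolding primitives_eq_span[OF B linear_coprod] by simp
  have "\<forall>n. \<exists>X. X \<subseteq> grade A n \<inter> ?P \<and> V.independent X \<and> grade A n \<inter> ?P \<subseteq> V.span X"
    using V.maximal_independent_subset by metis
  from choice[OF this] obtain X where X: "\<And>n. X n \<subseteq> grade A n \<inter> ?P"
      "\<And>n. V.independent (X n)" "\<And>n. grade A n \<inter> ?P \<subseteq> V.span (X n)" by blast
  have XG: "X n \<subseteq> grade A n" for n using X(1) by blast
  obtain H \<eta> where XH: "\<And>n. X n \<subseteq> H n" and H: "coord_basis A (Sigma UNIV H) snd \<eta>"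
    and \<eta>: "\<And>i. i \<in> Sigma UNIV H \<Longrightarrow> homogeneous A (\<eta> i) (fst i)"
    using homogeneous_basis_exists[OF XG X(2)] by blast
  let ?J = "Sigma UNIV X"
  have J: "?J \<subseteq> Sigma UNIV H" using XH by auto
  have "?P = V.span (snd ` ?J)"
  proof (intro equalityI)
    have "snd ` ?J \<subseteq> ?P" using X(1) by fastforce
    then show "V.span (snd ` ?J) \<subseteq> ?P" by (intro V.span_minimal P)
    show "?P \<subseteq> V.span (snd ` ?J)"
    proof
      fix x assume x: "x \<in> ?P"
      then have xA: "x \<in> carrier A" by (simp add: primitive_def)
      have "component (grade A) n x \<in> V.span (snd ` ?J)" for n
      proof -
        have "component (grade A) n x \<in> V.span (X n)"
          using X(3)[of n] component_mem[OF xA] component_primitive[OF graded_coalgebra_axioms e] x by blast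
        also have "\<dots> \<subseteq> V.span (snd ` ?J)" by (intro V.span_mono) force
        finally show ?thesis .
      qed
      then have "(\<Sum>n\<in>{n. component (grade A) n x \<noteq> 0}. component (grade A) n x) \<in> V.span (snd ` ?J)"
        by (intro V.span_sum)
      then show "x \<in> V.span (snd ` ?J)" by (simp only: sum_components(2)[OF xA])
    qed
  qed
  then have "coord_basis \<lparr>carrier = ?P, scal = scal A\<rparr> ?J snd \<eta>"
    by (intro coord_basis_subset[OF H J]) simp_all
  moreover have "fst i > 0" if i: "i \<in> ?J" for i
  proof (rule ccontr)
    assume "\<not> fst i > 0"
    then have h: "snd i \<in> X 0" using i by (auto simp: mem_Times_iff)
    then have p: "primitive A (b []) (snd i)" and g: "snd i \<in> grade A 0" using X(1) by auto
    have "\<xi> [] (snd i) = 0" using p primitive_iff_coords[OF B linear_coprod] by simp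
    then have "counit A (snd i) = 0"
      using deconc_counit_coord[OF B linear_counit] p by (simp add: primitive_def)
    then have "snd i = 0" using unit_elt_deconc(3)[OF gr B g] by simp
    then show False using h X(2)[of 0] V.dependent_zero by metis
  qed
  ultimately show ?thesis using J H \<eta> by blast
qed

fun convolution_word ::
    "('k::field, 'v, 'm) coalg_scheme \<Rightarrow> ('i \<Rightarrow> 'v \<Rightarrow> 'k) \<Rightarrow> 'i list \<Rightarrow> 'v \<Rightarrow> 'k" where
  "convolution_word A \<eta> [] = counit A"
| "convolution_word A \<eta> (j # w) = (\<lambda>x. coprod A x (\<lambda>u v. \<eta> j u * convolution_word A \<eta> w v))"

lemma homogeneous_convolution_word:
  assumes "graded_coalgebra A" "\<And>j. j \<in> set w \<Longrightarrow> homogeneous A (\<eta> j) (deg j)"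
  shows "homogeneous A (convolution_word A \<eta> w) (sum_list (map deg w))"
  using assms(2)
proof (induction w)
  case Nil
  then show ?case using graded_coalgebra.homogeneous_counit[OF assms(1)] by simp
next
  case (Cons j w)
  then show ?case using graded_coalgebra.homogeneous_convolution[OF assms(1), of "\<eta> j" "deg j"] by simp
qed

lemma deconc_coprod_form:
  assumes A: "deconc_basis A I b \<xi>" and f: "linear_on A ground f" "linear_on A ground g" and w: "w \<in> lists I"
  shows "coprod A (b w) (\<lambda>u v. f u * g v) = (\<Sum>(s, t)\<in>splits w. f (b s) * g (b t))"
  using bilinear_form_mult[OF f] by (simp add: deconc_coprod[OF A w] sum_fun_pointwise case_prod_beta tens_def)

context
  fixes A :: "('k::field, 'v::ab_group_add, 'm) coalg_scheme" and J :: "'i set" and b \<xi> \<eta>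
  assumes co: "coalgebra A" and B: "deconc_basis A J b \<xi>"
    and \<eta>: "\<And>j. j \<in> J \<Longrightarrow> linear_on A ground (\<eta> j)"
begin

private lemma lin: "linear_on A (tensor_prod A A) (coprod A)" "linear_on A ground (counit A)"
  using co by (auto simp: coalgebra_def)

lemma linear_convolution_word: "linear_on A ground (convolution_word A \<eta> w)"
proof (cases w)
  case (Cons j w')
  then show ?thesis using lin(1) by (simp add: linear_on_def)
qed (simp add: lin)

text \<open>
  Associativity of convolution, verified on a deconcatenation basis.
\<close>

lemma convolution_word_append:
  assumes u: "u \<in> lists J" and x: "x \<in> carrier A"
  shows "convolution_word A \<eta> (u @ v) x = coprod A x (\<lambda>s t. convolution_word A \<eta> u s * convolution_word A \<eta> v t)"
proof -
  let ?c = "convolution_word A \<eta>"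
  have l: "linear_on A ground (\<lambda>x. coprod A x F)" for F
    using lin(1) by (simp add: linear_on_def)
  note form = deconc_coprod_form[OF B _ linear_convolution_word]
  have b: "?c (u @ v) (b w) = coprod A (b w) (\<lambda>s t. ?c u s * ?c v t)" if "w \<in> lists J" for w
    using u that
  proof (induction u arbitrary: w rule: list.induct)
    case Nil
    have "coprod A (b w) (\<lambda>s t. ?c [] s * ?c v t) = (\<Sum>(s, t)\<in>splits w. counit A (b s) * ?c v (b t))"
      using form[OF lin(2) Nil(2)] by simp
    also have "\<dots> = (\<Sum>p\<in>splits w. if p = ([], w) then ?c v (b w) else 0)"
    proof (intro sum.cong refl)
      fix p assume p: "p \<in> splits w"
      then have "fst p \<in> lists J" using splits_lists[OF Nil(2), of "fst p" "snd p"] by simp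
      then show "(case p of (s, t) \<Rightarrow> counit A (b s) * ?c v (b t)) = (if p = ([], w) then ?c v (b w) else 0)"
        using p by (cases p) (auto simp: deconc_counit[OF B] splits_def)
    qed
    also have "\<dots> = ?c v (b w)" by (simp only: sum.delta[OF finite_splits]) (simp add: splits_def)
    finally show ?case by simp
  next
    case (Cons j u)
    have j: "j \<in> J" "u \<in> lists J" using Cons.prems by auto
    have "?c ((j # u) @ v) (b w) = (\<Sum>(s, t)\<in>splits w. \<eta> j (b s) * ?c (u @ v) (b t))"
      using form[OF \<eta>[OF j(1)] Cons.prems(2)] by simp
    also have "\<dots> = (\<Sum>(s, t)\<in>splits w. \<Sum>(p, q)\<in>splits t. \<eta> j (b s) * ?c u (b p) * ?c v (b q))"
    proof (intro sum.cong refl)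
      fix p assume "p \<in> splits w"
      then have t: "snd p \<in> lists J" using splits_lists[OF Cons.prems(2), of "fst p" "snd p"] by simp
      show "(case p of (s, t) \<Rightarrow> \<eta> j (b s) * ?c (u @ v) (b t)) =
        (case p of (s, t) \<Rightarrow> \<Sum>(p, q)\<in>splits t. \<eta> j (b s) * ?c u (b p) * ?c v (b q))"
        unfolding case_prod_beta Cons.IH[OF j(2) t] form[OF linear_convolution_word t]
        by (simp add: sum_distrib_left mult.assoc)
    qed
    also have "\<dots> = (\<Sum>(s, t)\<in>splits w. \<Sum>(p, q)\<in>splits s. \<eta> j (b p) * ?c u (b q) * ?c v (b t))"
      by (rule sum_splits_assoc[symmetric])
    also have "\<dots> = (\<Sum>(s, t)\<in>splits w. ?c (j # u) (b s) * ?c v (b t))"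
    proof (intro sum.cong refl)
      fix p assume "p \<in> splits w"
      then have s: "fst p \<in> lists J" using splits_lists[OF Cons.prems(2), of "fst p" "snd p"] by simp
      show "(case p of (s, t) \<Rightarrow> \<Sum>(p, q)\<in>splits s. \<eta> j (b p) * ?c u (b q) * ?c v (b t)) =
        (case p of (s, t) \<Rightarrow> ?c (j # u) (b s) * ?c v (b t))"
        unfolding case_prod_beta convolution_word.simps form[OF \<eta>[OF j(1)] s]
        by (simp add: sum_distrib_right)
    qed
    also have "\<dots> = coprod A (b w) (\<lambda>s t. ?c (j # u) s * ?c v t)"
      by (rule form[OF linear_convolution_word Cons.prems(2), symmetric])
    finally show ?case .
  qed
  show ?thesis
    by (rule linear_on_coord_basis_eq[OF deconc_coord_basis[OF B] linear_convolution_word l b x])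
qed

context
  assumes dual: "\<And>i j. i \<in> J \<Longrightarrow> j \<in> J \<Longrightarrow> \<eta> i (b [j]) = (if i = j then 1 else 0)"
    and \<eta>1: "\<And>j. j \<in> J \<Longrightarrow> \<eta> j (b []) = 0"
    and fin: "\<And>x. x \<in> carrier A \<Longrightarrow> finite {j\<in>J. \<eta> j x \<noteq> 0}"
begin

text \<open>
  The value of the convolution of \<open>n\<close> functionals at \<open>b w\<close> is a sum over the factorizations of \<open>w\<close>
  into \<open>n\<close> factors. Only nonempty factors contribute, as the functionals vanish at \<open>b []\<close>: there are
  none if \<open>w\<close> is shorter than \<open>n\<close>, and if \<open>w\<close> has length \<open>n\<close>, all factors are single letters.
\<close>

lemma convolution_word_triangular:
  assumes u: "u \<in> lists J" and w: "w \<in> lists J"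
  shows "length w < length u \<Longrightarrow> convolution_word A \<eta> u (b w) = 0"
    and "length w = length u \<Longrightarrow> convolution_word A \<eta> u (b w) = (if u = w then 1 else 0)"
proof -
  let ?c = "convolution_word A \<eta>"
  have "(length w < length u \<longrightarrow> ?c u (b w) = 0) \<and>
    (length w = length u \<longrightarrow> ?c u (b w) = (if u = w then 1 else 0))"
    using u w
  proof (induction u arbitrary: w rule: list.induct)
    case Nil
    then show ?case by (simp add: deconc_counit[OF B])
  next
    case (Cons j u)
    have j: "j \<in> J" "u \<in> lists J" using Cons.prems by auto
    have e: "?c (j # u) (b w) = (\<Sum>(s, t)\<in>splits w. \<eta> j (b s) * ?c u (b t))"
      using deconc_coprod_form[OF B \<eta>[OF j(1)] linear_convolution_word Cons.prems(2)] by simp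
    have "?c (j # u) (b w) = (\<Sum>p\<in>splits w. if p = ([hd w], tl w) then (if j # u = w then 1 else 0) else 0)"
      if le: "length w \<le> Suc (length u)"
      unfolding e
    proof (intro sum.cong refl)
      fix p assume "p \<in> splits w"
      moreover obtain s t where p: "p = (s, t)" by (cases p)
      ultimately have st: "s @ t = w" "s \<in> lists J" "t \<in> lists J"
        using splits_lists[OF Cons.prems(2), of s t] by (auto simp: splits_def)
      show "(case p of (s, t) \<Rightarrow> \<eta> j (b s) * ?c u (b t)) =
          (if p = ([hd w], tl w) then (if j # u = w then 1 else 0) else 0)"
      proof (cases s)
        case Nil
        then show ?thesis using \<eta>1[OF j(1)] by (simp add: p)
      next
        case (Cons i s')
        note IH = Cons.IH[OF j(2) st(3)]
        show ?thesis
        proof (cases s')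
          case Nil
          then have w: "w = i # t" "i \<in> J" using \<open>s = i # s'\<close> st by auto
          show ?thesis
          proof (cases "length t < length u")
            case True
            then show ?thesis using IH w by (auto simp: p)
          next
            case False
            then have "length t = length u" using le w by simp
            then show ?thesis using IH w \<open>s = i # s'\<close> Nil dual[OF j(1) w(2)] by (auto simp: p)
          qed
        next
          case (Cons i' s'')
          then have "length t < length u" using \<open>s = i # s'\<close> st(1) le by auto
          then show ?thesis using IH \<open>s = i # s'\<close> Cons by (simp add: p)
        qed
      qed
    qed
    then have *: "?c (j # u) (b w) = (if ([hd w], tl w) \<in> splits w then (if j # u = w then 1 else 0) else 0)"
      if "length w \<le> Suc (length u)" using that by (simp only: sum.delta[OF finite_splits])
    show ?case
    proof (intro conjI impI)
      assume "length w < length (j # u)"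
      then show "?c (j # u) (b w) = 0" using * by auto
    next
      assume "length w = length (j # u)"
      moreover from this have "([hd w], tl w) \<in> splits w" by (cases w) (auto simp: splits_def)
      ultimately show "?c (j # u) (b w) = (if j # u = w then 1 else 0)" using * by simp
    qed
  qed
  then show "length w < length u \<Longrightarrow> ?c u (b w) = 0"
    "length w = length u \<Longrightarrow> ?c u (b w) = (if u = w then 1 else 0)" by auto
qed

lemma convolution_word_finite:
  assumes x: "x \<in> carrier A"
  shows "finite {u\<in>lists J. convolution_word A \<eta> u x \<noteq> 0}"
proof -
  let ?c = "convolution_word A \<eta>"
  note X = deconc_coord_basis[OF B]
  have b: "finite {u\<in>lists J. ?c u (b w) \<noteq> 0}" if "w \<in> lists J" for w
    using that
  proof (induction w rule: measure_induct_rule[of length])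
    case (less w)
    \<comment> \<open>The factorization with empty left factor does not contribute, so the induction on length applies.\<close>
    let ?S = "\<lambda>p. (\<lambda>(j, u). j # u) ` ({j\<in>J. \<eta> j (b (fst p)) \<noteq> 0} \<times> {u\<in>lists J. ?c u (b (snd p)) \<noteq> 0})"
    have "{u\<in>lists J. ?c u (b w) \<noteq> 0} \<subseteq> insert [] (\<Union>p\<in>{p\<in>splits w. fst p \<noteq> []}. ?S p)"
    proof
      fix u assume u: "u \<in> {u\<in>lists J. ?c u (b w) \<noteq> 0}"
      show "u \<in> insert [] (\<Union>p\<in>{p\<in>splits w. fst p \<noteq> []}. ?S p)"
      proof (cases u)
        case (Cons j u')
        then have j: "j \<in> J" "u' \<in> lists J" using u by auto
        have "(\<Sum>(s, t)\<in>splits w. \<eta> j (b s) * ?c u' (b t)) \<noteq> 0"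
          using deconc_coprod_form[OF B \<eta>[OF j(1)] linear_convolution_word less.prems] u Cons by simp
        then obtain p where p: "p \<in> splits w" "\<eta> j (b (fst p)) * ?c u' (b (snd p)) \<noteq> 0"
          by (metis (no_types, lifting) case_prod_beta sum.neutral)
        then have "fst p \<noteq> []" using \<eta>1[OF j(1)] by auto
        moreover have "u \<in> ?S p" using p j Cons by auto
        ultimately show ?thesis using p(1) by blast
      qed simp
    qed
    moreover have "finite (?S p)" if p: "p \<in> splits w" "fst p \<noteq> []" for p
    proof -
      have m: "fst p \<in> lists J" "snd p \<in> lists J" using splits_lists[OF less.prems, of "fst p" "snd p"] p by simp_all
      have "length (snd p) < length w" using p by (auto simp: splits_def)
      then show ?thesis
        using less.IH m(2) fin[OF coord_basis_mem[OF X m(1)]] by (intro finite_imageI finite_cartesian_product) auto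
    qed
    ultimately show ?case by (auto intro: finite_subset)
  qed
  show ?thesis using x
  proof (induction rule: coord_basis_induct[OF X, consumes 1])
    case 1
    have "?c u 0 = 0" for u by (rule linear_on_zero[OF linear_convolution_word coord_basis_vspace[OF X]])
    then show ?case by simp
  next
    case (2 c w y)
    have m: "b w \<in> carrier A" "scal A c (b w) \<in> carrier A"
      using coord_basis_mem[OF X 2(1)] is_vspaceD(3)[OF coord_basis_vspace[OF X]] by auto
    have "{u\<in>lists J. ?c u (scal A c (b w) + y) \<noteq> 0} \<subseteq> {u\<in>lists J. ?c u (b w) \<noteq> 0} \<union> {u\<in>lists J. ?c u y \<noteq> 0}"
      using m 2 by (auto simp: linear_on_add[OF linear_convolution_word] linear_on_scal[OF linear_convolution_word])
    then show ?case using b[OF 2(1)] 2(3) by (auto intro: finite_subset)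
  qed
qed

text \<open>
  The basis dual to the convolution products is a deconcatenation basis, because its coordinate
  functionals multiply as words by construction.
\<close>

lemma deconc_basis_convolution_word: "\<exists>c. deconc_basis A J c (convolution_word A \<eta>)"
proof -
  let ?c = "convolution_word A \<eta>"
  note X = deconc_coord_basis[OF B]
  obtain c where c: "coord_basis A (lists J) c ?c"
    using coord_basis_unitriangular[OF X linear_convolution_word convolution_word_finite, of length]
      convolution_word_triangular by blast
  have "deconc_basis A J c ?c"
  proof (rule deconc_basisI[OF c])
    fix w assume w: "w \<in> lists J"
    note m = coord_basis_mem[OF c w]
    show "coprod A (c w) \<in> carrier (tensor_prod A A)" by (rule linear_on_mem[OF lin(1) m])
    show "counit A (c w) = (if w = [] then 1 else 0)"
      using coord_basis_dual[OF c _ w, of "[]"] by auto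
    show "tensor_coord ?c ?c (u, v) (coprod A (c w)) = (if w = u @ v then 1 else 0)"
      if "u \<in> lists J" "v \<in> lists J" for u v
      using convolution_word_append[OF that(1) m, of v] coord_basis_dual[OF c _ w, of "u @ v"] that
      by (auto simp: tensor_coord_def)
  qed
  then show ?thesis by blast
qed

end

end

text \<open>
  The dual basis is homogeneous: since the functionals are, a dual basis vector and its component in
  the degree of its index have the same coordinates.
\<close>

lemma homogeneous_deconc_basis:
  fixes A :: "('k::field, 'v::ab_group_add, 'm) graded_coalg_scheme"
  assumes gr: "connected_graded_coalgebra A" and cf: "cofree A"
  shows "\<exists>(J :: (nat \<times> 'v) set) b \<xi>. deconc_basis A J b \<xi> \<and> (\<forall>j\<in>J. fst j > 0) \<and>
    (\<forall>w\<in>lists J. b w \<in> grade A (sum_list (map fst w)) \<and> homogeneous A (\<xi> w) (sum_list (map fst w)))"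
proof -
  interpret connected_graded_coalgebra A by (rule gr)
  obtain I :: "'v set" and b0 \<xi>0 where B0: "deconc_basis A I b0 \<xi>0"
    using deconc_basis_of_cofree[OF cf] by blast
  obtain J :: "(nat \<times> 'v) set" and H \<eta> where J: "J \<subseteq> H" "coord_basis A H snd \<eta>"
      "\<And>i. i \<in> H \<Longrightarrow> homogeneous A (\<eta> i) (fst i)" "\<And>i. i \<in> J \<Longrightarrow> fst i > 0"
      "coord_basis \<lparr>carrier = {x. primitive A (b0 []) x}, scal = scal A\<rparr> J snd \<eta>"
    using homogeneous_basis_primitives[OF gr B0] by blast
  obtain b1 \<xi>1 where B1: "deconc_basis A J b1 \<xi>1" and b1: "\<And>j. j \<in> J \<Longrightarrow> b1 [j] = snd j"
    using deconc_basis_extending[OF B0 coalgebra_axioms J(5)] by blast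
  have l: "linear_on A ground (\<eta> j)" if "j \<in> J" for j using coord_basis_linear[OF J(2)] J(1) that by blast
  let ?\<xi> = "convolution_word A \<eta>"
  have "\<exists>c. deconc_basis A J c ?\<xi>"
  proof (rule deconc_basis_convolution_word[OF coalgebra_axioms B1 l])
    show "\<eta> i (b1 [j]) = (if i = j then 1 else 0)" if "i \<in> J" "j \<in> J" for i j
      using coord_basis_dual[OF J(2) subsetD[OF J(1) that(1)] subsetD[OF J(1) that(2)]] b1[OF that(2)] by simp
    show "\<eta> j (b1 []) = 0" if "j \<in> J" for j
      using homogeneousD(2)[OF J(3)[OF subsetD[OF J(1) that]] unit_elt_deconc(2)[OF gr B1]] J(4)[OF that] by simp
    show "finite {j \<in> J. \<eta> j x \<noteq> 0}" if "x \<in> carrier A" for x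
      using coord_basis_finite[OF J(2) that] J(1) by (auto elim: finite_subset[rotated])
  qed
  then obtain b where b: "deconc_basis A J b ?\<xi>" ..
  note X = deconc_coord_basis[OF b]
  have h: "homogeneous A (?\<xi> w) (sum_list (map fst w))" if "w \<in> lists J" for w
    using that J(1,3) by (intro homogeneous_convolution_word graded_coalgebra_axioms) auto
  have "b w \<in> grade A (sum_list (map fst w))" if w: "w \<in> lists J" for w
  proof -
    let ?n = "sum_list (map fst w)"
    note m = coord_basis_mem[OF X w]
    have "component (grade A) ?n (b w) = b w"
    proof (rule coord_basis_eq[OF X component_carrier[OF m] m])
      show "?\<xi> u (component (grade A) ?n (b w)) = ?\<xi> u (b w)" if u: "u \<in> lists J" for u
        using homogeneous_component[OF h[OF u] m, of ?n] coord_basis_dual[OF X u w] by auto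
    qed
    then show ?thesis using component_mem[OF m, of ?n] by simp
  qed
  with b h J(4) show ?thesis by blast
qed

section \<open>The alphabet of a composition\<close>

text \<open>
  A word \<open>k\<close> in the new alphabet encodes the pair of a word \<open>outer_word k\<close> and a nonempty list
  \<open>inner_words k\<close> of words, the indices of an element \<open>b\<^sub>D w \<circ> (b\<^sub>C u\<^sub>0 \<cdot> \<dots> \<cdot> b\<^sub>C u\<^sub>n)\<close>. Reading \<open>k\<close>
  from the left, a letter \<open>Inl i\<close> is appended to the inner word being spelt, and a letter
  \<open>Inr (j, us)\<close> closes this word, contributes \<open>j\<close> to the outer word and \<open>us\<close> to the list, and opens
  the next inner word.
\<close>

fun outer_word :: "('i + 'j \<times> 'i list list) list \<Rightarrow> 'j list" where
  "outer_word [] = []"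
| "outer_word (Inl i # k) = outer_word k"
| "outer_word (Inr (j, us) # k) = j # outer_word k"

fun inner_words :: "('i + 'j \<times> 'i list list) list \<Rightarrow> 'i list list" where
  "inner_words [] = [[]]"
| "inner_words (Inl i # k) = (i # hd (inner_words k)) # tl (inner_words k)"
| "inner_words (Inr (j, us) # k) = [] # us @ inner_words k"

text \<open>
  If \<open>d\<close> has degree \<open>m\<close>, then \<open>d \<circ> (c\<^sub>0 \<cdot> \<dots> \<cdot> c\<^sub>m)\<close> has \<open>m - 1\<close> factors strictly between the first and
  the last one. They are absorbed into the letter, whereas the outer two are shared with the
  neighbouring letters.
\<close>

definition comp_letters :: "('j \<Rightarrow> nat) \<Rightarrow> 'j set \<Rightarrow> 'i set \<Rightarrow> ('i + 'j \<times> 'i list list) set" where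
  "comp_letters deg J I = Inl ` I \<union> Inr ` {(j, us). j \<in> J \<and> us \<in> lists (lists I) \<and> length us = deg j - 1}"

definition comp_index :: "('j \<Rightarrow> nat) \<Rightarrow> 'j set \<Rightarrow> 'i set \<Rightarrow> ('j list \<times> 'i list list) set" where
  "comp_index deg J I = {(w, us). w \<in> lists J \<and> us \<in> lists (lists I) \<and> length us = Suc (sum_list (map deg w))}"

lemma inner_words_nonempty [simp]: "inner_words k \<noteq> []"
  by (induction k rule: inner_words.induct) auto

lemma outer_word_append: "outer_word (k @ l) = outer_word k @ outer_word l"
  by (induction k rule: outer_word.induct) auto

text \<open>
  Concatenation glues the last inner word of \<open>k\<close> to the first one of \<open>l\<close>. This glued word is the index
  of the factor \<open>c\<^sub>i\<close> that is split in the coproduct of the composition.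
\<close>

lemma inner_words_append: "inner_words (k @ l) = butlast (inner_words k) @ (last (inner_words k) @ hd (inner_words l)) # tl (inner_words l)"
proof (induction k rule: inner_words.induct)
  case (2 i k)
  obtain u us where "inner_words k = u # us" by (cases "inner_words k") auto
  with 2 show ?case by (cases us) auto
next
  case (3 j us k)
  then show ?case by (simp add: butlast_append)
qed simp

lemma outer_word_Inl: "outer_word (map Inl u @ k) = outer_word k"
  by (induction u) auto

lemma inner_words_Inl: "inner_words (map Inl u @ k) = (u @ hd (inner_words k)) # tl (inner_words k)"
  by (induction u) auto

lemma outer_word_empty: "outer_word k = [] \<Longrightarrow> \<exists>u. k = map Inl u \<and> inner_words k = [u]"
proof (induction k rule: outer_word.induct)
  case (2 i k)
  then obtain u where "k = map Inl u" "inner_words k = [u]" by auto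
  then have "Inl i # k = map Inl (i # u) \<and> inner_words (Inl i # k) = [i # u]" by auto
  then show ?case by (rule exI)
qed auto

lemma comp_index_words:
  assumes "\<And>j. j \<in> J \<Longrightarrow> deg j > 0" "k \<in> lists (comp_letters deg J I)"
  shows "(outer_word k, inner_words k) \<in> comp_index deg J I"
  using assms(2)
proof (induction k rule: list.induct)
  case (Cons a k)
  then have k: "outer_word k \<in> lists J" "inner_words k \<in> lists (lists I)" "length (inner_words k) = Suc (sum_list (map deg (outer_word k)))"
    and a: "a \<in> comp_letters deg J I" by (auto simp: comp_index_def)
  obtain u us where i: "inner_words k = u # us" by (cases "inner_words k") auto
  show ?case
  proof (cases a)
    case (Inl i')
    then have "i' \<in> I" using a by (auto simp: comp_letters_def)
    then show ?thesis using Inl k i by (auto simp: comp_index_def)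
  next
    case (Inr p)
    then obtain j vs where p: "a = Inr (j, vs)" "j \<in> J" "vs \<in> lists (lists I)" "length vs = deg j - 1"
      using a by (auto simp: comp_letters_def)
    then show ?thesis using k assms(1)[OF p(2)] by (auto simp: comp_index_def)
  qed
qed (simp add: comp_index_def)

lemma comp_words_inj:
  assumes "k \<in> lists (comp_letters deg J I)" "l \<in> lists (comp_letters deg J I)"
    and "outer_word k = outer_word l" "inner_words k = inner_words l"
  shows "k = l"
  using assms
proof (induction k arbitrary: l rule: list.induct)
  case Nil
  then show ?case by (cases l rule: outer_word.cases) auto
next
  case (Cons a k)
  obtain u us where i: "inner_words k = u # us" by (cases "inner_words k") auto
  show ?case
  proof (cases a)
    case (Inl x)
    then obtain l' where l: "l = Inl x # l'"
      using Cons.prems(3,4) by (cases l rule: outer_word.cases) auto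
    then have "hd (inner_words l') = hd (inner_words k)" "tl (inner_words l') = tl (inner_words k)" "outer_word l' = outer_word k"
      using Cons.prems(3,4) Inl by auto
    then have "inner_words k = inner_words l'" "outer_word k = outer_word l'" using list.expand[of "inner_words k" "inner_words l'"] by auto
    then have "k = l'" using Cons.IH[of l'] Cons.prems(1,2) l by auto
    then show ?thesis using l Inl by simp
  next
    case (Inr p)
    obtain j vs where p: "p = (j, vs)" by (cases p)
    then obtain vs' l' where l: "l = Inr (j, vs') # l'"
      using Cons.prems(3,4) Inr by (cases l rule: outer_word.cases) auto
    have "length vs = length vs'" using Cons.prems(1,2) l p Inr by (auto simp: comp_letters_def)
    then have "vs = vs'" "inner_words k = inner_words l'" "outer_word k = outer_word l'" using Cons.prems(3,4) l p Inr by auto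
    then have "k = l'" using Cons.IH[of l'] Cons.prems(1,2) l by auto
    then show ?thesis using l Inr p \<open>vs = vs'\<close> by simp
  qed
qed

lemma comp_words_surj:
  assumes "\<And>j. j \<in> J \<Longrightarrow> deg j > 0" "(w, us) \<in> comp_index deg J I"
  shows "\<exists>k\<in>lists (comp_letters deg J I). outer_word k = w \<and> inner_words k = us"
  using assms(2)
proof (induction w arbitrary: us rule: list.induct)
  case Nil
  then obtain u where u: "us = [u]" "u \<in> lists I" by (auto simp: comp_index_def length_Suc_conv)
  then have "map Inl u \<in> lists (comp_letters deg J I)" by (auto simp: comp_letters_def)
  moreover have "outer_word (map Inl u) = ([] :: 'a list)" "inner_words (map Inl u :: ('b + 'a \<times> 'b list list) list) = us"
    using outer_word_Inl[of u "[]"] inner_words_Inl[of u "[]"] u by simp_all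
  ultimately show ?case by blast
next
  case (Cons j w)
  then have j: "j \<in> J" "w \<in> lists J" and us: "us \<in> lists (lists I)"
    and len: "length us = Suc (deg j + sum_list (map deg w))" by (auto simp: comp_index_def)
  obtain u vs where u: "us = u # vs" using len by (cases us) auto
  let ?n = "deg j - 1"
  have v: "take ?n vs \<in> lists (lists I)" "drop ?n vs \<in> lists (lists I)" "u \<in> lists I"
    using us u set_take_subset[of ?n vs] set_drop_subset[of ?n vs] by (auto simp: in_lists_conv_set subset_iff)
  have "(w, drop ?n vs) \<in> comp_index deg J I"
    using v j len u assms(1)[OF j(1)] by (auto simp: comp_index_def)
  then obtain k where k: "k \<in> lists (comp_letters deg J I)" "outer_word k = w" "inner_words k = drop ?n vs"
    using Cons.IH by blast
  let ?k = "map Inl u @ Inr (j, take ?n vs) # k"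
  have "length (take ?n vs) = ?n" using len u by simp
  then have "Inr (j, take ?n vs) \<in> comp_letters deg J I" using v j by (auto simp: comp_letters_def)
  moreover have "set (map Inl u) \<subseteq> comp_letters deg J I" using v(3) by (auto simp: comp_letters_def)
  ultimately have "?k \<in> lists (comp_letters deg J I)" using k(1) by auto
  moreover have "outer_word ?k = j # w" "inner_words ?k = us" using k u by (simp_all add: outer_word_Inl inner_words_Inl)
  ultimately show ?case by blast
qed

lemma bij_betw_comp_words:
  assumes "\<And>j. j \<in> J \<Longrightarrow> deg j > 0"
  shows "bij_betw (\<lambda>k. (outer_word k, inner_words k)) (lists (comp_letters deg J I)) (comp_index deg J I)"
  unfolding bij_betw_def
proof (intro conjI inj_onI equalityI subsetI)
  fix k l assume "k \<in> lists (comp_letters deg J I)" "l \<in> lists (comp_letters deg J I)"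
    "(outer_word k, inner_words k) = (outer_word l, inner_words l)"
  then show "k = l" by (intro comp_words_inj) auto
next
  fix p assume "p \<in> (\<lambda>k. (outer_word k, inner_words k)) ` lists (comp_letters deg J I)"
  then show "p \<in> comp_index deg J I" by (elim imageE) (simp only: comp_index_words[OF assms])
next
  fix p assume "p \<in> comp_index deg J I"
  then have "(fst p, snd p) \<in> comp_index deg J I" by simp
  from comp_words_surj[OF assms this] show "p \<in> (\<lambda>k. (outer_word k, inner_words k)) ` lists (comp_letters deg J I)"
    by (auto intro: rev_image_eqI)
qed

section \<open>A deconcatenation basis of the composition\<close>

lemma composition_simps [simp]:
  "carrier (composition D C) = carrier (comp_space D C)" "scal (composition D C) = fscale"
  by (simp_all add: composition_def comp_space_def)

lemma tens_composition: "tens (composition D C) (composition D C) = tens (comp_space D C) (comp_space D C)"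
  by (rule tens_cong_space) (simp_all add: comp_space_def)

lemma circ_mem:
  assumes "d \<in> grade D n" "set cs \<subseteq> carrier C" "length cs = Suc n"
  shows "circ D C d cs \<in> carrier (comp_space D C)"
proof -
  have "word C cs \<in> tensor_power C (Suc n)"
    unfolding tensor_power_def using assms by (intro span_fscale_base) blast
  then have "circ D C d cs \<in> tensor_span D (tensor_alg C) (grade D n) (tensor_power C (Suc n))"
    unfolding circ_def tensor_span_def using assms(1) by (intro span_fscale_base) blast
  then have "circ D C d cs \<in> (\<Union>n. tensor_span D (tensor_alg C) (grade D n) (tensor_power C (Suc n)))" by blast
  then show ?thesis unfolding comp_space_def by (simp only: vspace.simps) (rule span_fscale_base)
qed

lemma bilinear_form_tens:
  assumes "linear_on V P f" "linear_on W Q g"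
  shows "bilinear_form V W (\<lambda>v w. tens P Q (f v) (g w) x)"
  using tens_bilinear_form[of P Q x] assms by (auto simp: bilinear_form_def linear_on_def)

lemma bilinear_form_cong:
  assumes "is_vspace V" "is_vspace W" "bilinear_form V W B"
    and "\<And>v w. v \<in> carrier V \<Longrightarrow> w \<in> carrier W \<Longrightarrow> B v w = B' v w"
  shows "bilinear_form V W B'"
  unfolding bilinear_form_def
proof (intro conjI ballI)
  show "linear_on V ground (\<lambda>v. B' v w)" if "w \<in> carrier W" for w
    by (rule linear_on_ground_cong[OF assms(1), of "\<lambda>v. B v w"])
      (use assms(3,4) that in \<open>auto simp: bilinear_form_def\<close>)
  show "linear_on W ground (\<lambda>w. B' v w)" if "v \<in> carrier V" for v
    by (rule linear_on_ground_cong[OF assms(2), of "B v"])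
      (use assms(3,4) that in \<open>auto simp: bilinear_form_def\<close>)
qed

lemma linear_circ_inner:
  assumes "graded_coalgebra D" "d \<in> grade D (length xs + length ys)" "set xs \<subseteq> carrier C" "set ys \<subseteq> carrier C"
  shows "linear_on C (comp_space D C) (\<lambda>c. circ D C d (xs @ c # ys))"
proof (rule linear_on_funI)
  interpret D: graded_coalgebra D by (rule assms(1))
  show "scal (comp_space D C) = fscale" by (simp add: comp_space_def)
  show "circ D C d (xs @ c # ys) \<in> carrier (comp_space D C)" if "c \<in> carrier C" for c
    using assms that by (intro circ_mem) auto
  have d: "d \<in> carrier D" using assms(2) D.grade_subset by blast
  show "linear_on C ground (\<lambda>c. circ D C d (xs @ c # ys) z)" for z
    unfolding circ_def
    using tens_bilinear_form[of D "tensor_alg C" z] d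
    by (intro linear_on_compose[OF _ word_multilinear[OF assms(3,4)]]) (auto simp: bilinear_form_def)
qed

lemma linear_circ_outer:
  assumes "graded_coalgebra D" "set cs \<subseteq> carrier C" "length cs = Suc n"
  shows "linear_on D (comp_space D C) (\<lambda>d. circ D C (component (grade D) n d) cs)"
proof (rule linear_on_funI)
  interpret D: graded_coalgebra D by (rule assms(1))
  show "scal (comp_space D C) = fscale" by (simp add: comp_space_def)
  show "circ D C (component (grade D) n d) cs \<in> carrier (comp_space D C)" if "d \<in> carrier D" for d
    using assms D.component_mem[OF that] by (intro circ_mem) auto
  show "linear_on D ground (\<lambda>d. circ D C (component (grade D) n d) cs z)" for z
    unfolding circ_def
    using tens_bilinear_form[of D "tensor_alg C" z] word_mem[OF assms(2)]
    by (intro linear_on_compose[OF _ D.linear_component]) (auto simp: bilinear_form_def)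
qed

text \<open>
  Once the coproducts of \<open>d\<close> and of the factors are written as explicit sums of tensors, the formula for
  the coproduct of the composition is an explicit sum. The work is to see that the maps under \<open>lift\<close>
  are bilinear.
\<close>

lemma circ_coprod_sum:
  assumes gD: "graded_coalgebra D" and gC: "graded_coalgebra C"
    and d: "coprod D d = (\<Sum>p\<in>S. tens D D (d1 p) (d2 p))" "\<And>p. p \<in> S \<Longrightarrow> d1 p \<in> carrier D \<and> d2 p \<in> carrier D"
    and cs: "set cs \<subseteq> carrier C"
    and c: "\<And>i. i < length cs \<Longrightarrow> coprod C (cs ! i) = (\<Sum>q\<in>T i. tens C C (c1 i q) (c2 i q))"
      "\<And>i q. i < length cs \<Longrightarrow> q \<in> T i \<Longrightarrow> c1 i q \<in> carrier C \<and> c2 i q \<in> carrier C"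
  shows "circ_coprod D C d cs = (\<Sum>i<length cs. \<Sum>p\<in>S. \<Sum>q\<in>T i. tens (comp_space D C) (comp_space D C)
    (circ D C (component (grade D) i (d1 p)) (take i cs @ [c1 i q]))
    (circ D C (component (grade D) (length cs - 1 - i) (d2 p)) (c2 i q # drop (Suc i) cs)))"
  unfolding circ_coprod_def
proof (intro sum.cong refl)
  interpret D: graded_coalgebra D by (rule gD)
  fix i assume "i \<in> {..<length cs}"
  then have i: "i < length cs" by simp
  let ?P = "comp_space D C"
  let ?k = "component (grade D)"
  let ?f = "\<lambda>d' c'. circ D C (?k i d') (take i cs @ [c'])"
  let ?g = "\<lambda>d'' c''. circ D C (?k (length cs - 1 - i) d'') (c'' # drop (Suc i) cs)"
  have xs: "set (take i cs) \<subseteq> carrier C" "set (drop (Suc i) cs) \<subseteq> carrier C"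
    using cs set_take_subset[of i cs] set_drop_subset[of "Suc i" cs] by blast+
  have inner_sum: "lift (\<lambda>c' c''. tens ?P ?P (?f d' c') (?g d'' c'')) (coprod C (cs ! i)) =
      (\<Sum>q\<in>T i. tens ?P ?P (?f d' (c1 i q)) (?g d'' (c2 i q)))"
    if d': "d' \<in> carrier D" "d'' \<in> carrier D" for d' d''
  proof -
    have "linear_on C ?P (\<lambda>c'. ?f d' c')"
      using linear_circ_inner[OF gD, of "?k i d'" "take i cs" "[]" C] D.component_mem[OF d'(1)] xs i by simp
    moreover have "linear_on C ?P (\<lambda>c''. ?g d'' c'')"
      using linear_circ_inner[OF gD, of "?k (length cs - 1 - i) d''" "[]" "drop (Suc i) cs" C]
        D.component_mem[OF d'(2), of "length cs - 1 - i"] xs i by simp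
    ultimately have "bilinear_form C C (\<lambda>c' c''. tens ?P ?P (?f d' c') (?g d'' c'') x)" for x
      by (rule bilinear_form_tens)
    then show ?thesis by (simp only: c(1)[OF i] lift_sum lift_tens)
  qed
  have B: "bilinear_form D D (\<lambda>d' d''. lift (\<lambda>c' c''. tens ?P ?P (?f d' c') (?g d'' c'')) (coprod C (cs ! i)) x)" for x
  proof -
    have "bilinear_form D D (\<lambda>d' d''. tens ?P ?P (?f d' (c1 i q)) (?g d'' (c2 i q)) x)" if "q \<in> T i" for q
      using xs i c(2)[OF i that] by (intro bilinear_form_tens linear_circ_outer gD) auto
    then have "bilinear_form D D (\<lambda>d' d''. \<Sum>q\<in>T i. tens ?P ?P (?f d' (c1 i q)) (?g d'' (c2 i q)) x)"
      unfolding bilinear_form_def by (intro conjI ballI linear_on_ground_sum) auto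
    then show ?thesis
      by (rule bilinear_form_cong[OF D.is_vspace D.is_vspace]) (simp only: inner_sum sum_fun_pointwise)
  qed
  have "lift (\<lambda>d' d''. lift (\<lambda>c' c''. tens ?P ?P (?f d' c') (?g d'' c'')) (coprod C (cs ! i))) (coprod D d) =
      (\<Sum>p\<in>S. lift (\<lambda>c' c''. tens ?P ?P (?f (d1 p) c') (?g (d2 p) c'')) (coprod C (cs ! i)))"
    by (simp only: d(1) lift_sum lift_tens[OF B])
  also have "\<dots> = (\<Sum>p\<in>S. \<Sum>q\<in>T i. tens ?P ?P (?f (d1 p) (c1 i q)) (?g (d2 p) (c2 i q)))"
    using d(2) by (intro sum.cong refl inner_sum) auto
  finally show "lift (\<lambda>d' d''. lift (\<lambda>c' c''. tens ?P ?P (?f d' c') (?g d'' c'')) (coprod C (cs ! i))) (coprod D d) =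
      (\<Sum>p\<in>S. \<Sum>q\<in>T i. tens ?P ?P (?f (d1 p) (c1 i q)) (?g (d2 p) (c2 i q)))" .
qed

context
  fixes D :: "('k::field, 'd::ab_group_add) graded_coalg" and C :: "('k, 'c::ab_group_add) graded_coalg"
    and J :: "'j set" and deg :: "'j \<Rightarrow> nat" and bD \<xi>
    and I :: "'i set" and bC \<zeta>
  assumes gD: "graded_coalgebra D" and gC: "graded_coalgebra C"
    and BD: "deconc_basis D J bD \<xi>" and BC: "deconc_basis C I bC \<zeta>"
    and deg: "\<And>j. j \<in> J \<Longrightarrow> deg j > 0"
    and bD: "\<And>w. w \<in> lists J \<Longrightarrow> bD w \<in> grade D (sum_list (map deg w))"
    and \<xi>: "\<And>w. w \<in> lists J \<Longrightarrow> homogeneous D (\<xi> w) (sum_list (map deg w))"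
begin

interpretation D: graded_coalgebra D by (rule gD)
interpretation C: graded_coalgebra C by (rule gC)

definition "comp_basis k = circ D C (bD (outer_word k)) (map bC (inner_words k))"
definition "comp_coord k = tensor_coord \<xi> (word_coord \<zeta>) (outer_word k, inner_words k)"

abbreviation "letters \<equiv> comp_letters deg J I"

private lemma words:
  assumes "k \<in> lists letters"
  shows "outer_word k \<in> lists J" "inner_words k \<in> lists (lists I)" "length (inner_words k) = Suc (sum_list (map deg (outer_word k)))"
  using comp_index_words[OF deg assms] by (auto simp: comp_index_def)

private lemma XD: "coord_basis D (lists J) bD \<xi>" and XC: "coord_basis C (lists I) bC \<zeta>"
  using deconc_coord_basis[OF BD] deconc_coord_basis[OF BC] .

private lemma bC_mem: "us \<in> lists (lists I) \<Longrightarrow> set (map bC us) \<subseteq> carrier C"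
  using coord_basis_mem[OF XC] by auto

lemma comp_coord_circ: "k \<in> lists letters \<Longrightarrow> comp_coord k (circ D C d cs) = \<xi> (outer_word k) d * list_coord \<zeta> (inner_words k) cs"
  unfolding comp_coord_def circ_def
  using words[of k] coord_basis_linear[OF XC]
  by (subst tensor_coord_tens[OF coord_basis_linear[OF XD] linear_word_coord])
    (auto simp: word_coord_word in_lists_conv_set)

text \<open>
  The space \<open>D \<circ> C\<close> is spanned by a part of a basis of \<open>D \<otimes> tensor_alg C\<close>, because the \<open>b\<^sub>D w\<close> of degree
  \<open>n\<close> span \<open>D\<^sub>n\<close>. The index set of this part is encoded by the words in the new alphabet.
\<close>

lemma coord_basis_composition: "coord_basis (composition D C) (lists letters) comp_basis comp_coord"
proof -
  interpret F: vector_space "fscale :: 'k \<Rightarrow> ('k, 'd, ('k, 'c) words) tensor \<Rightarrow> _" by (rule vector_space_fscale)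
  let ?T = "tensor_alg C" and ?N = "comp_index deg J I"
  let ?b = "\<lambda>(w, us). tens D ?T (bD w) (word C (map bC us))"
  note X = coord_basis_tensor_prod[OF XD coord_basis_tensor_alg[OF XC]]
  have sub: "?N \<subseteq> lists J \<times> lists (lists I)" by (auto simp: comp_index_def)
  have "carrier (composition D C) = F.span (?b ` ?N)"
  proof (intro equalityI)
    show "F.span (?b ` ?N) \<subseteq> carrier (composition D C)"
    proof (intro F.span_minimal)
      show "F.subspace (carrier (composition D C))" by (simp add: comp_space_def)
      show "?b ` ?N \<subseteq> carrier (composition D C)"
      proof
        fix x assume "x \<in> ?b ` ?N"
        then obtain w us where "x = circ D C (bD w) (map bC us)" "w \<in> lists J" "us \<in> lists (lists I)"
            "length us = Suc (sum_list (map deg w))" by (auto simp: comp_index_def circ_def)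
        then show "x \<in> carrier (composition D C)" using bD bC_mem
          by (simp only: composition_simps length_map) (rule circ_mem, auto)
      qed
    qed
    have g: "grade D n \<subseteq> module.span (scal D) (bD ` {w \<in> lists J. sum_list (map deg w) = n})" for n
      using homogeneousD(2)[OF \<xi>] D.grade_subset
      by (subst span_subset_iff_coords[OF XD]) blast+
    have "tens D ?T v t \<in> F.span (?b ` ?N)" if v: "v \<in> grade D n" and t: "t \<in> tensor_power C (Suc n)" for n v t
    proof -
      let ?X = "bD ` {w \<in> lists J. sum_list (map deg w) = n}"
      let ?Y = "(\<lambda>us. word C (map bC us)) ` {us \<in> lists (lists I). length us = Suc n}"
      have "tens D ?T v t \<in> F.span {tens D ?T x y | x y. x \<in> ?X \<and> y \<in> ?Y}"
      proof (rule tens_span_mem[OF D.is_vspace is_vspace_tensor_alg])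
        show "?X \<subseteq> carrier D" using coord_basis_mem[OF XD] by blast
        show "?Y \<subseteq> carrier ?T" using bC_mem word_mem by blast
        show "v \<in> module.span (scal D) ?X" using g v by blast
        show "t \<in> module.span (scal ?T) ?Y" using t by (simp add: tensor_power_eq_span[OF XC])
      qed
      also have "\<dots> \<subseteq> F.span (?b ` ?N)"
      proof (intro F.span_mono subsetI)
        fix z assume "z \<in> {tens D ?T x y | x y. x \<in> ?X \<and> y \<in> ?Y}"
        then obtain w us where "z = ?b (w, us)" "w \<in> lists J" "sum_list (map deg w) = n"
          "us \<in> lists (lists I)" "length us = Suc n" by auto
        moreover from this have "(w, us) \<in> ?N" by (simp only: comp_index_def mem_Collect_eq case_prod_conv simp_thms)
        ultimately show "z \<in> ?b ` ?N" by blast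
      qed
      finally show ?thesis .
    qed
    then show "carrier (composition D C) \<subseteq> F.span (?b ` ?N)"
      unfolding composition_simps comp_space_def tensor_span_def vspace.simps
      by (intro F.span_minimal F.subspace_span UN_least) blast
  qed
  then have "coord_basis (composition D C) ?N ?b (tensor_coord \<xi> (word_coord \<zeta>))"
    by (intro coord_basis_subset[OF X sub]) (simp_all only: composition_simps tensor_prod_simps)
  from coord_basis_reindex[OF this bij_betw_comp_words[OF deg]]
  show ?thesis unfolding comp_basis_def[abs_def] comp_coord_def[abs_def] circ_def by simp
qed

lemma coprod_comp_basis:
  assumes k: "k \<in> lists letters"
  shows "coprod (composition D C) (comp_basis k) =
    (\<Sum>i<length (inner_words k). \<Sum>p\<in>splits (outer_word k). \<Sum>q\<in>splits (inner_words k ! i).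
      tens (composition D C) (composition D C)
        (circ D C (component (grade D) i (bD (fst p))) (take i (map bC (inner_words k)) @ [bC (fst q)]))
        (circ D C (component (grade D) (length (inner_words k) - 1 - i) (bD (snd p)))
          (bC (snd q) # drop (Suc i) (map bC (inner_words k)))))"
proof -
  note w = words[OF k]
  have i: "inner_words k ! i \<in> lists I" if "i < length (inner_words k)" for i
    using nth_mem[OF that] w(2) by (auto simp: in_lists_conv_set)
  have "coprod (composition D C) (comp_basis k) = circ_coprod D C (bD (outer_word k)) (map bC (inner_words k))"
    unfolding comp_basis_def by (rule composition_coprod[OF gC gD coord_basis_mem[OF XD w(1)] bC_mem[OF w(2)]])
  also have "\<dots> = (\<Sum>i<length (map bC (inner_words k)). \<Sum>p\<in>splits (outer_word k). \<Sum>q\<in>splits (inner_words k ! i).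
      tens (comp_space D C) (comp_space D C)
        (circ D C (component (grade D) i (bD (fst p))) (take i (map bC (inner_words k)) @ [bC (fst q)]))
        (circ D C (component (grade D) (length (map bC (inner_words k)) - 1 - i) (bD (snd p)))
          (bC (snd q) # drop (Suc i) (map bC (inner_words k)))))"
  proof (rule circ_coprod_sum[OF gD gC _ _ bC_mem[OF w(2)]])
    show "coprod D (bD (outer_word k)) = (\<Sum>p\<in>splits (outer_word k). tens D D (bD (fst p)) (bD (snd p)))"
      using deconc_coprod[OF BD w(1)] by (simp add: case_prod_beta)
    show "bD (fst p) \<in> carrier D \<and> bD (snd p) \<in> carrier D" if "p \<in> splits (outer_word k)" for p
      using splits_lists[OF w(1), of "fst p" "snd p"] that coord_basis_mem[OF XD] by simp
    fix i assume "i < length (map bC (inner_words k))"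
    then have il: "i < length (inner_words k)" by simp
    show "coprod C (map bC (inner_words k) ! i) = (\<Sum>q\<in>splits (inner_words k ! i). tens C C (bC (fst q)) (bC (snd q)))"
      using deconc_coprod[OF BC i[OF il]] il by (simp add: case_prod_beta)
    show "bC (fst q) \<in> carrier C \<and> bC (snd q) \<in> carrier C" if "q \<in> splits (inner_words k ! i)" for q
      using splits_lists[OF i[OF il], of "fst q" "snd q"] that coord_basis_mem[OF XC] by simp
  qed
  finally show ?thesis by (simp add: tens_composition)
qed

lemma coprod_comp_basis_mem:
  assumes k: "k \<in> lists letters"
  shows "coprod (composition D C) (comp_basis k) \<in> carrier (tensor_prod (composition D C) (composition D C))"
  unfolding coprod_comp_basis[OF k]
proof (intro is_vspace_sum is_vspace_tensor_prod tens_mem)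
  note w = words[OF k]
  fix i p q assume "i \<in> {..<length (inner_words k)}" and p: "p \<in> splits (outer_word k)" and q: "q \<in> splits (inner_words k ! i)"
  then have i: "i < length (inner_words k)" by simp
  have il: "inner_words k ! i \<in> lists I" using nth_mem[OF i] w(2) by (auto simp: in_lists_conv_set)
  have pm: "bD (fst p) \<in> carrier D" "bD (snd p) \<in> carrier D"
    using splits_lists[OF w(1), of "fst p" "snd p"] p coord_basis_mem[OF XD] by simp_all
  have qm: "bC (fst q) \<in> carrier C" "bC (snd q) \<in> carrier C"
    using splits_lists[OF il, of "fst q" "snd q"] q coord_basis_mem[OF XC] by simp_all
  have s: "set (take i (map bC (inner_words k))) \<subseteq> carrier C" "set (drop (Suc i) (map bC (inner_words k))) \<subseteq> carrier C"
    using bC_mem[OF w(2)] set_take_subset[of i "map bC (inner_words k)"] set_drop_subset[of "Suc i" "map bC (inner_words k)"]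
    by blast+
  show "circ D C (component (grade D) i (bD (fst p))) (take i (map bC (inner_words k)) @ [bC (fst q)]) \<in> carrier (composition D C)"
    unfolding composition_simps using s qm i by (intro circ_mem[OF D.component_mem[OF pm(1)]]) auto
  show "circ D C (component (grade D) (length (inner_words k) - 1 - i) (bD (snd p)))
      (bC (snd q) # drop (Suc i) (map bC (inner_words k))) \<in> carrier (composition D C)"
    unfolding composition_simps using s qm i by (intro circ_mem[OF D.component_mem[OF pm(2)]]) auto
qed

text \<open>
  The coordinate at \<open>k\<close> vanishes on elements with a number of inner factors other than the length of
  \<open>inner_words k\<close>. In the sum over \<open>i\<close> this leaves one term, in which the coordinate is a product of
  Kronecker symbols for the outer words, for the split inner word, and for the inner words on its
  left and on its right.
\<close>

lemma coprod_comp_basis_coords: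
  assumes m: "m \<in> lists letters" and k: "k \<in> lists letters" and l: "l \<in> lists letters"
  shows "tensor_coord comp_coord comp_coord (k, l) (coprod (composition D C) (comp_basis m)) = (if m = k @ l then 1 else 0)"
proof -
  note wm = words[OF m] and wk = words[OF k] and wl = words[OF l]
  note X = coord_basis_composition
  note dC = coord_basis_dual[OF XC] and dD = coord_basis_dual[OF XD]
  \<comment> \<open>The word that is cut is \<open>a @ b\<close>; \<open>xs\<close> and \<open>ys\<close> are the inner words to the left and right of it.\<close>
  define xs a where "xs = butlast (inner_words k)" and "a = last (inner_words k)"
  define b ys where "b = hd (inner_words l)" and "ys = tl (inner_words l)"
  have ik: "inner_words k = xs @ [a]" and il: "inner_words l = b # ys" by (simp_all add: xs_def a_def b_def ys_def)
  let ?w = "outer_word m" and ?us = "inner_words m" and ?w1 = "outer_word k" and ?w2 = "outer_word l"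
  have xa: "xs \<in> lists (lists I)" "a \<in> lists I" using wk(2) unfolding ik by auto
  have by': "ys \<in> lists (lists I)" "b \<in> lists I" using wl(2) unfolding il by auto
  have lx: "length xs = sum_list (map deg ?w1)" using wk(3) unfolding ik by simp
  have ly: "length ys = sum_list (map deg ?w2)" using wl(3) unfolding il by simp
  have lc: "list_coord \<zeta> us (map bC vs) = (if us = vs then 1 else 0)" if "us \<in> lists (lists I)" "vs \<in> lists (lists I)" for us vs
    using that by (intro list_coord_map[of "lists I"] dC) auto
  let ?cond = "\<lambda>i. i = length xs \<and> take i ?us = xs \<and> drop (Suc i) ?us = ys"
  let ?k = "component (grade D)" and ?cs = "map bC (inner_words m)"
  have summand: "comp_coord k (circ D C (?k i (bD p)) (take i ?cs @ [bC s])) *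
      comp_coord l (circ D C (?k (length ?us - 1 - i) (bD q)) (bC t # drop (Suc i) ?cs)) =
      (if ?cond i then ((if ?w1 = p then 1 else 0) * (if ?w2 = q then 1 else 0)) *
        ((if a = s then 1 else 0) * (if b = t then 1 else 0)) else 0)"
    if i: "i < length ?us" and pq: "p \<in> lists J" "q \<in> lists J" and st: "s \<in> lists I" "t \<in> lists I" for i p q s t
  proof -
    have tk: "take i ?us \<in> lists (lists I)" "drop (Suc i) ?us \<in> lists (lists I)"
      using wm(2) set_take_subset[of i ?us] set_drop_subset[of "Suc i" ?us] by (auto simp: in_lists_conv_set subset_iff)
    have bp: "bD p \<in> carrier D" "bD q \<in> carrier D" using coord_basis_mem[OF XD] pq by auto
    have l1: "list_coord \<zeta> (xs @ [a]) (take i ?cs @ [bC s]) =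
        (if i = length xs \<and> take i ?us = xs then (if a = s then 1 else 0) else 0)"
    proof (cases "i = length xs")
      case True
      then have "list_coord \<zeta> (xs @ [a]) (take i ?cs @ [bC s]) = list_coord \<zeta> xs (map bC (take i ?us)) * list_coord \<zeta> [a] [bC s]"
        using i by (subst list_coord_append) (simp_all add: take_map)
      then show ?thesis using lc[OF xa(1) tk(1)] dC[OF xa(2) st(1)] True by auto
    next
      case False
      then show ?thesis using i by (subst list_coord_length) auto
    qed
    have l2: "list_coord \<zeta> (b # ys) (bC t # drop (Suc i) ?cs) =
        (if drop (Suc i) ?us = ys then (if b = t then 1 else 0) else 0)"
      using lc[OF by'(1) tk(2)] dC[OF by'(2) st(2)] by (auto simp: drop_map)
    have h1: "\<xi> ?w1 (?k i (bD p)) = (if i = length xs then (if ?w1 = p then 1 else 0) else 0)"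
      unfolding D.homogeneous_component[OF \<xi>[OF wk(1)] bp(1)] dD[OF wk(1) pq(1)] lx by simp
    have h2: "\<xi> ?w2 (?k (length ?us - 1 - i) (bD q)) =
        (if length ?us - 1 - i = length ys then (if ?w2 = q then 1 else 0) else 0)"
      unfolding D.homogeneous_component[OF \<xi>[OF wl(1)] bp(2)] dD[OF wl(1) pq(2)] ly by simp
    have "drop (Suc i) ?us = ys \<Longrightarrow> length ?us - 1 - i = length ys" by auto
    then show ?thesis
      unfolding comp_coord_circ[OF k] comp_coord_circ[OF l] ik il l1 l2 h1 h2 by auto
  qed
  have factor: "(\<Sum>p\<in>S. \<Sum>q\<in>T. if c then f p * g q else 0) = (if c then sum f S * sum g T else (0::'k))"
    for S :: "'x set" and T :: "'y set" and f g c
    by (cases c) (simp_all add: sum_product)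
  have "tensor_coord comp_coord comp_coord (k, l) (coprod (composition D C) (comp_basis m)) =
    (\<Sum>i<length ?us. \<Sum>p\<in>splits ?w. \<Sum>q\<in>splits (?us ! i).
      comp_coord k (circ D C (?k i (bD (fst p))) (take i ?cs @ [bC (fst q)])) *
      comp_coord l (circ D C (?k (length ?us - 1 - i) (bD (snd p))) (bC (snd q) # drop (Suc i) ?cs)))"
    unfolding coprod_comp_basis[OF m] tensor_coord_sum
    by (intro sum.cong refl tensor_coord_tens coord_basis_linear[OF X] k l)
  also have "\<dots> = (\<Sum>i<length ?us. \<Sum>p\<in>splits ?w. \<Sum>q\<in>splits (?us ! i).
      if ?cond i then ((if ?w1 = fst p then 1 else 0) * (if ?w2 = snd p then 1 else 0)) *
        ((if a = fst q then 1 else 0) * (if b = snd q then 1 else 0)) else 0)"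
  proof (intro sum.cong refl summand)
    fix i p q assume i: "i \<in> {..<length ?us}" and p: "p \<in> splits ?w" and q: "q \<in> splits (?us ! i)"
    show "i < length ?us" using i by simp
    then have "?us ! i \<in> lists I" using nth_mem[of i ?us] wm(2) by (auto simp: in_lists_conv_set)
    then show "fst q \<in> lists I" "snd q \<in> lists I" using splits_lists[of "?us ! i" I "fst q" "snd q"] q by simp_all
    show "fst p \<in> lists J" "snd p \<in> lists J" using splits_lists[OF wm(1), of "fst p" "snd p"] p by simp_all
  qed
  also have "\<dots> = (\<Sum>i<length ?us. if ?cond i then
      (\<Sum>p\<in>splits ?w. (if ?w1 = fst p then 1 else 0) * (if ?w2 = snd p then 1 else 0)) *
      (\<Sum>q\<in>splits (?us ! i). (if a = fst q then 1 else 0) * (if b = snd q then 1 else 0)) else 0)"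
    by (intro sum.cong refl factor)
  also have "\<dots> = (\<Sum>i<length ?us. if ?cond i then
      (if ?w = ?w1 @ ?w2 then 1 else 0) * (if ?us ! i = a @ b then 1 else 0) else 0)"
    by (simp only: sum_splits_delta[unfolded case_prod_beta])
  also have "\<dots> = (\<Sum>i<length ?us. if i = length xs then
      (if ?w = ?w1 @ ?w2 \<and> ?us = xs @ (a @ b) # ys then 1 else 0) else 0)"
  proof (intro sum.cong refl)
    fix i assume "i \<in> {..<length ?us}"
    then have i: "i < length ?us" by simp
    have us: "take i ?us @ ?us ! i # drop (Suc i) ?us = ?us" by (rule id_take_nth_drop[OF i, symmetric])
    have "(take i ?us @ ?us ! i # drop (Suc i) ?us = xs @ (a @ b) # ys) =
        (take i ?us = xs \<and> ?us ! i = a @ b \<and> drop (Suc i) ?us = ys)" if "i = length xs"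
      using that i by (subst append_eq_append_conv) (simp_all add: list.inject)
    from this[unfolded us] show "(if ?cond i then (if ?w = ?w1 @ ?w2 then 1 else 0) * (if ?us ! i = a @ b then 1 else 0) else 0) =
      (if i = length xs then (if ?w = ?w1 @ ?w2 \<and> ?us = xs @ (a @ b) # ys then 1 else (0::'k)) else 0)" by auto
  qed
  also have "\<dots> = (if ?w = ?w1 @ ?w2 \<and> ?us = xs @ (a @ b) # ys then 1 else 0)"
    by (auto simp: sum.delta)
  also have "(?w = ?w1 @ ?w2 \<and> ?us = xs @ (a @ b) # ys) = (m = k @ l)"
  proof -
    have "outer_word (k @ l) = ?w1 @ ?w2" "inner_words (k @ l) = xs @ (a @ b) # ys"
      by (simp_all add: outer_word_append inner_words_append xs_def a_def b_def ys_def)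
    moreover have "k @ l \<in> lists letters" using k l by simp
    ultimately show ?thesis using comp_words_inj[OF m] by metis
  qed
  finally show ?thesis .
qed

lemma counit_comp_basis:
  assumes k: "k \<in> lists letters"
  shows "counit (composition D C) (comp_basis k) = (if k = [] then 1 else 0)"
proof -
  note w = words[OF k]
  have "counit (composition D C) (comp_basis k) = (if outer_word k = [] then 1 else 0) * prod_list (map (counit C) (map bC (inner_words k)))"
    unfolding comp_basis_def by (simp only: composition_counit[OF gC gD] deconc_counit[OF BD w(1)])
  also have "\<dots> = (if k = [] then 1 else 0)"
  proof (cases "outer_word k = []")
    case True
    then obtain u where u: "k = map Inl u" "inner_words k = [u]" using outer_word_empty by blast
    then have "u \<in> lists I" using w(2) by simp
    then show ?thesis using u True by (simp add: deconc_counit[OF BC])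
  next
    case False
    then show ?thesis by auto
  qed
  finally show ?thesis .
qed

lemma deconc_basis_composition: "deconc_basis (composition D C) letters comp_basis comp_coord"
  by (rule deconc_basisI[OF coord_basis_composition coprod_comp_basis_mem coprod_comp_basis_coords counit_comp_basis])

lemma linear_coprod_composition:
  "linear_on (composition D C) (tensor_prod (composition D C) (composition D C)) (coprod (composition D C))"
proof -
  let ?L = "composition D C"
  note X = coord_basis_composition
  have cop: "coprod ?L (x + y) = coprod ?L x + coprod ?L y" "coprod ?L (fscale a x) = fscale a (coprod ?L x)"
    "coprod ?L 0 = 0" for x y a
    unfolding composition_def by (simp_all only: coalg.simps lift_linear)
  have "coprod ?L x \<in> carrier (tensor_prod ?L ?L)" if "x \<in> carrier ?L" for x
    using that
  proof (induction rule: coord_basis_induct[OF X, consumes 1, case_names zero add])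
    case zero
    show ?case unfolding cop by (rule is_vspaceD(1)[OF is_vspace_tensor_prod])
  next
    case (add c k y)
    have "fscale c (coprod ?L (comp_basis k)) \<in> carrier (tensor_prod ?L ?L)"
      using is_vspaceD(3)[OF is_vspace_tensor_prod coprod_comp_basis_mem[OF add(1)], of c] by (simp only: tensor_prod_simps)
    then show ?case unfolding composition_simps cop
      by (rule is_vspaceD(2)[OF is_vspace_tensor_prod _ add(3)])
  qed
  then show ?thesis unfolding linear_on_def by (simp only: cop composition_simps tensor_prod_simps(2)) simp
qed

lemma linear_counit_composition: "linear_on (composition D C) ground (counit (composition D C))"
  by (simp add: linear_on_ground_iff composition_def comp_space_def)

text \<open>
  The basis vectors for the two kinds of letters are of the two forms in the statement. Conversely, an
  element of either form is primitive by its coordinates. For \<open>\<delta> \<circ> (1 \<cdot> c\<^sub>1 \<cdot> \<dots> \<cdot> c\<^bsub>n-1\<^esub> \<cdot> 1)\<close>, a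
  coordinate at \<open>k\<close> can be nonzero only if \<open>outer_word k\<close> has length one and the first and the last
  inner words are empty, and then \<open>k\<close> is a single letter.
\<close>

lemma primitives_composition:
  "{x. primitive (composition D C) (circ D C (bD []) [bC []]) x} =
    module.span fscale
      ({circ D C \<delta> (bC [] # cs @ [bC []]) | \<delta> cs n.
          n \<ge> 1 \<and> \<delta> \<in> grade D n \<and> primitive D (bD []) \<delta> \<and> set cs \<subseteq> carrier C \<and> length cs = n - 1} \<union>
       {circ D C (bD []) [\<gamma>] | \<gamma>. primitive C (bC []) \<gamma>})"
  (is "?P = module.span fscale (?G1 \<union> ?G2)")
proof -
  interpret F: vector_space "fscale :: 'k \<Rightarrow> ('k, 'd, ('k, 'c) words) tensor \<Rightarrow> _" by (rule vector_space_fscale)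
  note B = deconc_basis_composition and lin = linear_coprod_composition
  have e: "comp_basis [] = circ D C (bD []) [bC []]" by (simp add: comp_basis_def)
  have Pspan: "?P = F.span (comp_basis ` {k \<in> lists letters. length k = 1})"
    using primitives_eq_span[OF B lin] by (simp only: e composition_simps)
  have PD: "primitive D (bD []) x \<longleftrightarrow> x \<in> carrier D \<and> (\<forall>w\<in>lists J. length w \<noteq> 1 \<longrightarrow> \<xi> w x = 0)" for x
    by (rule primitive_iff_coords[OF BD D.linear_coprod])
  have PC: "primitive C (bC []) x \<longleftrightarrow> x \<in> carrier C \<and> (\<forall>w\<in>lists I. length w \<noteq> 1 \<longrightarrow> \<zeta> w x = 0)" for x
    by (rule primitive_iff_coords[OF BC C.linear_coprod])
  have PK: "x \<in> ?P \<longleftrightarrow> x \<in> carrier (comp_space D C) \<and> (\<forall>k\<in>lists letters. length k \<noteq> 1 \<longrightarrow> comp_coord k x = 0)" for x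
    using primitive_iff_coords[OF B lin] by (simp only: e composition_simps mem_Collect_eq)
  have eC: "bC [] \<in> carrier C" by (rule coord_basis_mem[OF XC]) simp
  have e0: "bD [] \<in> grade D 0" using bD[of "[]"] by simp
  have \<zeta>1: "\<zeta> u (bC []) = (if u = [] then 1 else 0)" if "u \<in> lists I" for u
    using coord_basis_dual[OF XC that] by simp
  have \<xi>1: "\<xi> w (bD []) = (if w = [] then 1 else 0)" if "w \<in> lists J" for w
    using coord_basis_dual[OF XD that] by simp
  have "comp_basis k \<in> ?G1 \<union> ?G2" if k: "k \<in> lists letters" "length k = 1" for k
  proof -
    obtain x where x: "k = [x]" "x \<in> letters" using k by (auto simp: length_Suc_conv)
    show ?thesis
    proof (cases x)
      case (Inl i)
      then have i: "i \<in> I" using x by (auto simp: comp_letters_def)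
      have "primitive C (bC []) (bC [i])"
        unfolding PC using i coord_basis_mem[OF XC, of "[i]"] coord_basis_dual[OF XC, of _ "[i]"] by auto
      moreover have "comp_basis k = circ D C (bD []) [bC [i]]" using x Inl by (simp add: comp_basis_def)
      ultimately show ?thesis by blast
    next
      case (Inr p)
      then obtain j us where j: "x = Inr (j, us)" "j \<in> J" "us \<in> lists (lists I)" "length us = deg j - 1"
        using x by (auto simp: comp_letters_def)
      have "primitive D (bD []) (bD [j])"
        unfolding PD using j coord_basis_mem[OF XD, of "[j]"] coord_basis_dual[OF XD, of _ "[j]"] by auto
      moreover have "comp_basis k = circ D C (bD [j]) (bC [] # map bC us @ [bC []])" using x j by (simp add: comp_basis_def)
      moreover have "bD [j] \<in> grade D (deg j)" using bD[of "[j]"] j by simp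
      moreover have "deg j \<ge> 1" using deg[OF j(2)] by simp
      moreover have "length (map bC us) = deg j - 1" using j by simp
      ultimately show ?thesis using bC_mem[OF j(3)] by blast
    qed
  qed
  then have "?P \<subseteq> F.span (?G1 \<union> ?G2)" unfolding Pspan by (intro F.span_mono) blast
  moreover have "F.span (?G1 \<union> ?G2) \<subseteq> ?P"
  proof (rule F.span_minimal)
    show "F.subspace ?P" unfolding Pspan by (rule F.subspace_span)
    have "x \<in> ?P" if G: "x \<in> ?G1" for x
    proof -
      obtain \<delta> cs n where x: "x = circ D C \<delta> (bC [] # cs @ [bC []])" and n: "n \<ge> 1" "\<delta> \<in> grade D n"
        and \<delta>: "primitive D (bD []) \<delta>" and cs: "set cs \<subseteq> carrier C" "length cs = n - 1" using G by blast
      have "x \<in> carrier (comp_space D C)"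
        unfolding x using n cs eC by (intro circ_mem[OF n(2)]) auto
      moreover have "comp_coord k x = 0" if k: "k \<in> lists letters" "length k \<noteq> 1" for k
      proof (rule ccontr)
        assume "comp_coord k x \<noteq> 0"
        then have nz: "\<xi> (outer_word k) \<delta> \<noteq> 0" "list_coord \<zeta> (inner_words k) (bC [] # cs @ [bC []]) \<noteq> 0"
          unfolding x comp_coord_circ[OF k(1)] by auto
        note w = words[OF k(1)]
        have o: "length (outer_word k) = 1" using nz(1) \<delta> w(1) unfolding PD by blast
        obtain u us where u: "inner_words k = u # us" by (cases "inner_words k") auto
        have "u = []" using nz(2) \<zeta>1[of u] w(2) u by (auto split: if_splits)
        then obtain j vs k' where k': "k = Inr (j, vs) # k'"
          using o u by (cases k rule: outer_word.cases) auto
        then have "outer_word k' = []" using o by simp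
        then obtain v where v: "k' = map Inl v" "inner_words k' = [v]" using outer_word_empty by blast
        have ik: "inner_words k = ([] # vs) @ [v]" using k' v by simp
        have len: "length (inner_words k) = length (bC [] # cs @ [bC []])" using nz(2) list_coord_length by blast
        have "list_coord \<zeta> (([] # vs) @ [v]) ((bC [] # cs) @ [bC []]) \<noteq> 0" using nz(2) unfolding ik by simp
        then have "\<zeta> v (bC []) \<noteq> 0" using len unfolding ik by (subst (asm) list_coord_append) auto
        moreover have "v \<in> lists I" using w(2) unfolding ik by auto
        ultimately have "v = []" using \<zeta>1 by (auto split: if_splits)
        then show False using k(2) k' v by simp
      qed
      ultimately show ?thesis unfolding PK by blast
    qed
    moreover have "x \<in> ?P" if G: "x \<in> ?G2" for x
    proof -
      obtain \<gamma> where x: "x = circ D C (bD []) [\<gamma>]" and \<gamma>: "primitive C (bC []) \<gamma>" using G by blast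
      have "x \<in> carrier (comp_space D C)"
        unfolding x using \<gamma> by (intro circ_mem[OF e0]) (auto simp: primitive_def)
      moreover have "comp_coord k x = 0" if k: "k \<in> lists letters" "length k \<noteq> 1" for k
      proof (rule ccontr)
        assume "comp_coord k x \<noteq> 0"
        then have nz: "\<xi> (outer_word k) (bD []) \<noteq> 0" "list_coord \<zeta> (inner_words k) [\<gamma>] \<noteq> 0"
          unfolding x comp_coord_circ[OF k(1)] by auto
        note w = words[OF k(1)]
        have "outer_word k = []" using nz(1) \<xi>1[OF w(1)] by (auto split: if_splits)
        then obtain u where u: "k = map Inl u" "inner_words k = [u]" using outer_word_empty by blast
        then have "\<zeta> u \<gamma> \<noteq> 0" "u \<in> lists I" using nz(2) w(2) by auto
        then have "length u = 1" using \<gamma> unfolding PC by blast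
        then show False using k(2) u by simp
      qed
      ultimately show ?thesis unfolding PK by blast
    qed
    ultimately show "?G1 \<union> ?G2 \<subseteq> ?P" by blast
  qed
  ultimately show ?thesis by blast
qed

lemma cofree_composition: "cofree (composition D C)"
  by (rule cofree_of_deconc_basis[OF deconc_basis_composition linear_coprod_composition linear_counit_composition])

end

section \<open>Composition of cofree coalgebras\<close>

theorem theorem2p4:
  fixes C :: "('k::field_char_0, 'c::ab_group_add) graded_coalg"
    and D :: "('k, 'd::ab_group_add) graded_coalg"
  assumes "connected_graded_coalgebra C" and "connected_graded_coalgebra D"
    and "cofree C" and "cofree D"
  shows "cofree (composition D C) \<and>
    {x. primitive (composition D C) (circ D C (unit_elt D) [unit_elt C]) x} =
      module.span fscale
        ({circ D C \<delta> (unit_elt C # cs @ [unit_elt C]) | \<delta> cs n.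
            n \<ge> 1 \<and> \<delta> \<in> grade D n \<and> primitive D (unit_elt D) \<delta> \<and>
            set cs \<subseteq> carrier C \<and> length cs = n - 1} \<union>
         {circ D C (unit_elt D) [\<gamma>] | \<gamma>. primitive C (unit_elt C) \<gamma>})"
proof -
  have gC: "graded_coalgebra C" and gD: "graded_coalgebra D"
    using assms(1,2) by (simp_all add: connected_graded_coalgebra_def)
  obtain I :: "'c set" and bC \<zeta> where BC: "deconc_basis C I bC \<zeta>"
    using deconc_basis_of_cofree[OF assms(3)] by blast
  obtain J :: "(nat \<times> 'd) set" and bD \<xi> where BD: "deconc_basis D J bD \<xi>" and deg: "\<And>j. j \<in> J \<Longrightarrow> fst j > 0"
    and hD: "\<And>w. w \<in> lists J \<Longrightarrow> bD w \<in> grade D (sum_list (map fst w))"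
      "\<And>w. w \<in> lists J \<Longrightarrow> homogeneous D (\<xi> w) (sum_list (map fst w))"
    using homogeneous_deconc_basis[OF assms(2,4)] by blast
  note hyps = gD gC BD BC deg hD
  show ?thesis
    unfolding unit_elt_deconc(1)[OF assms(1) BC] unit_elt_deconc(1)[OF assms(2) BD]
    using cofree_composition[OF hyps] primitives_composition[OF hyps] by (rule conjI)
qed

end
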